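(* Given vectors $A,B\in\mathbb{R}_+^n$ and a parameter $\varepsilon>0$, there are vectors $A^{(1)},\dots,A^{(s)},B^{(1)},\dots,B^{(s)}\in\mathbb{R}_+^n$ with $s=\mathcal{O}(\frac1\varepsilon\log\frac1\varepsilon+\log n\log\frac1\varepsilon)$ such that (i) for all $i,j\in[n]$ and all $\ell\in[s]$: $\max\{A^{(\ell)}[i],B^{(\ell)}[j]\}\ge A[i]+B[j]$; (ii) for all $i,j\in[n]$ there exists $\ell\in[s]$: $\max\{A^{(\ell)}[i],B^{(\ell)}[j]\}\le(1+\varepsilon)(A[i]+B[j])$. Moreover, such vectors can be computed in time $\mathcal{O}(\frac n\varepsilon\log\frac1\varepsilon+n\log n\log\frac1\varepsilon)$.
   Context: $\mathbb{R}_+=\{a\in\mathbb{R}:a\ge1\}\cup\{\infty\}$, $[n]=\{1,\dots,n\}$. Standing assumption: $0<\varepsilon<1/10$. Time counts arithmetic operations (unit cost on real/floating-point numbers). *)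

theory Defs
  imports Complex_Main "HOL-Library.Extended_Real" "HOL-Library.FuncSet"
begin

definition Rplus :: "ereal set" where
  "Rplus = ereal ` {a. 1 \<le> a} \<union> {\<infinity>}"

text \<open>A vector of length \<open>n\<close> is a function on the naturals of which only the entries
  \<open>1, \<dots>, n\<close> matter; a family of vectors is a function of two arguments, the first one
  being the index of the vector.\<close>

definition sum_to_max_covering ::
  "nat \<Rightarrow> (nat \<Rightarrow> ereal) \<Rightarrow> (nat \<Rightarrow> ereal) \<Rightarrow> real \<Rightarrow>
   nat \<Rightarrow> (nat \<Rightarrow> nat \<Rightarrow> ereal) \<Rightarrow> (nat \<Rightarrow> nat \<Rightarrow> ereal) \<Rightarrow> bool" where
  "sum_to_max_covering n A B \<epsilon> s A' B' \<longleftrightarrow>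
     A' \<in> {1..s} \<rightarrow> {1..n} \<rightarrow> Rplus \<and>
     B' \<in> {1..s} \<rightarrow> {1..n} \<rightarrow> Rplus \<and>
     (\<forall>i\<in>{1..n}. \<forall>j\<in>{1..n}. \<forall>l\<in>{1..s}. max (A' l i) (B' l j) \<ge> A i + B j) \<and>
     (\<forall>i\<in>{1..n}. \<forall>j\<in>{1..n}. \<exists>l\<in>{1..s}.
        max (A' l i) (B' l j) \<le> ereal (1 + \<epsilon>) * (A i + B j))"

text \<open>The model of computation is a unit-cost random access machine, programmed in a while
  language.  Memory consists of named arrays, indexed by naturals, of two kinds: arrays of
  naturals (for counters, indices and pointers) and arrays of numbers.  Numbers are extended
  reals, since \<open>\<infinity>\<close> is a legal vector entry; the machine computes exactly with them, but has
  no rounding, no logarithm and no conversion between the two kinds.  On naturals it only has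
  addition and truncated subtraction.  Every array access, arithmetic operation, constant,
  comparison, Boolean connective, assignment, skip and branch costs one unit.\<close>

type_synonym name = string

datatype iexp =
    INum nat
  | IGet name iexp
  | IAdd iexp iexp
  | ISub iexp iexp

datatype nexp =
    NZero
  | NOne
  | NInf
  | NGet name iexp
  | NAdd nexp nexp
  | NSub nexp nexp
  | NMul nexp nexp
  | NDiv nexp nexp

datatype bexp =
    ILe iexp iexp
  | NLe nexp nexp
  | BNot bexp
  | BAnd bexp bexp

datatype com =
    Skip
  | ISet name iexp iexp
  | NSet name iexp nexp
  | Seq com com
  | Cond bexp com com
  | While bexp com

record state =
  ints :: "name \<Rightarrow> nat \<Rightarrow> nat"
  nums :: "name \<Rightarrow> nat \<Rightarrow> ereal"

primrec ival :: "state \<Rightarrow> iexp \<Rightarrow> nat" where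
  "ival \<sigma> (INum k) = k"
| "ival \<sigma> (IGet x a) = ints \<sigma> x (ival \<sigma> a)"
| "ival \<sigma> (IAdd a b) = ival \<sigma> a + ival \<sigma> b"
| "ival \<sigma> (ISub a b) = ival \<sigma> a - ival \<sigma> b"

primrec nval :: "state \<Rightarrow> nexp \<Rightarrow> ereal" where
  "nval \<sigma> NZero = 0"
| "nval \<sigma> NOne = 1"
| "nval \<sigma> NInf = \<infinity>"
| "nval \<sigma> (NGet x a) = nums \<sigma> x (ival \<sigma> a)"
| "nval \<sigma> (NAdd u v) = nval \<sigma> u + nval \<sigma> v"
| "nval \<sigma> (NSub u v) = nval \<sigma> u - nval \<sigma> v"
| "nval \<sigma> (NMul u v) = nval \<sigma> u * nval \<sigma> v"
| "nval \<sigma> (NDiv u v) = nval \<sigma> u / nval \<sigma> v"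

primrec bval :: "state \<Rightarrow> bexp \<Rightarrow> bool" where
  "bval \<sigma> (ILe a b) = (ival \<sigma> a \<le> ival \<sigma> b)"
| "bval \<sigma> (NLe u v) = (nval \<sigma> u \<le> nval \<sigma> v)"
| "bval \<sigma> (BNot p) = (\<not> bval \<sigma> p)"
| "bval \<sigma> (BAnd p q) = (bval \<sigma> p \<and> bval \<sigma> q)"

primrec icost :: "iexp \<Rightarrow> nat" where
  "icost (INum k) = 1"
| "icost (IGet x a) = icost a + 1"
| "icost (IAdd a b) = icost a + icost b + 1"
| "icost (ISub a b) = icost a + icost b + 1"

primrec ncost :: "nexp \<Rightarrow> nat" where
  "ncost NZero = 1"
| "ncost NOne = 1"
| "ncost NInf = 1"
| "ncost (NGet x a) = icost a + 1"
| "ncost (NAdd u v) = ncost u + ncost v + 1"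
| "ncost (NSub u v) = ncost u + ncost v + 1"
| "ncost (NMul u v) = ncost u + ncost v + 1"
| "ncost (NDiv u v) = ncost u + ncost v + 1"

primrec bcost :: "bexp \<Rightarrow> nat" where
  "bcost (ILe a b) = icost a + icost b + 1"
| "bcost (NLe u v) = ncost u + ncost v + 1"
| "bcost (BNot p) = bcost p + 1"
| "bcost (BAnd p q) = bcost p + bcost q + 1"

definition set_int :: "name \<Rightarrow> nat \<Rightarrow> nat \<Rightarrow> state \<Rightarrow> state" where
  "set_int x k v \<sigma> = \<sigma>\<lparr>ints := (ints \<sigma>)(x := (ints \<sigma> x)(k := v))\<rparr>"

definition set_num :: "name \<Rightarrow> nat \<Rightarrow> ereal \<Rightarrow> state \<Rightarrow> state" where
  "set_num x k v \<sigma> = \<sigma>\<lparr>nums := (nums \<sigma>)(x := (nums \<sigma> x)(k := v))\<rparr>"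

text \<open>\<open>exec c \<sigma> t \<sigma>'\<close>: started in \<open>\<sigma>\<close>, the program \<open>c\<close> terminates in \<open>\<sigma>'\<close> after time \<open>t\<close>.\<close>

inductive exec :: "com \<Rightarrow> state \<Rightarrow> nat \<Rightarrow> state \<Rightarrow> bool" where
  Skip: "exec Skip \<sigma> 1 \<sigma>"
| ISet: "exec (ISet x a b) \<sigma> (icost a + icost b + 1) (set_int x (ival \<sigma> a) (ival \<sigma> b) \<sigma>)"
| NSet: "exec (NSet x a u) \<sigma> (icost a + ncost u + 1) (set_num x (ival \<sigma> a) (nval \<sigma> u) \<sigma>)"
| Seq: "exec c \<sigma> t \<sigma>' \<Longrightarrow> exec d \<sigma>' t' \<sigma>'' \<Longrightarrow> exec (Seq c d) \<sigma> (t + t') \<sigma>''"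
| CondTrue: "bval \<sigma> p \<Longrightarrow> exec c \<sigma> t \<sigma>' \<Longrightarrow> exec (Cond p c d) \<sigma> (bcost p + t + 1) \<sigma>'"
| CondFalse: "\<not> bval \<sigma> p \<Longrightarrow> exec d \<sigma> t \<sigma>' \<Longrightarrow> exec (Cond p c d) \<sigma> (bcost p + t + 1) \<sigma>'"
| WhileFalse: "\<not> bval \<sigma> p \<Longrightarrow> exec (While p c) \<sigma> (bcost p + 1) \<sigma>"
| WhileTrue: "bval \<sigma> p \<Longrightarrow> exec c \<sigma> t \<sigma>' \<Longrightarrow> exec (While p c) \<sigma>' t' \<sigma>'' \<Longrightarrow>
    exec (While p c) \<sigma> (bcost p + t + t' + 1) \<sigma>''"

inductive_cases SkipE: "exec Skip \<sigma> t \<sigma>'"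
inductive_cases ISetE: "exec (ISet x a b) \<sigma> t \<sigma>'"
inductive_cases NSetE: "exec (NSet x a u) \<sigma> t \<sigma>'"
inductive_cases SeqE: "exec (Seq c d) \<sigma> t \<sigma>'"
inductive_cases CondE: "exec (Cond p c d) \<sigma> t \<sigma>'"
inductive_cases WhileE: "exec (While p c) \<sigma> t \<sigma>'"

lemma exec_deterministic:
  "exec c \<sigma> t \<sigma>' \<Longrightarrow> exec c \<sigma> u \<tau> \<Longrightarrow> u = t \<and> \<tau> = \<sigma>'"
proof (induction arbitrary: u \<tau> rule: exec.induct)
  case (Skip \<sigma>)
  then show ?case by (auto elim: SkipE)
next
  case (ISet x a b \<sigma>)
  then show ?case by (auto elim: ISetE)
next
  case (NSet x a b \<sigma>)
  then show ?case by (auto elim: NSetE)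
next
  case (Seq c \<sigma> t \<sigma>' d t' \<sigma>'')
  from Seq.prems obtain v w \<rho> where "u = v + w" "exec c \<sigma> v \<rho>" "exec d \<rho> w \<tau>"
    by (rule SeqE)
  then show ?case using Seq.IH by metis
next
  case (CondTrue \<sigma> p c t \<sigma>' d)
  from CondTrue.prems show ?case
    by (rule CondE) (use CondTrue.hyps(1) CondTrue.IH in simp_all)
next
  case (CondFalse \<sigma> p d t \<sigma>' c)
  from CondFalse.prems show ?case
    by (rule CondE) (use CondFalse.hyps(1) CondFalse.IH in simp_all)
next
  case (WhileFalse \<sigma> p c)
  from WhileFalse.prems show ?case
    by (rule WhileE) (use WhileFalse.hyps in simp_all)
next
  case (WhileTrue \<sigma> p c t \<sigma>' t' \<sigma>'')
  from WhileTrue.prems obtain v w \<rho>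
    where "u = bcost p + v + w + 1" "exec c \<sigma> v \<rho>" "exec (While p c) \<rho> w \<tau>"
    by (rule WhileE) (use WhileTrue.hyps(1) in simp_all)
  then show ?case using WhileTrue.IH by metis
qed

text \<open>Input: the length \<open>n\<close>, the parameter \<open>\<epsilon>\<close> and the two vectors; all other memory is zero.\<close>

definition input_state :: "nat \<Rightarrow> (nat \<Rightarrow> ereal) \<Rightarrow> (nat \<Rightarrow> ereal) \<Rightarrow> real \<Rightarrow> state" where
  "input_state n A B \<epsilon> =
     \<lparr>ints = (\<lambda>x k. if x = ''n'' \<and> k = 0 then n else 0),
      nums = (\<lambda>x k. if x = ''eps'' \<and> k = 0 then ereal \<epsilon>
                     else if x = ''A'' \<and> k \<in> {1..n} then A k
                     else if x = ''B'' \<and> k \<in> {1..n} then B k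
                     else 0)\<rparr>"

text \<open>Output: the number of vectors, and each of the two families of vectors of length \<open>n\<close>
  stored consecutively in one array, so that entry \<open>i\<close> of vector \<open>l\<close> is in cell
  \<open>(l - 1) * n + i\<close>.\<close>

definition output_size :: "state \<Rightarrow> nat" where
  "output_size \<sigma> = ints \<sigma> ''s'' 0"

definition output_vectors :: "name \<Rightarrow> nat \<Rightarrow> state \<Rightarrow> nat \<Rightarrow> nat \<Rightarrow> ereal" where
  "output_vectors x n \<sigma> l i = nums \<sigma> x ((l - 1) * n + i)"

end

theory Submission
  imports Defs
begin

text \<open>Call a pair of values close if their ratio lies between \<open>\<epsilon>\<^sup>3\<close> and \<open>\<epsilon>\<^sup>-\<^sup>3\<close>.  For every
  \<open>\<theta> > 0\<close> we have \<open>a + b \<le> max {(1 + \<theta>) a, (1 + 1/\<theta>) b}\<close>, and this is tight up to a factor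
  \<open>1 + \<epsilon>\<close> if \<open>\<theta> \<le> b/a \<le> (1 + \<epsilon>) \<theta>\<close>.  Hence letting \<open>\<theta>\<close> and \<open>1/\<theta>\<close> run through the powers of
  \<open>1 + \<epsilon>\<close> up to \<open>\<epsilon>\<^sup>-\<^sup>3\<close> covers all close pairs with \<open>O(1/\<epsilon> log 1/\<epsilon>)\<close> vectors.

  If \<open>a \<le> \<epsilon> b\<close> or \<open>b \<le> \<epsilon> a\<close>, then \<open>a + b \<le> (1 + \<epsilon>) max {a, b}\<close>.  So it remains to find few
  products of index sets which only contain such pairs and which contain all pairs that are not
  close.  The values are sorted and cut into numbered groups, so that group numbers differing by
  at least 2 force a ratio beyond \<open>1/\<epsilon>\<close>, and group numbers differing by at most 1 force a close
  pair.  For each of the three residues mod 3, drop the groups with that residue; two of the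
  remaining chunks are then always at distance at least 2, and two different chunks are told apart
  by some bit of the chunk number.  Taking \<open>A\<close> from the chunks with bit 0 and \<open>B\<close> from
  those with bit 1, and vice versa, gives \<open>O(log n)\<close> further vectors.  Since the machine cannot
  divide naturals, the bits are read off from a table of halves and parities, and the merge
  sort works on an array that is padded with \<open>\<infinity>\<close> to a power of two.\<close>

section \<open>Timed execution\<close>

text \<open>Total correctness with a time budget. The existential form is as strong as a universal
  one, because execution is deterministic (\<open>exec_deterministic\<close>), and it makes
  termination part of the claim.\<close>

definition runs :: "com \<Rightarrow> nat \<Rightarrow> state \<Rightarrow> (state \<Rightarrow> bool) \<Rightarrow> bool" where
  "runs c T \<sigma> Q \<longleftrightarrow> (\<exists>t \<sigma>'. exec c \<sigma> t \<sigma>' \<and> t \<le> T \<and> Q \<sigma>')"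

lemma runs_mono:
  assumes "runs c T \<sigma> Q" "T \<le> T'" "\<And>\<sigma>'. Q \<sigma>' \<Longrightarrow> Q' \<sigma>'"
  shows "runs c T' \<sigma> Q'"
  using assms unfolding runs_def by (meson order_trans)

lemma runs_Seq:
  assumes "runs c T \<sigma> (\<lambda>\<sigma>'. runs d T' \<sigma>' Q)"
  shows "runs (Seq c d) (T + T') \<sigma> Q"
  using assms unfolding runs_def by (meson exec.Seq add_mono)

text \<open>The number \<open>N\<close> of rounds is fixed beforehand and the invariant is indexed
  by the rounds already done, so termination comes with the invariant. The guard is evaluated once
  more often than the body, whence the summand outside the product.\<close>

lemma runs_While:
  assumes step: "\<And>k \<sigma>. k < N \<Longrightarrow> I k \<sigma> \<Longrightarrow> bval \<sigma> p \<and> runs c T \<sigma> (I (Suc k))"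
    and stop: "\<And>\<sigma>. I N \<sigma> \<Longrightarrow> \<not> bval \<sigma> p"
    and start: "I 0 \<sigma>"
    and fin: "\<And>\<sigma>. I N \<sigma> \<Longrightarrow> Q \<sigma>"
    and time: "N * (T + bcost p + 1) + bcost p + 1 \<le> T'"
  shows "runs (While p c) T' \<sigma> Q"
proof -
  \<comment> \<open>Induction on the number \<open>k\<close> of rounds still to be done.\<close>
  have "k \<le> N \<Longrightarrow> I (N - k) \<sigma> \<Longrightarrow>
      runs (While p c) (k * (T + bcost p + 1) + bcost p + 1) \<sigma> (I N)" for k \<sigma>
  proof (induction k arbitrary: \<sigma>)
    case 0
    then show ?case using stop unfolding runs_def by (auto intro!: exI exec.WhileFalse)
  next
    case (Suc k)
    then have "N - Suc k < N" and S: "Suc (N - Suc k) = N - k" by auto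
    from step[OF this(1) Suc.prems(2)] obtain t \<sigma>' where p: "bval \<sigma> p"
      and c: "exec c \<sigma> t \<sigma>'" "t \<le> T" "I (N - k) \<sigma>'"
      unfolding runs_def S by blast
    from Suc.IH[OF _ c(3)] Suc.prems obtain t' \<sigma>''
      where w: "exec (While p c) \<sigma>' t' \<sigma>''" "t' \<le> k * (T + bcost p + 1) + bcost p + 1" "I N \<sigma>''"
      unfolding runs_def by auto
    have "exec (While p c) \<sigma> (bcost p + t + t' + 1) \<sigma>''"
      by (rule exec.WhileTrue[OF p c(1) w(1)])
    moreover have "bcost p + t + t' + 1 \<le> Suc k * (T + bcost p + 1) + bcost p + 1"
      using c(2) w(2) by simp
    ultimately show ?case using w(3) unfolding runs_def by blast
  qed
  from runs_mono[OF this[of N] time fin] start show ?thesis by simp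
qed

section \<open>Frame conditions and loop-free programs\<close>

primrec written_ints :: "com \<Rightarrow> name set" where
  "written_ints Skip = {}"
| "written_ints (ISet x a b) = {x}"
| "written_ints (NSet x a u) = {}"
| "written_ints (Seq c d) = written_ints c \<union> written_ints d"
| "written_ints (Cond p c d) = written_ints c \<union> written_ints d"
| "written_ints (While p c) = written_ints c"

primrec written_nums :: "com \<Rightarrow> name set" where
  "written_nums Skip = {}"
| "written_nums (ISet x a b) = {}"
| "written_nums (NSet x a u) = {x}"
| "written_nums (Seq c d) = written_nums c \<union> written_nums d"
| "written_nums (Cond p c d) = written_nums c \<union> written_nums d"
| "written_nums (While p c) = written_nums c"

text \<open>Frames are as coarse as whole arrays: once one cell of an array is written, the rest of
  that array has to be tracked by the postconditions.\<close>

definition same_except :: "name set \<Rightarrow> name set \<Rightarrow> state \<Rightarrow> state \<Rightarrow> bool" where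
  "same_except X Y \<sigma> \<sigma>' \<longleftrightarrow>
     (\<forall>x. x \<notin> X \<longrightarrow> ints \<sigma>' x = ints \<sigma> x) \<and> (\<forall>y. y \<notin> Y \<longrightarrow> nums \<sigma>' y = nums \<sigma> y)"

lemma same_except_ints: "same_except X Y \<sigma> \<sigma>' \<Longrightarrow> x \<notin> X \<Longrightarrow> ints \<sigma>' x = ints \<sigma> x"
  by (simp add: same_except_def)

lemma same_except_nums: "same_except X Y \<sigma> \<sigma>' \<Longrightarrow> y \<notin> Y \<Longrightarrow> nums \<sigma>' y = nums \<sigma> y"
  by (simp add: same_except_def)

lemma ints_set_int [simp]:
  "ints (set_int x k v \<sigma>) y = (if y = x then (ints \<sigma> x)(k := v) else ints \<sigma> y)"
  by (simp add: set_int_def)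

lemma nums_set_int [simp]: "nums (set_int x k v \<sigma>) = nums \<sigma>"
  by (simp add: set_int_def)

lemma nums_set_num [simp]:
  "nums (set_num x k v \<sigma>) y = (if y = x then (nums \<sigma> x)(k := v) else nums \<sigma> y)"
  by (simp add: set_num_def)

lemma ints_set_num [simp]: "ints (set_num x k v \<sigma>) = ints \<sigma>"
  by (simp add: set_num_def)

lemma exec_same_except:
  "exec c \<sigma> t \<sigma>' \<Longrightarrow> same_except (written_ints c) (written_nums c) \<sigma> \<sigma>'"
  by (induction rule: exec.induct) (auto simp: same_except_def)

lemma runs_frame:
  assumes "runs c T \<sigma> Q"
  shows "runs c T \<sigma> (\<lambda>\<sigma>'. Q \<sigma>' \<and> same_except (written_ints c) (written_nums c) \<sigma> \<sigma>')"
  using assms exec_same_except unfolding runs_def by blast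

text \<open>Loop-free programs are total and admit a denotation \<open>effect\<close> and a state-independent
  time bound \<open>maxcost\<close>; both are junk on loops.\<close>

primrec loop_free :: "com \<Rightarrow> bool" where
  "loop_free Skip = True"
| "loop_free (ISet x a b) = True"
| "loop_free (NSet x a u) = True"
| "loop_free (Seq c d) = (loop_free c \<and> loop_free d)"
| "loop_free (Cond p c d) = (loop_free c \<and> loop_free d)"
| "loop_free (While p c) = False"

primrec effect :: "com \<Rightarrow> state \<Rightarrow> state" where
  "effect Skip \<sigma> = \<sigma>"
| "effect (ISet x a b) \<sigma> = set_int x (ival \<sigma> a) (ival \<sigma> b) \<sigma>"
| "effect (NSet x a u) \<sigma> = set_num x (ival \<sigma> a) (nval \<sigma> u) \<sigma>"
| "effect (Seq c d) \<sigma> = effect d (effect c \<sigma>)"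
| "effect (Cond p c d) \<sigma> = (if bval \<sigma> p then effect c \<sigma> else effect d \<sigma>)"
| "effect (While p c) \<sigma> = \<sigma>"

primrec maxcost :: "com \<Rightarrow> nat" where
  "maxcost Skip = 1"
| "maxcost (ISet x a b) = icost a + icost b + 1"
| "maxcost (NSet x a u) = icost a + ncost u + 1"
| "maxcost (Seq c d) = maxcost c + maxcost d"
| "maxcost (Cond p c d) = bcost p + maxcost c + maxcost d + 1"
| "maxcost (While p c) = 0"

lemma exec_effect: "loop_free c \<Longrightarrow> \<exists>t. exec c \<sigma> t (effect c \<sigma>) \<and> t \<le> maxcost c"
proof (induction c arbitrary: \<sigma>)
  case (Seq c d)
  from Seq.prems have "loop_free c" "loop_free d" by auto
  from Seq.IH(1)[OF this(1)] Seq.IH(2)[OF this(2)] show ?case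
    by simp (meson exec.Seq add_mono)
next
  case (Cond p c d)
  from Cond.prems have "loop_free c" "loop_free d" by auto
  from Cond.IH(1)[OF this(1), of \<sigma>] Cond.IH(2)[OF this(2), of \<sigma>] obtain t u
    where "exec c \<sigma> t (effect c \<sigma>)" "t \<le> maxcost c"
      "exec d \<sigma> u (effect d \<sigma>)" "u \<le> maxcost d" by auto
  then show ?case
    by (cases "bval \<sigma> p")
      (force intro: exec.CondTrue, force intro: exec.CondFalse)
qed (auto intro: exec.intros)

text \<open>The second program may use the frame of the first, so the intermediate condition
  \<open>P\<close> only has to describe arrays that were written.\<close>

lemma runs_SeqI:
  assumes "runs c T \<sigma> P"
    and "\<And>\<sigma>'. P \<sigma>' \<Longrightarrow> same_except (written_ints c) (written_nums c) \<sigma> \<sigma>' \<Longrightarrow> runs d T' \<sigma>' Q"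
    and "T + T' \<le> T''"
  shows "runs (Seq c d) T'' \<sigma> Q"
proof -
  have "runs c T \<sigma> (\<lambda>\<sigma>'. runs d T' \<sigma>' Q)"
    by (rule runs_mono[OF runs_frame[OF assms(1)]]) (simp_all add: assms(2))
  from runs_mono[OF runs_Seq[OF this] assms(3)] show ?thesis by simp
qed

lemma runs_loop_free:
  assumes "loop_free c" "Q (effect c \<sigma>)" "maxcost c \<le> T"
  shows "runs c T \<sigma> Q"
  using exec_effect[OF assms(1), of \<sigma>] assms(2,3) unfolding runs_def by (meson order_trans)

section \<open>Counting loops\<close>

abbreviation IVar :: "name \<Rightarrow> iexp" where "IVar x \<equiv> IGet x (INum 0)"
abbreviation NVar :: "name \<Rightarrow> nexp" where "NVar x \<equiv> NGet x (INum 0)"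
abbreviation ILess :: "iexp \<Rightarrow> iexp \<Rightarrow> bexp" where "ILess a b \<equiv> BNot (ILe b a)"

definition For :: "name \<Rightarrow> nat \<Rightarrow> iexp \<Rightarrow> com \<Rightarrow> com" where
  "For x lo b c = Seq (ISet x (INum 0) (INum lo))
     (While (ILess (IVar x) b) (Seq c (ISet x (INum 0) (IAdd (IVar x) (INum 1)))))"

lemma written_For [simp]:
  "written_ints (For x lo b c) = insert x (written_ints c)"
  "written_nums (For x lo b c) = written_nums c"
  by (auto simp: For_def)

text \<open>\<open>I k\<close> speaks about the state in which the counter already holds
  \<open>k\<close>; hence a round has to establish \<open>I (Suc k)\<close> for the incremented
  counter. The bound \<open>b\<close> is evaluated anew in each round and must therefore keep its
  value throughout the frame.\<close>

lemma runs_For: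
  fixes \<sigma>0 :: state and I :: "nat \<Rightarrow> state \<Rightarrow> bool" and x :: name and c :: com
  defines "fr \<equiv> same_except (insert x (written_ints c)) (written_nums c) \<sigma>0"
  assumes "lo \<le> hi"
    and bound: "\<And>\<sigma>. fr \<sigma> \<Longrightarrow> ival \<sigma> b = hi"
    and x: "x \<notin> written_ints c"
    and start: "I lo (set_int x 0 lo \<sigma>0)"
    and step: "\<And>k \<sigma>. lo \<le> k \<Longrightarrow> k < hi \<Longrightarrow> fr \<sigma> \<Longrightarrow> ints \<sigma> x 0 = k \<Longrightarrow> I k \<sigma> \<Longrightarrow>
        runs c T \<sigma> (\<lambda>\<sigma>'. I (Suc k) (set_int x 0 (Suc k) \<sigma>'))"
    and fin: "\<And>\<sigma>. fr \<sigma> \<Longrightarrow> ints \<sigma> x 0 = hi \<Longrightarrow> I hi \<sigma> \<Longrightarrow> Q \<sigma>"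
    and time: "(hi - lo) * (T + icost b + 11) + icost b + 8 \<le> T'"
  shows "runs (For x lo b c) T' \<sigma>0 Q"
proof -
  let ?inc = "ISet x (INum 0) (IAdd (IVar x) (INum 1))"
  let ?J = "\<lambda>k \<sigma>. fr \<sigma> \<and> ints \<sigma> x 0 = lo + k \<and> I (lo + k) \<sigma>"
  \<comment> \<open>A round costs \<open>T\<close> for the body, 6 for the increment,
    \<open>icost b + 4\<close> for the guard and 1 for the loop itself, together
    \<open>T + icost b + 11\<close>; the initial assignment costs 3.\<close>
  have "runs (While (ILess (IVar x) b) (Seq c ?inc))
     ((hi - lo) * ((T + 6) + bcost (ILess (IVar x) b) + 1) + bcost (ILess (IVar x) b) + 1)
     (set_int x 0 lo \<sigma>0) (?J (hi - lo))"
  proof (rule runs_While[where I = ?J and N = "hi - lo" and T = "T + 6"])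
    fix k \<sigma> assume k: "k < hi - lo" and J: "?J k \<sigma>"
    then have f: "fr \<sigma>" and i: "ints \<sigma> x 0 = lo + k" by auto
    have b: "bval \<sigma> (ILess (IVar x) b)" using k i bound[OF f] by simp
    from runs_frame[OF step[OF _ _ f i]] k J
    have "runs c T \<sigma> (\<lambda>\<sigma>'. I (Suc (lo + k)) (set_int x 0 (Suc (lo + k)) \<sigma>') \<and>
        same_except (written_ints c) (written_nums c) \<sigma> \<sigma>')" by simp
    then have "runs c T \<sigma> (\<lambda>\<sigma>'. runs ?inc 6 \<sigma>' (?J (Suc k)))"
    proof (rule runs_mono)
      fix \<sigma>' assume *: "I (Suc (lo + k)) (set_int x 0 (Suc (lo + k)) \<sigma>') \<and>
        same_except (written_ints c) (written_nums c) \<sigma> \<sigma>'"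
      then have i': "ints \<sigma>' x 0 = lo + k" using x i by (simp add: same_except_def)
      have "fr (set_int x 0 (Suc (lo + k)) \<sigma>')"
        using f * unfolding fr_def same_except_def by simp
      with * i' show "runs ?inc 6 \<sigma>' (?J (Suc k))" by (intro runs_loop_free) simp_all
    qed simp
    from runs_Seq[OF this] b show "bval \<sigma> (ILess (IVar x) b) \<and> runs (Seq c ?inc) (T + 6) \<sigma> (?J (Suc k))"
      by simp
  next
    fix \<sigma> assume "?J (hi - lo) \<sigma>"
    with bound[of \<sigma>] \<open>lo \<le> hi\<close> show "\<not> bval \<sigma> (ILess (IVar x) b)" by simp
  next
    show "?J 0 (set_int x 0 lo \<sigma>0)" using start by (simp add: fr_def same_except_def)
  qed simp_all
  then have "runs (ISet x (INum 0) (INum lo)) 3 \<sigma>0 (\<lambda>\<sigma>. runs (While (ILess (IVar x) b) (Seq c ?inc))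
     ((hi - lo) * ((T + 6) + bcost (ILess (IVar x) b) + 1) + bcost (ILess (IVar x) b) + 1) \<sigma> (?J (hi - lo)))"
    by - (rule runs_loop_free, simp_all)
  from runs_Seq[OF this] have "runs (For x lo b c) (3 +
     ((hi - lo) * ((T + 6) + bcost (ILess (IVar x) b) + 1) + bcost (ILess (IVar x) b) + 1))
     \<sigma>0 (?J (hi - lo))" by (simp add: For_def)
  then show ?thesis
  proof (rule runs_mono)
    show "3 + ((hi - lo) * (T + 6 + bcost (ILess (IVar x) b) + 1) + bcost (ILess (IVar x) b) + 1) \<le> T'"
      using time by (simp add: algebra_simps)
  qed (use \<open>lo \<le> hi\<close> fin in auto)
qed

section \<open>Coverings by scaled vectors\<close>

lemma Rplus_cases:
  assumes "a \<in> Rplus"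
  obtains "a = \<infinity>" | x where "a = ereal x" "1 \<le> x"
  using assms unfolding Rplus_def by auto

lemma Rplus_ge_0: "a \<in> Rplus \<Longrightarrow> 0 \<le> a"
  by (auto simp: Rplus_def)

lemma Rplus_scale: "a \<in> Rplus \<Longrightarrow> 1 \<le> x \<Longrightarrow> a * ereal x \<in> Rplus"
  using mult_mono[of 1 _ 1 x] by (auto simp: Rplus_def ereal_mult_eq_PInfty)

text \<open>Requirement (i) is a property of each pair of vectors on its own, while requirement (ii)
  asks for one suitable vector per index pair. Separating them into \<open>valid_pair\<close> and
  \<open>covers\<close> allows the vectors to be emitted one at a time.\<close>

definition valid_pair ::
  "nat \<Rightarrow> (nat \<Rightarrow> ereal) \<Rightarrow> (nat \<Rightarrow> ereal) \<Rightarrow> (nat \<Rightarrow> ereal) \<Rightarrow> (nat \<Rightarrow> ereal) \<Rightarrow> bool" where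
  "valid_pair n A B a b \<longleftrightarrow> a \<in> {1..n} \<rightarrow> Rplus \<and> b \<in> {1..n} \<rightarrow> Rplus \<and>
     (\<forall>i\<in>{1..n}. \<forall>j\<in>{1..n}. A i + B j \<le> max (a i) (b j))"

definition covers :: "real \<Rightarrow> ereal \<Rightarrow> ereal \<Rightarrow> ereal \<Rightarrow> ereal \<Rightarrow> bool" where
  "covers \<epsilon> a b a' b' \<longleftrightarrow> max a' b' \<le> ereal (1 + \<epsilon>) * (a + b)"

lemma covers_infinite:
  assumes "a \<in> Rplus" "b \<in> Rplus" "a = \<infinity> \<or> b = \<infinity>" "0 < \<epsilon>"
  shows "covers \<epsilon> a b a' b'"
proof -
  have "a + b = \<infinity>" using assms(1-3) by (auto simp: Rplus_def)
  moreover have "ereal (1 + \<epsilon>) * \<infinity> = \<infinity>" using \<open>0 < \<epsilon>\<close> by simp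
  ultimately show ?thesis by (simp only: covers_def top_ereal_def[symmetric] top_greatest)
qed

subsection \<open>Pairs of comparable size\<close>

text \<open>Both scaled values equal the sum when \<open>b = \<theta> * a\<close>; on either side of
  this ray one of them exceeds it.\<close>

lemma theta_split:
  assumes "a \<in> Rplus" "b \<in> Rplus" "0 < \<theta>"
  shows "a + b \<le> max (a * ereal (1 + \<theta>)) (b * ereal (1 + 1 / \<theta>))"
proof (cases "a = \<infinity> \<or> b = \<infinity>")
  case True
  have "0 < 1 + 1 / \<theta>" using assms(3) by (simp add: add_pos_pos)
  then show ?thesis using True assms by (auto simp: max_def)
next
  case False
  with assms(1,2) obtain x y where xy: "a = ereal x" "b = ereal y" "1 \<le> x" "1 \<le> y"
    by (auto elim!: Rplus_cases)
  have "x + y \<le> max (x * (1 + \<theta>)) (y * (1 + 1 / \<theta>))"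
  proof (cases "y \<le> \<theta> * x")
    case True
    then show ?thesis by (simp add: algebra_simps max.coboundedI1)
  next
    case False
    then have "x \<le> y / \<theta>" using assms(3) by (simp add: field_simps)
    then show ?thesis by (simp add: algebra_simps max.coboundedI2)
  qed
  then show ?thesis by (simp add: xy flip: ereal_max)
qed

text \<open>The lower bound on \<open>y\<close> keeps the first entry below the sum itself. The
  upper bound says \<open>y / \<theta> \<le> (1 + \<epsilon>) * x\<close>, so only the second entry
  uses up the factor.\<close>

lemma theta_covers:
  assumes "1 \<le> x" "1 \<le> y" "0 < \<theta>" "0 < \<epsilon>" "\<theta> * x \<le> y" "y \<le> (1 + \<epsilon>) * \<theta> * x"
  shows "covers \<epsilon> (ereal x) (ereal y) (ereal x * ereal (1 + \<theta>)) (ereal y * ereal (1 + 1 / \<theta>))"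
proof -
  have "x * (1 + \<theta>) \<le> x + y" using assms by (simp add: algebra_simps)
  also have "\<dots> \<le> (1 + \<epsilon>) * (x + y)" using assms by simp
  finally have 1: "x * (1 + \<theta>) \<le> (1 + \<epsilon>) * (x + y)" .
  have "y / \<theta> \<le> (1 + \<epsilon>) * x" using assms by (simp add: field_simps)
  moreover have "0 \<le> \<epsilon> * y" using assms by simp
  ultimately have 2: "y * (1 + 1 / \<theta>) \<le> (1 + \<epsilon>) * (x + y)" by (simp add: algebra_simps)
  from 1 2 show ?thesis by (simp add: covers_def flip: ereal_max)
qed

lemma theta_covers_swap:
  assumes "1 \<le> x" "1 \<le> y" "0 < \<theta>" "0 < \<epsilon>" "\<theta> * y \<le> x" "x \<le> (1 + \<epsilon>) * \<theta> * y"
  shows "covers \<epsilon> (ereal x) (ereal y) (ereal x * ereal (1 + 1 / \<theta>)) (ereal y * ereal (1 + \<theta>))"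
  using theta_covers[OF assms(2,1,3-)] by (simp add: covers_def max.commute add.commute)

text \<open>The exponent is the integer part of the logarithm of \<open>z\<close> to base
  \<open>q\<close>, found as the predecessor of the least exponent whose power exceeds
  \<open>z\<close>.\<close>

lemma power_bracket:
  fixes q z :: real
  assumes "1 < q" "1 \<le> z"
  obtains k where "q ^ k \<le> z" "z < q * q ^ k"
proof -
  obtain m where "z < q ^ m" using assms(1) real_arch_pow by blast
  then have ex: "\<exists>m. z < q ^ m" ..
  define m where "m = (LEAST m. z < q ^ m)"
  have m: "z < q ^ m" unfolding m_def by (rule LeastI_ex[OF ex])
  with assms(2) have "m \<noteq> 0" by (cases m) auto
  then obtain k where k: "m = Suc k" by (cases m) auto
  have "\<not> z < q ^ k" using not_less_Least[of k "\<lambda>m. z < q ^ m"] k m_def by auto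
  with m k that[of k] show thesis by auto
qed

text \<open>The number of rounds of the loop for close pairs: the first exponent at which its guard
  fails. It is about \<open>3 * log (1 + \<epsilon>) (1 / \<epsilon>)\<close>, but is characterised
  through the guard since the machine has no logarithm.\<close>

definition thetas :: "real \<Rightarrow> nat" where
  "thetas \<epsilon> = (LEAST k. 1 < \<epsilon> ^ 3 * (1 + \<epsilon>) ^ k)"

lemma thetas_stop: assumes "0 < \<epsilon>" shows "1 < \<epsilon> ^ 3 * (1 + \<epsilon>) ^ thetas \<epsilon>"
proof -
  obtain m where "1 / \<epsilon> ^ 3 < (1 + \<epsilon>) ^ m" using assms real_arch_pow[of "1 + \<epsilon>"] by auto
  then have "1 < \<epsilon> ^ 3 * (1 + \<epsilon>) ^ m" using assms by (simp add: field_simps)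
  then show ?thesis unfolding thetas_def by (rule LeastI)
qed

lemma thetas_go: "k < thetas \<epsilon> \<Longrightarrow> \<epsilon> ^ 3 * (1 + \<epsilon>) ^ k \<le> 1"
  using not_less_Least[of k] unfolding thetas_def by fastforce

lemma thetas_less:
  assumes "0 < \<epsilon>" "\<epsilon> ^ 3 * (1 + \<epsilon>) ^ k \<le> 1" shows "k < thetas \<epsilon>"
proof (rule ccontr)
  assume "\<not> k < thetas \<epsilon>"
  then have "(1 + \<epsilon>) ^ thetas \<epsilon> \<le> (1 + \<epsilon>) ^ k" using assms(1) by (intro power_increasing) auto
  then have "\<epsilon> ^ 3 * (1 + \<epsilon>) ^ thetas \<epsilon> \<le> \<epsilon> ^ 3 * (1 + \<epsilon>) ^ k" using assms(1) by simp
  with thetas_stop[OF assms(1)] assms(2) show False by linarith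
qed

text \<open>All exponents but the last satisfy the guard, so their powers are at most
  \<open>(1 / \<epsilon>) ^ 3\<close>; taking logarithms bounds them. The two other claims serve to
  absorb additive constants into the bounds.\<close>

lemma thetas_bound:
  assumes "0 < \<epsilon>" "\<epsilon> < 1 / 10"
  shows "real (thetas \<epsilon>) \<le> 7 * (1 / \<epsilon> * log 2 (1 / \<epsilon>))" and "1 \<le> 1 / \<epsilon> * log 2 (1 / \<epsilon>)"
    and "1 \<le> log 2 (1 / \<epsilon>)"
proof -
  have e: "2 < 1 / \<epsilon>" using assms by (simp add: field_simps)
  then have "log 2 2 \<le> log 2 (1 / \<epsilon>)" using assms(1) by (subst log_le_cancel_iff) auto
  then show l: "1 \<le> log 2 (1 / \<epsilon>)" by simp
  then show X: "1 \<le> 1 / \<epsilon> * log 2 (1 / \<epsilon>)" using e assms mult_mono[of 1 "1 / \<epsilon>" 1 "log 2 (1 / \<epsilon>)"] by linarith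
  show "real (thetas \<epsilon>) \<le> 7 * (1 / \<epsilon> * log 2 (1 / \<epsilon>))"
  proof (cases "thetas \<epsilon>")
    case 0
    then show ?thesis using X by linarith
  next
    case (Suc k)
    have "\<epsilon> ^ 3 * (1 + \<epsilon>) ^ k \<le> 1" by (rule thetas_go) (simp add: Suc)
    then have "(1 + \<epsilon>) ^ k \<le> (1 / \<epsilon>) ^ 3" using assms by (simp add: field_simps)
    then have "ln ((1 + \<epsilon>) ^ k) \<le> ln ((1 / \<epsilon>) ^ 3)" using assms by (subst ln_le_cancel_iff) auto
    then have 1: "real k * ln (1 + \<epsilon>) \<le> 3 * ln (1 / \<epsilon>)"
      using assms by (simp add: ln_realpow)
    \<comment> \<open>The quadratic lower bound for the logarithm gives
      \<open>\<epsilon> / 2 \<le> ln (1 + \<epsilon>)\<close>, because \<epsilon> is below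
      1/2.\<close>
    have "\<epsilon> - \<epsilon>\<^sup>2 \<le> ln (1 + \<epsilon>)" using assms by (intro ln_one_plus_pos_lower_bound) auto
    moreover have "\<epsilon>\<^sup>2 \<le> \<epsilon> / 2" using assms mult_left_mono[of \<epsilon> "1/2" \<epsilon>] by (simp add: power2_eq_square)
    ultimately have "\<epsilon> / 2 \<le> ln (1 + \<epsilon>)" by linarith
    then have "real k * (\<epsilon> / 2) \<le> real k * ln (1 + \<epsilon>)" by (rule mult_left_mono) simp
    with 1 have "real k * (\<epsilon> / 2) \<le> 3 * ln (1 / \<epsilon>)" by linarith
    moreover have "ln (1 / \<epsilon>) \<le> log 2 (1 / \<epsilon>)"
    proof -
      have "0 \<le> log 2 (1 / \<epsilon>)" using l by linarith
      moreover have "ln (2::real) \<le> 1" using ln_2_less_1 by linarith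
      moreover have "ln (1 / \<epsilon>) = ln 2 * log 2 (1 / \<epsilon>)" by (simp add: log_def)
      ultimately show ?thesis using mult_right_mono[of "ln 2" 1 "log 2 (1/\<epsilon>)"] by simp
    qed
    ultimately have "real k * (\<epsilon> / 2) \<le> 3 * log 2 (1 / \<epsilon>)" by linarith
    then have "real k \<le> 6 * (1 / \<epsilon> * log 2 (1 / \<epsilon>))" using assms by (simp add: field_simps)
    \<comment> \<open>The bound 6 concerns the last exponent \<open>k\<close> that passes the guard;
      the seventh unit pays for the successor.\<close>
    then show ?thesis using X Suc by simp
  qed
qed

text \<open>Take the largest power of \<open>1 + \<epsilon>\<close> not exceeding
  \<open>y / x\<close>. As \<open>y / x\<close> is at most \<epsilon> to the power -3, the guard
  still holds for this power.\<close>

lemma close_pair_theta: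
  assumes "0 < \<epsilon>" "1 \<le> x" "x \<le> y" "\<epsilon> ^ 3 * y \<le> x"
  obtains k where "k < thetas \<epsilon>" "(1 + \<epsilon>) ^ k * x \<le> y" "y \<le> (1 + \<epsilon>) * (1 + \<epsilon>) ^ k * x"
proof -
  have "1 \<le> y / x" using assms by simp
  then obtain k where k: "(1 + \<epsilon>) ^ k \<le> y / x" "y / x < (1 + \<epsilon>) * (1 + \<epsilon>) ^ k"
    using power_bracket[of "1 + \<epsilon>" "y / x"] assms(1) by auto
  have "\<epsilon> ^ 3 * (1 + \<epsilon>) ^ k \<le> \<epsilon> ^ 3 * (y / x)" using k(1) assms(1) by (intro mult_left_mono) auto
  also have "\<dots> \<le> 1" using assms by (simp add: field_simps)
  finally have "k < thetas \<epsilon>" using thetas_less assms(1) by blast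
  moreover have "(1 + \<epsilon>) ^ k * x \<le> y" "y \<le> (1 + \<epsilon>) * (1 + \<epsilon>) ^ k * x"
    using k assms(2) by (simp_all add: field_simps)
  ultimately show thesis by (rule that)
qed

subsection \<open>Grouping a sorted sequence\<close>

text \<open>A new group is opened when the current value leaves the window \<open>[base, base / \<epsilon>]\<close>.  The
  group number jumps by more than one if there is also a large gap to the preceding value, so
  that groups whose numbers differ by at most one are close together.\<close>

primrec scan :: "real \<Rightarrow> (nat \<Rightarrow> ereal) \<Rightarrow> nat \<Rightarrow> ereal \<times> nat" where
  "scan \<epsilon> v 0 = (v 0, 0)"
| "scan \<epsilon> v (Suc k) =
    (if ereal \<epsilon> * v (Suc k) \<le> fst (scan \<epsilon> v k) then scan \<epsilon> v k
     else (v (Suc k), snd (scan \<epsilon> v k) + (if ereal \<epsilon> * v (Suc k) \<le> v k then 1 else 3)))"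

abbreviation group :: "real \<Rightarrow> (nat \<Rightarrow> ereal) \<Rightarrow> nat \<Rightarrow> nat" where
  "group \<epsilon> v k \<equiv> snd (scan \<epsilon> v k)"

text \<open>Limiting the jumps to 3 per value keeps the chunk numbers below the array size. Jumping
  by 3, not by 2, also preserves the residue mod 3, so the machine merely increments its chunk
  counter.\<close>

lemma group_bound: "group \<epsilon> v k \<le> 3 * k"
  by (induction k) auto

text \<open>Every earlier value is compared only with the current base, which is the least value of
  its group. For each distance of group numbers (0, 1, at least 2) the invariant records how far
  below the base the value can or must lie.\<close>

lemma scan_invariant:
  assumes \<epsilon>: "0 < \<epsilon>" "\<epsilon> < 1" and sorted: "\<forall>x y. x \<le> y \<and> y < m \<longrightarrow> v x \<le> v y"
    and nn: "\<forall>x<m. 0 \<le> v x" and "k < m"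
  defines "b \<equiv> \<lambda>k. fst (scan \<epsilon> v k)" and "g \<equiv> \<lambda>k. snd (scan \<epsilon> v k)"
  shows "b k \<le> v k \<and> ereal \<epsilon> * v k \<le> b k \<and>
    (\<forall>x\<le>k. g x \<le> g k \<and> (g x = g k \<longrightarrow> b k \<le> v x) \<and>
      (g x < g k \<longrightarrow> v x \<le> b k) \<and>
      (g x + 1 = g k \<longrightarrow> ereal \<epsilon> * (ereal \<epsilon> * b k) \<le> v x) \<and>
      (g x + 2 \<le> g k \<longrightarrow> v x \<le> ereal \<epsilon> * b k))"
  using \<open>k < m\<close>
proof (induction k)
  case 0
  have "ereal \<epsilon> * v 0 \<le> 1 * v 0" using nn 0 \<epsilon> by (intro ereal_mult_right_mono) auto
  then show ?case by (simp add: b_def g_def)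
next
  case (Suc k)
  note IH = Suc.IH[OF Suc_lessD[OF Suc.prems]]
  let ?v = "v (Suc k)"
  have e0: "0 \<le> ereal \<epsilon>" using \<epsilon> by simp
  have vk: "v x \<le> ?v" "v x \<le> v k" if "x \<le> k" for x using sorted that Suc.prems by auto
  have ev: "ereal \<epsilon> * ?v \<le> ?v"
    using ereal_mult_right_mono[of "ereal \<epsilon>" 1 ?v] nn Suc.prems \<epsilon> by simp
  show ?case
  proof (cases "ereal \<epsilon> * ?v \<le> b k")
    case True
    then have "b (Suc k) = b k" "g (Suc k) = g k" by (simp_all add: b_def g_def)
    moreover have "b k \<le> ?v" using order_trans[OF _ vk(1)[of k]] IH by blast
    ultimately show ?thesis using IH True by (simp add: le_Suc_eq all_conj_distrib)
  next
    case far: False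
    then have b: "b (Suc k) = ?v" by (simp add: b_def)
    have ebv: "b k \<le> ereal \<epsilon> * ?v" using far by simp
    show ?thesis
    proof (cases "ereal \<epsilon> * ?v \<le> v k")
      case True
      \<comment> \<open>Going from the new base to the preceding value, and from there to the old
        base, loses one factor \<epsilon> each; this bounds the adjacent group from below. Groups
        further down lie below the old base, which is already below \<epsilon> times the new
        one.\<close>
      with far have g: "g (Suc k) = g k + 1" by (simp add: b_def g_def)
      have "ereal \<epsilon> * (ereal \<epsilon> * ?v) \<le> ereal \<epsilon> * v k"
        by (rule ereal_mult_left_mono[OF True e0])
      then have 2: "ereal \<epsilon> * (ereal \<epsilon> * ?v) \<le> b k" using IH by (meson order_trans)
      have *: "g x \<le> g k \<and> v x \<le> ?v \<and>
          (g x + 1 = g k + 1 \<longrightarrow> ereal \<epsilon> * (ereal \<epsilon> * ?v) \<le> v x) \<and>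
          (g x + 2 \<le> g k + 1 \<longrightarrow> v x \<le> ereal \<epsilon> * ?v)" if "x \<le> k" for x
      proof -
        have "g x \<le> g k" "g x = g k \<longrightarrow> b k \<le> v x" "g x < g k \<longrightarrow> v x \<le> b k"
          using IH that by auto
        moreover from this have "g x = g k \<longrightarrow> ereal \<epsilon> * (ereal \<epsilon> * ?v) \<le> v x"
          using order_trans[OF 2] by blast
        moreover have "g x < g k \<longrightarrow> v x \<le> ereal \<epsilon> * ?v"
          using calculation(3) order_trans[OF _ ebv] by blast
        ultimately show ?thesis using vk[OF that] by auto
      qed
      show ?thesis unfolding b g
      proof (intro conjI allI impI)
        fix x assume "x \<le> Suc k"
        then have x: "x \<le> k \<or> x = Suc k" by (simp add: le_Suc_eq)
        show "g x \<le> g k + 1" using * x g by fastforce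
        show "?v \<le> v x" if "g x = g k + 1" using * x that by fastforce
        show "v x \<le> ?v" if "g x < g k + 1" using * x by fastforce
        show "ereal \<epsilon> * (ereal \<epsilon> * ?v) \<le> v x" if "g x + 1 = g k + 1" using * x that g by fastforce
        show "v x \<le> ereal \<epsilon> * ?v" if "g x + 2 \<le> g k + 1" using * x that g by fastforce
      qed (use ev in simp_all)
    next
      case False
      \<comment> \<open>After a large gap all earlier values are below \<epsilon> times the new
        base, and no earlier group is adjacent to the new one.\<close>
      with far have g: "g (Suc k) = g k + 3" by (simp add: b_def g_def)
      have *: "g x \<le> g k \<and> v x \<le> ?v \<and> v x \<le> ereal \<epsilon> * ?v" if "x \<le> k" for x
      proof -
        have "v k \<le> ereal \<epsilon> * ?v" using False by simp
        with vk(2)[OF that] have "v x \<le> ereal \<epsilon> * ?v" by (rule order_trans)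
        moreover have "g x \<le> g k" using IH that by blast
        ultimately show ?thesis using vk(1)[OF that] by blast
      qed
      show ?thesis unfolding b g
      proof (intro conjI allI impI)
        fix x assume "x \<le> Suc k"
        then have x: "x \<le> k \<or> x = Suc k" by (simp add: le_Suc_eq)
        show "g x \<le> g k + 3" using * x g by fastforce
        show "?v \<le> v x" if "g x = g k + 3" using * x that by fastforce
        show "v x \<le> ?v" if "g x < g k + 3" using * x by fastforce
        show "ereal \<epsilon> * (ereal \<epsilon> * ?v) \<le> v x" if "g x + 1 = g k + 3" using * x that g by fastforce
        show "v x \<le> ereal \<epsilon> * ?v" if "g x + 2 \<le> g k + 3" using * x that g by fastforce
      qed (use ev in simp_all)
    qed
  qed
qed

text \<open>The invariant relates \<open>v x\<close> to the base of the group of \<open>y\<close>.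
  Since \<epsilon> times \<open>v y\<close> is at most that base and the base is at most
  \<open>v y\<close>, passing from the base to \<open>v y\<close> is free in the first claim and
  costs the third factor \<epsilon> in the second.\<close>

lemma group_separation:
  assumes \<epsilon>: "0 < \<epsilon>" "\<epsilon> < 1" and sorted: "\<forall>x y. x \<le> y \<and> y < m \<longrightarrow> v x \<le> v y"
    and nn: "\<forall>x<m. 0 \<le> v x" and xy: "x < m" "y < m"
  shows "group \<epsilon> v x + 2 \<le> group \<epsilon> v y \<Longrightarrow> v x \<le> ereal \<epsilon> * v y"
    and "group \<epsilon> v y \<le> group \<epsilon> v x + 1 \<Longrightarrow> ereal \<epsilon> * (ereal \<epsilon> * (ereal \<epsilon> * v y)) \<le> v x"
proof -
  note inv = scan_invariant[OF \<epsilon> sorted nn]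
  have e0: "0 \<le> ereal \<epsilon>" using \<epsilon> by simp
  have scale: "ereal \<epsilon> * z \<le> z" if "0 \<le> z" for z
    using ereal_mult_right_mono[of "ereal \<epsilon>" 1 z] that \<epsilon> by simp
  show "v x \<le> ereal \<epsilon> * v y" if g: "group \<epsilon> v x + 2 \<le> group \<epsilon> v y"
  proof (cases "x \<le> y")
    case True
    have "v x \<le> ereal \<epsilon> * fst (scan \<epsilon> v y)" using inv[OF xy(2)] True g by blast
    also have "\<dots> \<le> ereal \<epsilon> * v y"
      using inv[OF xy(2)] by (intro ereal_mult_left_mono[OF _ e0]) blast
    finally show ?thesis .
  next
    \<comment> \<open>Group numbers are monotone along the sequence, so this case contradicts the
      premise.\<close>
    case False
    then show ?thesis using inv[OF xy(1)] g by (auto dest!: spec[of _ y])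
  qed
  show "ereal \<epsilon> * (ereal \<epsilon> * (ereal \<epsilon> * v y)) \<le> v x" if g: "group \<epsilon> v y \<le> group \<epsilon> v x + 1"
  proof (cases "x \<le> y")
    case True
    have y: "ereal \<epsilon> * v y \<le> fst (scan \<epsilon> v y)" using inv[OF xy(2)] by blast
    have "group \<epsilon> v x \<le> group \<epsilon> v y" using inv[OF xy(2)] True by blast
    then consider "group \<epsilon> v x = group \<epsilon> v y" | "group \<epsilon> v x + 1 = group \<epsilon> v y" using g by linarith
    then show ?thesis
    proof cases
      case 1
      then have "ereal \<epsilon> * v y \<le> v x" using y inv[OF xy(2)] True by (blast intro: order_trans)
      then show ?thesis using scale e0 nn xy(2)
        by (meson ereal_0_le_mult order_trans)
    next
      case 2
      then have "ereal \<epsilon> * (ereal \<epsilon> * fst (scan \<epsilon> v y)) \<le> v x" using inv[OF xy(2)] True by blast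
      then show ?thesis using y e0 by (meson ereal_mult_left_mono order_trans)
    qed
  next
    case False
    then have "v y \<le> v x" using sorted xy by simp
    then show ?thesis using scale e0 nn xy(2)
      by (meson ereal_0_le_mult order_trans)
  qed
qed

section \<open>Bits and residues of group numbers\<close>

lemma bits_differ:
  fixes x y :: nat
  assumes "x < 2 ^ e" "y < 2 ^ e" "x \<noteq> y"
  obtains h where "h < e" "x div 2 ^ h mod 2 \<noteq> y div 2 ^ h mod 2"
  using assms
proof (induction e arbitrary: x y thesis)
  case 0
  then show ?case by simp
next
  case (Suc e)
  show ?case
  proof (cases "x mod 2 = y mod 2")
    case False
    then show ?thesis using Suc.prems(1)[of 0] by simp
  next
    case True
    \<comment> \<open>Equal lowest bits are stripped by halving both numbers, which lowers the
      position of the differing bit by one.\<close>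
    with Suc.prems(4) have "x div 2 \<noteq> y div 2" by (metis div_mult_mod_eq)
    moreover have "x div 2 < 2 ^ e" "y div 2 < 2 ^ e" using Suc.prems(2,3) by auto
    ultimately obtain h where "h < e" "x div 2 div 2 ^ h mod 2 \<noteq> y div 2 div 2 ^ h mod 2"
      using Suc.IH by blast
    then show ?thesis using Suc.prems(1)[of "Suc h"] by (simp add: div_mult2_eq)
  qed
qed

text \<open>With residue 0 dropped, a chunk consists of two consecutive numbers, and between
  neighbouring chunks one number is missing.\<close>

lemma chunks_far_apart:
  fixes g g' r :: nat
  assumes "(g + r) mod 3 \<noteq> 0" "(g' + r) mod 3 \<noteq> 0"
  shows "(g + r) div 3 \<noteq> (g' + r) div 3 \<longleftrightarrow> g + 2 \<le> g' \<or> g' + 2 \<le> g"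
proof -
  define c c' m m' where d: "c = (g + r) div 3" "c' = (g' + r) div 3" "m = (g + r) mod 3" "m' = (g' + r) mod 3"
  have "g + r = 3 * c + m" "g' + r = 3 * c' + m'" "m < 3" "m' < 3" by (simp_all add: d)
  moreover have "m \<noteq> 0" "m' \<noteq> 0" using assms by (simp_all add: d)
  ultimately show ?thesis unfolding d(1,2)[symmetric]
    by (cases c c' rule: linorder_cases) auto
qed

text \<open>Each of the two numbers rules out exactly one of the three shifts. Only residues matter,
  so nine cases are checked.\<close>

lemma good_shift:
  fixes g g' :: nat
  obtains r where "r < 3" "(g + r) mod 3 \<noteq> 0" "(g' + r) mod 3 \<noteq> 0"
proof -
  have *: "(x + r) mod 3 = (x mod 3 + r) mod 3" for x r :: nat by (simp add: mod_simps)
  have c: "x mod 3 \<in> {0, 1, 2}" for x :: nat 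
    proof -
    have "x mod 3 < 3" by simp
    then show ?thesis by auto
  qed
  have "\<forall>a\<in>{0,1,2::nat}. \<forall>b\<in>{0,1,2::nat}. \<exists>r\<in>{0,1,2::nat}. (a + r) mod 3 \<noteq> 0 \<and> (b + r) mod 3 \<noteq> 0"
    by simp
  from bspec[OF bspec[OF this c[of g]] c[of g']] obtain r where r: "r \<in> {0, 1, 2}"
    "(g mod 3 + r) mod 3 \<noteq> 0" "(g' mod 3 + r) mod 3 \<noteq> 0" by (elim bexE conjE)
  have "r < 3" using r(1) by auto
  then show thesis using r(2,3) unfolding *[symmetric] by (rule that)
qed

lemma sum_le_larger:
  assumes "0 \<le> b" "a \<le> ereal \<epsilon> * b" "0 < \<epsilon>"
  shows "a + b \<le> b * ereal (1 + \<epsilon>)"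
proof -
  have "a + b \<le> ereal \<epsilon> * b + b" by (rule add_right_mono[OF assms(2)])
  also have "\<dots> = b * ereal (1 + \<epsilon>)"
    using assms by (cases b) (auto simp: algebra_simps)
  finally show ?thesis .
qed

text \<open>Each value alone is at most the sum, as the other one is nonnegative.\<close>

lemma scaled_covers:
  assumes "a \<in> Rplus" "b \<in> Rplus" "0 < \<epsilon>"
  shows "covers \<epsilon> a b (a * ereal (1 + \<epsilon>)) (b * ereal (1 + \<epsilon>))"
proof (cases "a = \<infinity> \<or> b = \<infinity>")
  case True
  then show ?thesis using assms covers_infinite by blast
next
  case False
  with assms(1,2) obtain x y where xy: "a = ereal x" "b = ereal y" "1 \<le> x" "1 \<le> y"
    by (auto elim!: Rplus_cases)
  have "x * (1 + \<epsilon>) \<le> (1 + \<epsilon>) * (x + y)" "y * (1 + \<epsilon>) \<le> (1 + \<epsilon>) * (x + y)"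
    using xy assms(3) by (simp_all add: algebra_simps)
  then show ?thesis by (simp add: covers_def xy flip: ereal_max)
qed

section \<open>Writing out vectors; the close pairs\<close>

text \<open>\<open>off\<close> holds \<open>s * n\<close>, maintained by additions, so that cell
  \<open>off + i\<close> is entry \<open>i\<close> of the next vector in the prescribed output
  layout. The expressions \<open>u\<close> and \<open>v\<close> may read the loop counter.\<close>

definition emit :: "nexp \<Rightarrow> nexp \<Rightarrow> com" where
  "emit u v = Seq
     (For ''i'' 1 (IAdd (IVar ''n'') (INum 1))
       (Seq (NSet ''A_out'' (IAdd (IVar ''off'') (IVar ''i'')) u)
            (NSet ''B_out'' (IAdd (IVar ''off'') (IVar ''i'')) v)))
     (Seq (ISet ''off'' (INum 0) (IAdd (IVar ''off'') (IVar ''n'')))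
          (ISet ''s'' (INum 0) (IAdd (IVar ''s'') (INum 1))))"

lemma written_emit [simp]:
  "written_ints (emit u v) = {''i'', ''off'', ''s''}"
  "written_nums (emit u v) = {''A_out'', ''B_out''}"
  by (auto simp: emit_def)

locale covering_input =
  fixes n :: nat and A B :: "nat \<Rightarrow> ereal" and \<epsilon> :: real
  assumes n: "1 \<le> n" and \<epsilon>: "0 < \<epsilon>" "\<epsilon> < 1 / 10"
    and A: "A \<in> {1..n} \<rightarrow> Rplus" and B: "B \<in> {1..n} \<rightarrow> Rplus"
begin

definition loaded :: "state \<Rightarrow> bool" where
  "loaded \<sigma> \<longleftrightarrow> ints \<sigma> ''n'' 0 = n \<and> nums \<sigma> ''eps'' 0 = ereal \<epsilon> \<and>
     (\<forall>i\<in>{1..n}. nums \<sigma> ''A'' i = A i \<and> nums \<sigma> ''B'' i = B i)"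

lemma loaded_same_except:
  "loaded \<sigma> \<Longrightarrow> same_except X Y \<sigma> \<sigma>' \<Longrightarrow> ''n'' \<notin> X \<Longrightarrow> Y \<inter> {''eps'', ''A'', ''B''} = {} \<Longrightarrow> loaded \<sigma>'"
  unfolding loaded_def same_except_def by auto

definition emitted :: "state \<Rightarrow> bool" where
  "emitted \<sigma> \<longleftrightarrow> ints \<sigma> ''off'' 0 = ints \<sigma> ''s'' 0 * n \<and>
     (\<forall>l\<in>{1..ints \<sigma> ''s'' 0}.
        valid_pair n A B (output_vectors ''A_out'' n \<sigma> l) (output_vectors ''B_out'' n \<sigma> l))"

definition covered :: "state \<Rightarrow> nat \<Rightarrow> nat \<Rightarrow> bool" where
  "covered \<sigma> i j \<longleftrightarrow> (\<exists>l\<in>{1..ints \<sigma> ''s'' 0}.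
     covers \<epsilon> (A i) (B j) (output_vectors ''A_out'' n \<sigma> l i) (output_vectors ''B_out'' n \<sigma> l j))"

lemma outputs_same_except:
  assumes "same_except X Y \<sigma> \<sigma>'" "X \<inter> {''off'', ''s''} = {}" "Y \<inter> {''A_out'', ''B_out''} = {}"
  shows "emitted \<sigma>' = emitted \<sigma>" "covered \<sigma>' = covered \<sigma>" "ints \<sigma>' ''s'' = ints \<sigma> ''s''"
proof -
  have *: "ints \<sigma>' ''off'' = ints \<sigma> ''off''" "ints \<sigma>' ''s'' = ints \<sigma> ''s''"
    "nums \<sigma>' ''A_out'' = nums \<sigma> ''A_out''" "nums \<sigma>' ''B_out'' = nums \<sigma> ''B_out''"
    using assms unfolding same_except_def by auto
  then have "output_vectors ''A_out'' n \<sigma>' = output_vectors ''A_out'' n \<sigma>"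
    "output_vectors ''B_out'' n \<sigma>' = output_vectors ''B_out'' n \<sigma>"
    by (simp_all add: output_vectors_def fun_eq_iff)
  with * show "emitted \<sigma>' = emitted \<sigma>" "covered \<sigma>' = covered \<sigma>" "ints \<sigma>' ''s'' = ints \<sigma> ''s''"
    by (simp_all add: emitted_def covered_def[abs_def])
qed

text \<open>All output is produced through this rule. The expressions are evaluated while the loop
  is changing the counter and the output arrays, so \<open>val\<close> demands their values in every
  state that differs from \<sigma> only there. Coverage accumulates because earlier vectors
  survive.\<close>

lemma runs_emit:
  assumes load: "ints \<sigma> ''n'' 0 = n" and em: "emitted \<sigma>" and ab: "valid_pair n A B a b"
    and val: "\<And>\<sigma>' i. i \<in> {1..n} \<Longrightarrow> same_except {''i''} {''A_out'', ''B_out''} \<sigma> \<sigma>' \<Longrightarrow>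
      ints \<sigma>' ''i'' 0 = i \<Longrightarrow> nval \<sigma>' u = a i \<and> nval \<sigma>' v = b i"
    and cost: "n * (ncost u + ncost v + 60) \<le> T"
  shows "runs (emit u v) T \<sigma> (\<lambda>\<sigma>'. emitted \<sigma>' \<and>
    ints \<sigma>' ''s'' 0 = Suc (ints \<sigma> ''s'' 0) \<and>
    (\<forall>i\<in>{1..n}. \<forall>j\<in>{1..n}. covered \<sigma> i j \<or> covers \<epsilon> (A i) (B j) (a i) (b j) \<longrightarrow> covered \<sigma>' i j))"
proof -
  let ?off = "ints \<sigma> ''off'' 0"
  \<comment> \<open>The array contents before round \<open>k\<close>: entries 1 to
    \<open>k - 1\<close> of the new vector are in place, all other cells are as at the
    start.\<close>
  let ?fill = "\<lambda>x f k c. if ?off < c \<and> c < ?off + k then f (c - ?off) else nums \<sigma> x c"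
  let ?I = "\<lambda>k \<sigma>'. nums \<sigma>' ''A_out'' = ?fill ''A_out'' a k \<and> nums \<sigma>' ''B_out'' = ?fill ''B_out'' b k"
  let ?body = "Seq (NSet ''A_out'' (IAdd (IVar ''off'') (IVar ''i'')) u)
            (NSet ''B_out'' (IAdd (IVar ''off'') (IVar ''i'')) v)"
  have "runs (For ''i'' 1 (IAdd (IVar ''n'') (INum 1)) ?body) (n * (ncost u + ncost v + 30) + 12) \<sigma> (?I (Suc n))"
  proof (rule runs_For[where hi = "Suc n" and T = "ncost u + ncost v + 12" and I = ?I])
    fix k \<sigma>' assume k: "1 \<le> k" "k < Suc n" and f: "same_except (insert ''i'' (written_ints ?body)) (written_nums ?body) \<sigma> \<sigma>'"
      and i: "ints \<sigma>' ''i'' 0 = k" and I: "?I k \<sigma>'"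
    from f have f': "same_except {''i''} {''A_out'', ''B_out''} \<sigma> \<sigma>'" by (simp add: insert_commute)
    let ?\<tau> = "set_num ''A_out'' (?off + k) (a k) \<sigma>'"
    have off: "ints \<sigma>' ''off'' 0 = ?off" using f' by (simp add: same_except_def)
    have u: "nval \<sigma>' u = a k" using val[OF _ f' i] k by simp
    \<comment> \<open>The second expression is evaluated after the first write, hence in
      \<open>?\<tau>\<close>.\<close>
    have f'': "same_except {''i''} {''A_out'', ''B_out''} \<sigma> ?\<tau>" using f' by (simp add: same_except_def)
    have v: "nval ?\<tau> v = b k" using val[OF _ f''] k i by simp
    show "runs ?body (ncost u + ncost v + 12) \<sigma>' (\<lambda>\<sigma>'. ?I (Suc k) (set_int ''i'' 0 (Suc k) \<sigma>'))"
      by (rule runs_loop_free) (use k i I u v off in \<open>auto simp: fun_eq_iff\<close>)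
  qed (use n load in \<open>auto simp: same_except_def fun_eq_iff\<close>)
  then show ?thesis unfolding emit_def
  proof (rule runs_SeqI[where T' = 14])
    fix \<sigma>1 assume I: "?I (Suc n) \<sigma>1"
      and f: "same_except (written_ints (For ''i'' 1 (IAdd (IVar ''n'') (INum 1)) ?body)) (written_nums (For ''i'' 1 (IAdd (IVar ''n'') (INum 1)) ?body)) \<sigma> \<sigma>1"
    let ?c = "Seq (ISet ''off'' (INum 0) (IAdd (IVar ''off'') (IVar ''n''))) (ISet ''s'' (INum 0) (IAdd (IVar ''s'') (INum 1)))"
    let ?\<tau> = "effect ?c \<sigma>1"
    let ?s = "ints \<sigma> ''s'' 0"
    have off: "?off = ?s * n" using em by (simp add: emitted_def)
    have s': "ints ?\<tau> ''s'' 0 = Suc ?s" and off': "ints ?\<tau> ''off'' 0 = Suc ?s * n"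
      using f load off by (simp_all add: same_except_def)
    \<comment> \<open>The cells of the first \<open>?s\<close> vectors end at \<open>?off\<close>,
      and writing takes place strictly above it.\<close>
    have old: "output_vectors x n ?\<tau> l i = output_vectors x n \<sigma> l i"
      if "l \<in> {1..?s}" "i \<in> {1..n}" "x = ''A_out'' \<or> x = ''B_out''" for x l i
    proof -
      have "(l - 1) * n + i \<le> (l - 1) * n + n" using that by simp
      also have "\<dots> = l * n" using that(1) by (cases l) auto
      also have "\<dots> \<le> ?off" using that(1) off by simp
      finally show ?thesis using I that(3) by (auto simp: output_vectors_def)
    qed
    have newA: "output_vectors ''A_out'' n ?\<tau> (Suc ?s) i = a i" 
     and newB: "output_vectors ''B_out'' n ?\<tau> (Suc ?s) i = b i" if "i \<in> {1..n}" for i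
      using I that off by (simp_all add: output_vectors_def)
    have "emitted ?\<tau>" unfolding emitted_def s' off'
    proof (intro conjI ballI)
      fix l assume l: "l \<in> {1..Suc ?s}"
      show "valid_pair n A B (output_vectors ''A_out'' n ?\<tau> l) (output_vectors ''B_out'' n ?\<tau> l)"
      proof (cases "l = Suc ?s")
        case True
        then show ?thesis using ab newA newB unfolding valid_pair_def Pi_iff by simp
      next
        case False
        with l have l: "l \<in> {1..?s}" by auto
        then have "valid_pair n A B (output_vectors ''A_out'' n \<sigma> l) (output_vectors ''B_out'' n \<sigma> l)"
          using em by (simp add: emitted_def)
        then show ?thesis using old[OF l] unfolding valid_pair_def Pi_iff by simp
      qed
    qed simp
    moreover have "covered ?\<tau> i j" if "i \<in> {1..n}" "j \<in> {1..n}" "covered \<sigma> i j" for i j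
    proof -
      from that(3) obtain l where l: "l \<in> {1..?s}" and c: "covers \<epsilon> (A i) (B j)
          (output_vectors ''A_out'' n \<sigma> l i) (output_vectors ''B_out'' n \<sigma> l j)"
        unfolding covered_def by blast
      then show ?thesis unfolding covered_def s' using old[OF l] that(1,2)
        by (intro bexI[of _ l]) auto
    qed
    moreover have "covered ?\<tau> i j" if "i \<in> {1..n}" "j \<in> {1..n}" "covers \<epsilon> (A i) (B j) (a i) (b j)" for i j
      unfolding covered_def s' using newA newB that by (intro bexI[of _ "Suc ?s"]) auto
    ultimately show "runs ?c 14 \<sigma>1 (\<lambda>\<sigma>'. emitted \<sigma>' \<and>
      ints \<sigma>' ''s'' 0 = Suc (ints \<sigma> ''s'' 0) \<and>
      (\<forall>i\<in>{1..n}. \<forall>j\<in>{1..n}. covered \<sigma> i j \<or> covers \<epsilon> (A i) (B j) (a i) (b j) \<longrightarrow> covered \<sigma>' i j))"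
      using s' by (intro runs_loop_free) auto
  next
    have "n * (ncost u + ncost v + 30) + 12 + 14 \<le> n * (ncost u + ncost v + 60)"
      using n by (simp add: algebra_simps)
    then show "n * (ncost u + ncost v + 30) + 12 + 14 \<le> T" using cost by linarith
  qed
qed

section \<open>Vectors for close pairs\<close>

abbreviation theta :: "nat \<Rightarrow> real" where "theta k \<equiv> (1 + \<epsilon>) ^ k"

lemma theta_ge_1: "1 \<le> theta k"
  using \<epsilon> by simp

lemma valid_theta:
  assumes "0 < \<theta>"
  shows "valid_pair n A B (\<lambda>i. A i * ereal (1 + \<theta>)) (\<lambda>i. B i * ereal (1 + 1 / \<theta>))"
  using A B assms theta_split[OF _ _ assms] Rplus_scale unfolding valid_pair_def Pi_iff by simp

end

text \<open>\<open>th\<close> runs through the powers of \<open>1 + \<epsilon>\<close>. The first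
  emission serves pairs in which the entry of \<open>B\<close> is the larger one, the second
  emission those in which the entry of \<open>A\<close> is.\<close>

definition close_loop :: com where
  "close_loop = While (NLe (NMul (NMul (NMul (NVar ''eps'') (NVar ''eps'')) (NVar ''eps'')) (NVar ''th'')) NOne)
     (Seq (emit (NMul (NGet ''A'' (IVar ''i'')) (NAdd NOne (NVar ''th'')))
                (NMul (NGet ''B'' (IVar ''i'')) (NAdd NOne (NDiv NOne (NVar ''th'')))))
     (Seq (emit (NMul (NGet ''A'' (IVar ''i'')) (NAdd NOne (NDiv NOne (NVar ''th''))))
                (NMul (NGet ''B'' (IVar ''i'')) (NAdd NOne (NVar ''th''))))
          (NSet ''th'' (INum 0) (NMul (NVar ''th'') (NAdd NOne (NVar ''eps''))))))"

definition close_phase :: com where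
  "close_phase = Seq (NSet ''th'' (INum 0) NOne) close_loop"

lemma written_close_phase [simp]:
  "written_ints close_phase = {''i'', ''off'', ''s''}"
  "written_nums close_phase = {''th'', ''A_out'', ''B_out''}"
  by (auto simp: close_phase_def close_loop_def)

context covering_input
begin

lemma runs_close_loop:
  assumes load: "loaded \<sigma>" and "emitted \<sigma>" and s: "ints \<sigma> ''s'' 0 = 0" and th: "nums \<sigma> ''th'' 0 = 1"
  shows "runs close_loop (thetas \<epsilon> * (300 * n) + 20) \<sigma> (\<lambda>\<sigma>'. emitted \<sigma>' \<and> ints \<sigma>' ''s'' 0 = 2 * thetas \<epsilon> \<and>
     (\<forall>i\<in>{1..n}. \<forall>j\<in>{1..n}. \<forall>m<thetas \<epsilon>.
        covers \<epsilon> (A i) (B j) (A i * ereal (1 + theta m)) (B j * ereal (1 + 1 / theta m)) \<or>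
        covers \<epsilon> (A i) (B j) (A i * ereal (1 + 1 / theta m)) (B j * ereal (1 + theta m)) \<longrightarrow> covered \<sigma>' i j))"
proof -
  let ?c = "\<lambda>m i j. covers \<epsilon> (A i) (B j) (A i * ereal (1 + theta m)) (B j * ereal (1 + 1 / theta m))"
  let ?c' = "\<lambda>m i j. covers \<epsilon> (A i) (B j) (A i * ereal (1 + 1 / theta m)) (B j * ereal (1 + theta m))"
  let ?J = "\<lambda>k \<sigma>'. loaded \<sigma>' \<and> nums \<sigma>' ''th'' 0 = ereal (theta k) \<and> emitted \<sigma>' \<and> ints \<sigma>' ''s'' 0 = 2 * k \<and>
     (\<forall>i\<in>{1..n}. \<forall>j\<in>{1..n}. \<forall>m<k. ?c m i j \<or> ?c' m i j \<longrightarrow> covered \<sigma>' i j)"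
  have val: "nval \<tau> (NGet ''A'' (IVar ''i'')) = A i \<and> nval \<tau> (NGet ''B'' (IVar ''i'')) = B i \<and>
      nval \<tau> (NAdd NOne (NVar ''th'')) = ereal (1 + theta k) \<and>
      nval \<tau> (NAdd NOne (NDiv NOne (NVar ''th''))) = ereal (1 + 1 / theta k)"
    if "loaded \<sigma>" "nums \<sigma> ''th'' 0 = ereal (theta k)" "i \<in> {1..n}"
      "same_except {''i''} {''A_out'', ''B_out''} \<sigma> \<tau>" "ints \<tau> ''i'' 0 = i" for k i \<sigma> \<tau>
  proof -
    note eq = same_except_nums[OF that(4)]
    have [simp]: "nums \<tau> ''A'' = nums \<sigma> ''A''" "nums \<tau> ''B'' = nums \<sigma> ''B''" "nums \<tau> ''th'' = nums \<sigma> ''th''"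
      by (rule eq, simp)+
    have "theta k \<noteq> 0" using theta_ge_1[of k] by linarith
    then show ?thesis using that(1,2,3,5) by (simp add: loaded_def one_ereal_def)
  qed
  show ?thesis unfolding close_loop_def
  proof (rule runs_While[where I = ?J and N = "thetas \<epsilon>" and T = "200 * n + 10"])
    show "?J 0 \<sigma>" using assms by (simp add: one_ereal_def)
  next
    fix \<sigma> assume "?J (thetas \<epsilon>) \<sigma>"
    then show "\<not> bval \<sigma> (NLe (NMul (NMul (NMul (NVar ''eps'') (NVar ''eps'')) (NVar ''eps'')) (NVar ''th'')) NOne)"
      using thetas_stop[OF \<epsilon>(1)] by (simp add: loaded_def power3_eq_cube one_ereal_def)
  next
    fix k \<sigma> assume k: "k < thetas \<epsilon>" and J: "?J k \<sigma>"
    have test: "bval \<sigma> (NLe (NMul (NMul (NMul (NVar ''eps'') (NVar ''eps'')) (NVar ''eps'')) (NVar ''th'')) NOne)"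
      using J thetas_go[OF k] by (simp add: loaded_def power3_eq_cube one_ereal_def)
    let ?u = "NMul (NGet ''A'' (IVar ''i'')) (NAdd NOne (NVar ''th''))"
    let ?v = "NMul (NGet ''B'' (IVar ''i'')) (NAdd NOne (NDiv NOne (NVar ''th'')))"
    let ?u' = "NMul (NGet ''A'' (IVar ''i'')) (NAdd NOne (NDiv NOne (NVar ''th'')))"
    let ?v' = "NMul (NGet ''B'' (IVar ''i'')) (NAdd NOne (NVar ''th''))"
    have pos: "0 < theta k" using theta_ge_1[of k] by linarith
    \<comment> \<open>The second emission is the vector for the parameter
      \<open>1 / theta k\<close>.\<close>
    have valid': "valid_pair n A B (\<lambda>i. A i * ereal (1 + 1 / theta k)) (\<lambda>i. B i * ereal (1 + theta k))"
      using valid_theta[of "1 / theta k"] pos by simp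
    \<comment> \<open>The two expressions cost 8 and 10, and \<open>runs_emit\<close> adds 60 per
      entry.\<close>
    have "runs (emit ?u ?v) (n * 80) \<sigma> (\<lambda>\<sigma>'. emitted \<sigma>' \<and> ints \<sigma>' ''s'' 0 = Suc (ints \<sigma> ''s'' 0) \<and>
      (\<forall>i\<in>{1..n}. \<forall>j\<in>{1..n}. covered \<sigma> i j \<or> ?c k i j \<longrightarrow> covered \<sigma>' i j))"
    proof (rule runs_emit[OF _ _ valid_theta[OF pos]])
      fix \<sigma>' i assume "i \<in> {1..n}" "same_except {''i''} {''A_out'', ''B_out''} \<sigma> \<sigma>'" "ints \<sigma>' ''i'' 0 = i"
      from val[OF _ _ this] J show "nval \<sigma>' ?u = A i * ereal (1 + theta k) \<and> nval \<sigma>' ?v = B i * ereal (1 + 1 / theta k)"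
        by (simp only: nval.simps(7))
    qed (use J in \<open>simp_all add: loaded_def\<close>)
    then have "runs (Seq (emit ?u ?v) (Seq (emit ?u' ?v') (NSet ''th'' (INum 0) (NMul (NVar ''th'') (NAdd NOne (NVar ''eps''))))))
      (200 * n + 10) \<sigma> (?J (Suc k))"
    proof (rule runs_SeqI[where T' = "n * 80 + 10"])
      fix \<sigma>1 assume 1: "emitted \<sigma>1 \<and> ints \<sigma>1 ''s'' 0 = Suc (ints \<sigma> ''s'' 0) \<and>
          (\<forall>i\<in>{1..n}. \<forall>j\<in>{1..n}. covered \<sigma> i j \<or> ?c k i j \<longrightarrow> covered \<sigma>1 i j)"
        and f1: "same_except (written_ints (emit ?u ?v)) (written_nums (emit ?u ?v)) \<sigma> \<sigma>1"
      have l1: "loaded \<sigma>1" using J f1 by (auto elim: loaded_same_except)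
      have th1: "nums \<sigma>1 ''th'' 0 = ereal (theta k)" using J f1 by (simp add: same_except_def)
      have "runs (emit ?u' ?v') (n * 80) \<sigma>1 (\<lambda>\<sigma>'. emitted \<sigma>' \<and> ints \<sigma>' ''s'' 0 = Suc (ints \<sigma>1 ''s'' 0) \<and>
        (\<forall>i\<in>{1..n}. \<forall>j\<in>{1..n}. covered \<sigma>1 i j \<or> ?c' k i j \<longrightarrow> covered \<sigma>' i j))"
      proof (rule runs_emit[OF _ _ valid'])
        fix \<sigma>' i assume "i \<in> {1..n}" "same_except {''i''} {''A_out'', ''B_out''} \<sigma>1 \<sigma>'" "ints \<sigma>' ''i'' 0 = i"
        from val[OF l1 th1 this] show "nval \<sigma>' ?u' = A i * ereal (1 + 1 / theta k) \<and> nval \<sigma>' ?v' = B i * ereal (1 + theta k)"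
          by (simp only: nval.simps(7))
      qed (use 1 l1 in \<open>simp_all add: loaded_def\<close>)
      then show "runs (Seq (emit ?u' ?v') (NSet ''th'' (INum 0) (NMul (NVar ''th'') (NAdd NOne (NVar ''eps'')))))
          (n * 80 + 10) \<sigma>1 (?J (Suc k))"
      proof (rule runs_SeqI[where T' = 10])
        fix \<sigma>2 assume 2: "emitted \<sigma>2 \<and> ints \<sigma>2 ''s'' 0 = Suc (ints \<sigma>1 ''s'' 0) \<and>
            (\<forall>i\<in>{1..n}. \<forall>j\<in>{1..n}. covered \<sigma>1 i j \<or> ?c' k i j \<longrightarrow> covered \<sigma>2 i j)"
          and f2: "same_except (written_ints (emit ?u' ?v')) (written_nums (emit ?u' ?v')) \<sigma>1 \<sigma>2"
        have l2: "loaded \<sigma>2" using l1 f2 by (auto elim: loaded_same_except)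
        have th2: "nums \<sigma>2 ''th'' 0 = ereal (theta k)" using th1 f2 by (simp add: same_except_def)
        let ?set = "NSet ''th'' (INum 0) (NMul (NVar ''th'') (NAdd NOne (NVar ''eps'')))"
        have f3: "same_except {} {''th''} \<sigma>2 (effect ?set \<sigma>2)" by (simp add: same_except_def)
        have "loaded (effect ?set \<sigma>2)" by (rule loaded_same_except[OF l2 f3]) auto
        moreover have "nums (effect ?set \<sigma>2) ''th'' 0 = ereal (theta (Suc k))"
          using l2 th2 by (simp add: loaded_def one_ereal_def mult.commute)
        moreover have "covered \<sigma>2 i j" if "i \<in> {1..n}" "j \<in> {1..n}" "m < Suc k" "?c m i j \<or> ?c' m i j" for i j m
          using that 1 2 J by (cases "m = k") (auto simp: less_Suc_eq)
        ultimately have "?J (Suc k) (effect ?set \<sigma>2)"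
          using 1 2 J outputs_same_except[OF f3] by simp
        then show "runs ?set 10 \<sigma>2 (?J (Suc k))"
          by (rule runs_loop_free[where Q = "?J (Suc k)", rotated]) simp_all
      qed simp
    qed simp
    with test show "bval \<sigma> (NLe (NMul (NMul (NMul (NVar ''eps'') (NVar ''eps'')) (NVar ''eps'')) (NVar ''th'')) NOne) \<and>
      runs (Seq (emit ?u ?v) (Seq (emit ?u' ?v') (NSet ''th'' (INum 0) (NMul (NVar ''th'') (NAdd NOne (NVar ''eps''))))))
      (200 * n + 10) \<sigma> (?J (Suc k))" ..
  next
    show "thetas \<epsilon> * (200 * n + 10 + bcost (NLe (NMul (NMul (NMul (NVar ''eps'') (NVar ''eps'')) (NVar ''eps'')) (NVar ''th'')) NOne) + 1) +
      bcost (NLe (NMul (NMul (NMul (NVar ''eps'') (NVar ''eps'')) (NVar ''eps'')) (NVar ''th'')) NOne) + 1 \<le> thetas \<epsilon> * (300 * n) + 20"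
      by simp (rule trans_le_add2, rule mult_le_mono2, use n in simp)
  qed blast
qed

lemma close_pair_covered:
  assumes ij: "i \<in> {1..n}" "j \<in> {1..n}"
    and close: "ereal \<epsilon> * (ereal \<epsilon> * (ereal \<epsilon> * A i)) \<le> B j" "ereal \<epsilon> * (ereal \<epsilon> * (ereal \<epsilon> * B j)) \<le> A i"
  obtains m where "m < thetas \<epsilon>"
    "covers \<epsilon> (A i) (B j) (A i * ereal (1 + theta m)) (B j * ereal (1 + 1 / theta m)) \<or>
     covers \<epsilon> (A i) (B j) (A i * ereal (1 + 1 / theta m)) (B j * ereal (1 + theta m))"
proof (cases "A i = \<infinity> \<or> B j = \<infinity>")
  case True
  \<comment> \<open>An infinite pair is covered by every vector, so it suffices that the loop makes
    at least one round.\<close>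
  have "\<epsilon> ^ 3 \<le> 1" using \<epsilon> by (intro power_le_one) auto
  then have "0 < thetas \<epsilon>" using \<epsilon> by (intro thetas_less) auto
  then show ?thesis using covers_infinite[OF _ _ True \<epsilon>(1)] A B ij that[of 0] by blast
next
  case False
  with A B ij obtain x y where xy: "A i = ereal x" "B j = ereal y" "1 \<le> x" "1 \<le> y"
    by (metis Pi_mem Rplus_cases)
  have pos: "0 < theta m" for m using theta_ge_1[of m] by linarith
  show ?thesis
  proof (cases "x \<le> y")
    case True
    moreover have "\<epsilon> ^ 3 * y \<le> x" using close(2) xy by (simp add: power3_eq_cube mult.assoc)
    ultimately obtain m where "m < thetas \<epsilon>" "theta m * x \<le> y" "y \<le> (1 + \<epsilon>) * theta m * x"
      using close_pair_theta[OF \<epsilon>(1) xy(3)] by blast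
    then show ?thesis using that[of m] theta_covers[OF xy(3,4) pos \<epsilon>(1)] xy by simp
  next
    case False
    then have "y \<le> x" by simp
    moreover have "\<epsilon> ^ 3 * x \<le> y" using close(1) xy by (simp add: power3_eq_cube mult.assoc)
    ultimately obtain m where "m < thetas \<epsilon>" "theta m * y \<le> x" "x \<le> (1 + \<epsilon>) * theta m * y"
      using close_pair_theta[OF \<epsilon>(1) xy(4)] by blast
    then show ?thesis using that[of m] theta_covers_swap[OF xy(3,4) pos \<epsilon>(1)] xy by simp
  qed
qed

lemma runs_close_phase:
  assumes load: "loaded \<sigma>" and em: "emitted \<sigma>" and s: "ints \<sigma> ''s'' 0 = 0"
  shows "runs close_phase (thetas \<epsilon> * (300 * n) + 30) \<sigma> (\<lambda>\<sigma>'. emitted \<sigma>' \<and> ints \<sigma>' ''s'' 0 = 2 * thetas \<epsilon> \<and>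
     (\<forall>i\<in>{1..n}. \<forall>j\<in>{1..n}. ereal \<epsilon> * (ereal \<epsilon> * (ereal \<epsilon> * A i)) \<le> B j \<and>
        ereal \<epsilon> * (ereal \<epsilon> * (ereal \<epsilon> * B j)) \<le> A i \<longrightarrow> covered \<sigma>' i j))"
  unfolding close_phase_def
proof (rule runs_SeqI[where T = 3 and T' = "thetas \<epsilon> * (300 * n) + 20"])
  show "runs (NSet ''th'' (INum 0) NOne) 3 \<sigma> (\<lambda>\<sigma>'. nums \<sigma>' ''th'' 0 = 1)"
    by (rule runs_loop_free) simp_all
next
  fix \<sigma>' assume th: "nums \<sigma>' ''th'' 0 = 1"
    and f: "same_except (written_ints (NSet ''th'' (INum 0) NOne)) (written_nums (NSet ''th'' (INum 0) NOne)) \<sigma> \<sigma>'"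
  have "loaded \<sigma>'" by (rule loaded_same_except[OF load f]) auto
  moreover have "emitted \<sigma>'" "ints \<sigma>' ''s'' 0 = 0" using outputs_same_except[OF f] em s by auto
  ultimately show "runs close_loop (thetas \<epsilon> * (300 * n) + 20) \<sigma>' (\<lambda>\<sigma>'. emitted \<sigma>' \<and> ints \<sigma>' ''s'' 0 = 2 * thetas \<epsilon> \<and>
     (\<forall>i\<in>{1..n}. \<forall>j\<in>{1..n}. ereal \<epsilon> * (ereal \<epsilon> * (ereal \<epsilon> * A i)) \<le> B j \<and>
        ereal \<epsilon> * (ereal \<epsilon> * (ereal \<epsilon> * B j)) \<le> A i \<longrightarrow> covered \<sigma>' i j))"
    using th by (intro runs_mono[OF runs_close_loop]) (assumption | blast elim: close_pair_covered | simp)+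
qed simp

end

section \<open>Merge sort\<close>

text \<open>The values stay in place and an array \<open>p\<close> of indices is sorted, so each
  value remains traceable to its vector entry.\<close>

definition sorted_between :: "(nat \<Rightarrow> ereal) \<Rightarrow> (nat \<Rightarrow> nat) \<Rightarrow> nat \<Rightarrow> nat \<Rightarrow> bool" where
  "sorted_between v p lo hi \<longleftrightarrow> (\<forall>x y. lo \<le> x \<and> x \<le> y \<and> y < hi \<longrightarrow> v (p x) \<le> v (p y))"

text \<open>\<open>a\<close> and \<open>b\<close> are the read positions in the two halves,
  \<open>k\<close> is the write position. Contents are compared as sets of indices; this is enough,
  because a map of a finite set onto itself is a bijection. The last clause, that nothing unread is
  smaller than anything written, is what keeps the output sorted.\<close>

definition merging ::
  "(nat \<Rightarrow> ereal) \<Rightarrow> (nat \<Rightarrow> nat) \<Rightarrow> nat \<Rightarrow> nat \<Rightarrow> nat \<Rightarrow> nat \<Rightarrow> nat \<Rightarrow> nat \<Rightarrow> (nat \<Rightarrow> nat) \<Rightarrow> bool" where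
  "merging v p lo mid hi a b k q \<longleftrightarrow> lo \<le> a \<and> a \<le> mid \<and> mid \<le> b \<and> b \<le> hi \<and> a + b = mid + k \<and>
     q ` {lo..<k} = p ` {lo..<a} \<union> p ` {mid..<b} \<and> sorted_between v q lo k \<and>
     (\<forall>x y. lo \<le> x \<and> x < k \<and> (a \<le> y \<and> y < mid \<or> b \<le> y \<and> y < hi) \<longrightarrow> v (q x) \<le> v (p y))"

lemma sorted_between_singleton: "sorted_between v p t (Suc t)"
  unfolding sorted_between_def by (metis le_antisym le_trans less_Suc_eq_le order_refl)

lemma sorted_between_extend:
  assumes "sorted_between v q lo k" "\<forall>x. lo \<le> x \<and> x < k \<longrightarrow> v (q x) \<le> v z"
  shows "sorted_between v (q(k := z)) lo (Suc k)"
  using assms unfolding sorted_between_def by (auto simp: less_Suc_eq)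

text \<open>The smaller of the two heads is a minimum of everything unread, so it may be appended.
  The comparison is conditional because the other half may be exhausted.\<close>

lemma merging_left:
  assumes m: "merging v p lo mid hi a b k q" and "sorted_between v p lo mid" "sorted_between v p mid hi"
    and a: "a < mid" and le: "b < hi \<Longrightarrow> v (p a) \<le> v (p b)"
  shows "merging v p lo mid hi (Suc a) b (Suc k) (q(k := p a))"
proof -
  have k: "lo \<le> k" and ab: "lo \<le> a" "mid \<le> b" using m by (auto simp: merging_def)
  have small: "v (p a) \<le> v (p y)" if "a \<le> y \<and> y < mid \<or> b \<le> y \<and> y < hi" for y
  proof (cases "y < mid")
    case True
    then show ?thesis using that assms(2) ab by (auto simp: sorted_between_def)
  next
    case False
    then have y: "b \<le> y" "y < hi" using that by auto
    then have "v (p b) \<le> v (p y)" using assms(3) ab by (auto simp: sorted_between_def)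
    moreover have "v (p a) \<le> v (p b)" using le y by simp
    ultimately show ?thesis by (rule order_trans[rotated])
  qed
  have "(q(k := p a)) ` {lo..<Suc k} = insert (p a) (q ` {lo..<k})"
    using k by (auto simp: atLeastLessThanSuc)
  also have "\<dots> = p ` {lo..<Suc a} \<union> p ` {mid..<b}"
    using m ab by (auto simp: merging_def atLeastLessThanSuc)
  finally have img: "(q(k := p a)) ` {lo..<Suc k} = p ` {lo..<Suc a} \<union> p ` {mid..<b}" .
  have "sorted_between v (q(k := p a)) lo (Suc k)"
    using m a by (intro sorted_between_extend) (auto simp: merging_def)
  with img m a small show ?thesis unfolding merging_def by (auto simp: less_Suc_eq)
qed

lemma merging_right:
  assumes m: "merging v p lo mid hi a b k q" and "sorted_between v p lo mid" "sorted_between v p mid hi"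
    and b: "b < hi" and le: "a < mid \<Longrightarrow> v (p b) \<le> v (p a)"
  shows "merging v p lo mid hi a (Suc b) (Suc k) (q(k := p b))"
proof -
  have k: "lo \<le> k" and ab: "lo \<le> a" "mid \<le> b" using m by (auto simp: merging_def)
  have small: "v (p b) \<le> v (p y)" if "a \<le> y \<and> y < mid \<or> b \<le> y \<and> y < hi" for y
  proof (cases "mid \<le> y")
    case True
    then show ?thesis using that assms(3) ab by (auto simp: sorted_between_def)
  next
    case False
    then have y: "a \<le> y" "y < mid" using that ab by auto
    then have "v (p a) \<le> v (p y)" using assms(2) ab by (auto simp: sorted_between_def)
    moreover have "v (p b) \<le> v (p a)" using le y by simp
    ultimately show ?thesis by (rule order_trans[rotated])
  qed
  have "(q(k := p b)) ` {lo..<Suc k} = insert (p b) (q ` {lo..<k})"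
    using k by (auto simp: atLeastLessThanSuc)
  also have "\<dots> = p ` {lo..<a} \<union> p ` {mid..<Suc b}"
    using m ab by (auto simp: merging_def atLeastLessThanSuc)
  finally have img: "(q(k := p b)) ` {lo..<Suc k} = p ` {lo..<a} \<union> p ` {mid..<Suc b}" .
  have "sorted_between v (q(k := p b)) lo (Suc k)"
    using m b by (intro sorted_between_extend) (auto simp: merging_def)
  with img m b small show ?thesis unfolding merging_def by (auto simp: less_Suc_eq)
qed

text \<open>The test means: the left half is nonempty, and the right half is exhausted or has no
  smaller head. The disjunction is expressed by negations. Both operands of a conjunction are
  evaluated, but reading beyond the block is harmless as arrays are total.\<close>

definition merge_step :: com where
  "merge_step = Seq (Cond (BAnd (ILess (IVar ''a'') (IVar ''mid''))
        (BNot (BAnd (ILess (IVar ''b'') (IVar ''hi''))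
           (BNot (NLe (NGet ''V'' (IGet ''p'' (IVar ''a''))) (NGet ''V'' (IGet ''p'' (IVar ''b''))))))))
      (Seq (ISet ''q'' (IVar ''k'') (IGet ''p'' (IVar ''a''))) (ISet ''a'' (INum 0) (IAdd (IVar ''a'') (INum 1))))
      (Seq (ISet ''q'' (IVar ''k'') (IGet ''p'' (IVar ''b''))) (ISet ''b'' (INum 0) (IAdd (IVar ''b'') (INum 1)))))
    (ISet ''k'' (INum 0) (IAdd (IVar ''k'') (INum 1)))"

definition merge_start :: com where
  "merge_start = Seq (ISet ''a'' (INum 0) (IVar ''lo''))
    (Seq (ISet ''mid'' (INum 0) (IAdd (IVar ''lo'') (IVar ''w'')))
    (Seq (ISet ''b'' (INum 0) (IVar ''mid''))
    (Seq (ISet ''hi'' (INum 0) (IAdd (IVar ''mid'') (IVar ''w'')))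
         (ISet ''k'' (INum 0) (IVar ''lo'')))))"

definition merge_block :: com where
  "merge_block = Seq merge_start (While (ILess (IVar ''k'') (IVar ''hi'')) merge_step)"

definition merge_pass :: com where
  "merge_pass = Seq (ISet ''lo'' (INum 0) (INum 0))
    (Seq (While (ILess (IVar ''lo'') (IVar ''M'')) (Seq merge_block (ISet ''lo'' (INum 0) (IVar ''hi''))))
         (For ''x'' 0 (IVar ''M'') (ISet ''p'' (IVar ''x'') (IGet ''q'' (IVar ''x'')))))"

text \<open>Bottom-up merging with doubling width. As \<open>M\<close> is a power of two, sorted
  runs always come in pairs of full length.\<close>

definition merge_sort :: com where
  "merge_sort = Seq (ISet ''w'' (INum 0) (INum 1))
    (While (ILess (IVar ''w'') (IVar ''M''))
      (Seq merge_pass (ISet ''w'' (INum 0) (IAdd (IVar ''w'') (IVar ''w'')))))"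

lemma written_merge [simp]:
  "written_ints merge_step = {''q'', ''a'', ''b'', ''k''}"
  "written_ints merge_block = {''q'', ''a'', ''b'', ''k'', ''mid'', ''hi''}"
  "written_ints merge_pass = {''p'', ''q'', ''a'', ''b'', ''k'', ''mid'', ''hi'', ''lo'', ''x''}"
  "written_ints merge_sort = {''p'', ''q'', ''a'', ''b'', ''k'', ''mid'', ''hi'', ''lo'', ''x'', ''w''}"
  "written_nums merge_step = {}" "written_nums merge_block = {}"
  "written_nums merge_pass = {}" "written_nums merge_sort = {}"
  by (auto simp: merge_step_def merge_start_def merge_block_def merge_pass_def merge_sort_def)

lemma runs_merge_step:
  fixes \<sigma> :: state
  assumes m: "merging (nums \<sigma> ''V'') (ints \<sigma> ''p'') lo (ints \<sigma> ''mid'' 0) (ints \<sigma> ''hi'' 0)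
      (ints \<sigma> ''a'' 0) (ints \<sigma> ''b'' 0) (ints \<sigma> ''k'' 0) (ints \<sigma> ''q'')"
    and s: "sorted_between (nums \<sigma> ''V'') (ints \<sigma> ''p'') lo (ints \<sigma> ''mid'' 0)"
      "sorted_between (nums \<sigma> ''V'') (ints \<sigma> ''p'') (ints \<sigma> ''mid'' 0) (ints \<sigma> ''hi'' 0)"
    and k: "ints \<sigma> ''k'' 0 < ints \<sigma> ''hi'' 0"
  shows "runs merge_step 70 \<sigma> (\<lambda>\<sigma>'. ints \<sigma>' ''k'' 0 = Suc (ints \<sigma> ''k'' 0) \<and>
    (\<forall>x. x \<noteq> ints \<sigma> ''k'' 0 \<longrightarrow> ints \<sigma>' ''q'' x = ints \<sigma> ''q'' x) \<and>
    merging (nums \<sigma> ''V'') (ints \<sigma> ''p'') lo (ints \<sigma> ''mid'' 0) (ints \<sigma> ''hi'' 0)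
      (ints \<sigma>' ''a'' 0) (ints \<sigma>' ''b'' 0) (ints \<sigma>' ''k'' 0) (ints \<sigma>' ''q''))"
proof (cases "ints \<sigma> ''a'' 0 < ints \<sigma> ''mid'' 0 \<and> (ints \<sigma> ''b'' 0 < ints \<sigma> ''hi'' 0 \<longrightarrow>
    nums \<sigma> ''V'' (ints \<sigma> ''p'' (ints \<sigma> ''a'' 0)) \<le> nums \<sigma> ''V'' (ints \<sigma> ''p'' (ints \<sigma> ''b'' 0)))")
  case True
  with merging_left[OF m s] show ?thesis
    by (intro runs_loop_free) (auto simp: merge_step_def)
next
  case False
  \<comment> \<open>If the left half is exhausted, then \<open>a + b = mid + k\<close> forces
    \<open>b = k\<close>, which is below \<open>hi\<close>; otherwise the failed test itself says
    so.\<close>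
  have "ints \<sigma> ''b'' 0 < ints \<sigma> ''hi'' 0"
    using False m k by (auto simp: merging_def)
  moreover have "nums \<sigma> ''V'' (ints \<sigma> ''p'' (ints \<sigma> ''b'' 0)) \<le> nums \<sigma> ''V'' (ints \<sigma> ''p'' (ints \<sigma> ''a'' 0))"
    if "ints \<sigma> ''a'' 0 < ints \<sigma> ''mid'' 0" using False that by auto
  ultimately show ?thesis
    using merging_right[OF m s] False by (intro runs_loop_free) (auto simp: merge_step_def)
qed

lemma runs_merge_block:
  fixes \<sigma> :: state
  defines "w \<equiv> ints \<sigma> ''w'' 0" and "lo \<equiv> ints \<sigma> ''lo'' 0"
  assumes s: "sorted_between (nums \<sigma> ''V'') (ints \<sigma> ''p'') lo (lo + w)"
      "sorted_between (nums \<sigma> ''V'') (ints \<sigma> ''p'') (lo + w) (lo + w + w)"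
  shows "runs merge_block (2 * w * 80 + 45) \<sigma> (\<lambda>\<sigma>'. ints \<sigma>' ''hi'' 0 = lo + w + w \<and>
    (\<forall>x<lo. ints \<sigma>' ''q'' x = ints \<sigma> ''q'' x) \<and>
    ints \<sigma>' ''q'' ` {lo..<lo + w + w} = ints \<sigma> ''p'' ` {lo..<lo + w + w} \<and>
    sorted_between (nums \<sigma> ''V'') (ints \<sigma>' ''q'') lo (lo + w + w))"
proof -
  let ?v = "nums \<sigma> ''V''" and ?p = "ints \<sigma> ''p''"
  let ?J = "\<lambda>c (\<sigma>' :: state). nums \<sigma>' ''V'' = ?v \<and> ints \<sigma>' ''p'' = ?p \<and> ints \<sigma>' ''mid'' 0 = lo + w \<and>
    ints \<sigma>' ''hi'' 0 = lo + w + w \<and> ints \<sigma>' ''k'' 0 = lo + c \<and>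
    (\<forall>x<lo. ints \<sigma>' ''q'' x = ints \<sigma> ''q'' x) \<and>
    merging ?v ?p lo (lo + w) (lo + w + w) (ints \<sigma>' ''a'' 0) (ints \<sigma>' ''b'' 0) (ints \<sigma>' ''k'' 0) (ints \<sigma>' ''q'')"
  have "runs merge_start 30 \<sigma> (?J 0)"
    by (rule runs_loop_free) (auto simp: merge_start_def merging_def sorted_between_def lo_def w_def)
  then show ?thesis unfolding merge_block_def
  proof (rule runs_SeqI[where T' = "2 * w * 80 + 15"])
    fix \<sigma>1 assume J: "?J 0 \<sigma>1"
    show "runs (While (ILess (IVar ''k'') (IVar ''hi'')) merge_step) (2 * w * 80 + 15) \<sigma>1 (\<lambda>\<sigma>'. ints \<sigma>' ''hi'' 0 = lo + w + w \<and>
      (\<forall>x<lo. ints \<sigma>' ''q'' x = ints \<sigma> ''q'' x) \<and>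
      ints \<sigma>' ''q'' ` {lo..<lo + w + w} = ints \<sigma> ''p'' ` {lo..<lo + w + w} \<and>
      sorted_between (nums \<sigma> ''V'') (ints \<sigma>' ''q'') lo (lo + w + w))"
    proof (rule runs_While[where I = ?J and N = "2 * w" and T = 70])
      fix c \<sigma>2 assume c: "c < 2 * w" and J: "?J c \<sigma>2"
      have "runs merge_step 70 \<sigma>2 (\<lambda>\<sigma>'. ints \<sigma>' ''k'' 0 = Suc (ints \<sigma>2 ''k'' 0) \<and>
        (\<forall>x. x \<noteq> ints \<sigma>2 ''k'' 0 \<longrightarrow> ints \<sigma>' ''q'' x = ints \<sigma>2 ''q'' x) \<and>
        merging (nums \<sigma>2 ''V'') (ints \<sigma>2 ''p'') lo (ints \<sigma>2 ''mid'' 0) (ints \<sigma>2 ''hi'' 0)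
        (ints \<sigma>' ''a'' 0) (ints \<sigma>' ''b'' 0) (ints \<sigma>' ''k'' 0) (ints \<sigma>' ''q''))"
        by (rule runs_merge_step) (use J s c in auto)
      from runs_frame[OF this] have "runs merge_step 70 \<sigma>2 (?J (Suc c))"
      proof (rule runs_mono)
        fix \<sigma>3 assume *: "(ints \<sigma>3 ''k'' 0 = Suc (ints \<sigma>2 ''k'' 0) \<and>
          (\<forall>x. x \<noteq> ints \<sigma>2 ''k'' 0 \<longrightarrow> ints \<sigma>3 ''q'' x = ints \<sigma>2 ''q'' x) \<and>
          merging (nums \<sigma>2 ''V'') (ints \<sigma>2 ''p'') lo (ints \<sigma>2 ''mid'' 0) (ints \<sigma>2 ''hi'' 0)
          (ints \<sigma>3 ''a'' 0) (ints \<sigma>3 ''b'' 0) (ints \<sigma>3 ''k'' 0) (ints \<sigma>3 ''q'')) \<and>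
          same_except (written_ints merge_step) (written_nums merge_step) \<sigma>2 \<sigma>3"
        then have "nums \<sigma>3 ''V'' = nums \<sigma>2 ''V''" "ints \<sigma>3 ''p'' = ints \<sigma>2 ''p''"
          "ints \<sigma>3 ''mid'' = ints \<sigma>2 ''mid''" "ints \<sigma>3 ''hi'' = ints \<sigma>2 ''hi''"
          by (simp_all add: same_except_def)
        with * J show "?J (Suc c) \<sigma>3" by auto
      qed simp
      then show "bval \<sigma>2 (ILess (IVar ''k'') (IVar ''hi'')) \<and> runs merge_step 70 \<sigma>2 (?J (Suc c))"
        using J c by simp
    next
      fix \<sigma>2 assume "?J (2 * w) \<sigma>2"
      then show "\<not> bval \<sigma>2 (ILess (IVar ''k'') (IVar ''hi''))" by simp
    next
      fix \<sigma>2 assume J: "?J (2 * w) \<sigma>2"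
      then have m: "merging ?v ?p lo (lo + w) (lo + w + w) (ints \<sigma>2 ''a'' 0) (ints \<sigma>2 ''b'' 0) (lo + w + w) (ints \<sigma>2 ''q'')"
        by (auto simp: mult_2 add.assoc)
      \<comment> \<open>With \<open>k\<close> at the end of the block,
        \<open>a + b = mid + k\<close> leaves both read positions no choice but their upper
        limits.\<close>
      then have ab: "ints \<sigma>2 ''a'' 0 = lo + w" "ints \<sigma>2 ''b'' 0 = lo + w + w" by (auto simp: merging_def)
      have "ints \<sigma>2 ''q'' ` {lo..<lo + w + w} = ?p ` ({lo..<lo + w} \<union> {lo + w..<lo + w + w})"
        using m unfolding ab merging_def by (simp add: image_Un)
      also have "{lo..<lo + w} \<union> {lo + w..<lo + w + w} = {lo..<lo + w + w}" by auto
      finally show "ints \<sigma>2 ''hi'' 0 = lo + w + w \<and> (\<forall>x<lo. ints \<sigma>2 ''q'' x = ints \<sigma> ''q'' x) \<and>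
          ints \<sigma>2 ''q'' ` {lo..<lo + w + w} = ?p ` {lo..<lo + w + w} \<and>
          sorted_between ?v (ints \<sigma>2 ''q'') lo (lo + w + w)"
        using J m by (simp add: merging_def)
    qed (use J in auto)
  qed simp
qed

lemma runs_merge_pass:
  fixes \<sigma> :: state
  defines "w \<equiv> ints \<sigma> ''w'' 0" and "M \<equiv> ints \<sigma> ''M'' 0"
  assumes M: "M = N * (2 * w)" "0 < w" "0 < N"
    and s: "\<And>t. t < 2 * N \<Longrightarrow> sorted_between (nums \<sigma> ''V'') (ints \<sigma> ''p'') (t * w) (t * w + w)"
  shows "runs merge_pass (250 * M) \<sigma> (\<lambda>\<sigma>'.
    ints \<sigma>' ''p'' ` {..<M} = ints \<sigma> ''p'' ` {..<M} \<and>
    (\<forall>t<N. sorted_between (nums \<sigma> ''V'') (ints \<sigma>' ''p'') (t * (2 * w)) (t * (2 * w) + 2 * w)))"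
proof -
  let ?v = "nums \<sigma> ''V''" and ?p = "ints \<sigma> ''p''"
  let ?J = "\<lambda>t (\<sigma>' :: state). nums \<sigma>' ''V'' = ?v \<and> ints \<sigma>' ''p'' = ?p \<and> ints \<sigma>' ''w'' 0 = w \<and>
    ints \<sigma>' ''M'' 0 = M \<and> ints \<sigma>' ''lo'' 0 = t * (2 * w) \<and>
    ints \<sigma>' ''q'' ` {..<t * (2 * w)} = ?p ` {..<t * (2 * w)} \<and>
    (\<forall>t'<t. sorted_between ?v (ints \<sigma>' ''q'') (t' * (2 * w)) (t' * (2 * w) + 2 * w))"
  let ?body = "Seq merge_block (ISet ''lo'' (INum 0) (IVar ''hi''))"
  let ?loop = "While (ILess (IVar ''lo'') (IVar ''M'')) ?body"
  have NM: "N \<le> M" using M by simp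
  have start: "runs (ISet ''lo'' (INum 0) (INum 0)) 3 \<sigma> (?J 0)"
    by (rule runs_loop_free) (auto simp: w_def M_def)
  have loop: "runs ?loop (150 * M + 7) \<sigma>1 (?J N)" if "?J 0 \<sigma>1" for \<sigma>1
  proof (rule runs_While[where I = ?J and N = N and T = "2 * w * 80 + 50"])
    fix t \<sigma>2 assume t: "t < N" and J: "?J t \<sigma>2"
    let ?lo = "t * (2 * w)"
    have eq: "ints \<sigma>2 ''w'' 0 = w" "ints \<sigma>2 ''lo'' 0 = ?lo" "nums \<sigma>2 ''V'' = ?v" "ints \<sigma>2 ''p'' = ?p"
      using J by auto
    have test: "?lo < M" using t M by simp
    \<comment> \<open>Block \<open>t\<close> is made of the runs numbered \<open>2 * t\<close> and
      \<open>2 * t + 1\<close>.\<close>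
    have "sorted_between ?v ?p ?lo (?lo + w)" "sorted_between ?v ?p (?lo + w) (?lo + w + w)"
      using s[of "2 * t"] s[of "2 * t + 1"] t by (simp_all add: algebra_simps)
    then have "runs merge_block (2 * w * 80 + 45) \<sigma>2 (\<lambda>\<sigma>'. ints \<sigma>' ''hi'' 0 = ?lo + w + w \<and>
        (\<forall>x<?lo. ints \<sigma>' ''q'' x = ints \<sigma>2 ''q'' x) \<and>
        ints \<sigma>' ''q'' ` {?lo..<?lo + w + w} = ?p ` {?lo..<?lo + w + w} \<and>
        sorted_between ?v (ints \<sigma>' ''q'') ?lo (?lo + w + w))"
      using runs_merge_block[of \<sigma>2] unfolding eq by simp
    then have "runs ?body (2 * w * 80 + 50) \<sigma>2 (?J (Suc t))"
    proof (rule runs_SeqI[where T' = 5])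
      fix \<sigma>3 assume 3: "ints \<sigma>3 ''hi'' 0 = ?lo + w + w \<and>
        (\<forall>x<?lo. ints \<sigma>3 ''q'' x = ints \<sigma>2 ''q'' x) \<and>
        ints \<sigma>3 ''q'' ` {?lo..<?lo + w + w} = ?p ` {?lo..<?lo + w + w} \<and>
        sorted_between ?v (ints \<sigma>3 ''q'') ?lo (?lo + w + w)"
        and f: "same_except (written_ints merge_block) (written_nums merge_block) \<sigma>2 \<sigma>3"
      have hi: "?lo + w + w = Suc t * (2 * w)" by simp
      have split: "{..<Suc t * (2 * w)} = {..<?lo} \<union> {?lo..<?lo + w + w}" by auto
      have "ints \<sigma>3 ''q'' ` {..<?lo} = ints \<sigma>2 ''q'' ` {..<?lo}" using 3 by (intro image_cong) auto
      also have "\<dots> = ?p ` {..<?lo}" using J by simp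
      finally have img: "ints \<sigma>3 ''q'' ` {..<Suc t * (2 * w)} = ?p ` {..<Suc t * (2 * w)}"
        using 3 unfolding split image_Un by simp
      have srt: "sorted_between ?v (ints \<sigma>3 ''q'') (t' * (2 * w)) (t' * (2 * w) + 2 * w)" if "t' < Suc t" for t'
      proof (cases "t' = t")
        case True
        then show ?thesis using 3 by (simp add: mult_2 add.assoc)
      next
        case False
        with that have t': "t' < t" by simp
        \<comment> \<open>Earlier blocks end at or before \<open>?lo\<close>, and below
          \<open>?lo\<close> the merge leaves \<open>q\<close> alone.\<close>
        then have "Suc t' * (2 * w) \<le> ?lo" by (intro mult_le_mono1) simp
        then have "t' * (2 * w) + 2 * w \<le> ?lo" by simp
        then show ?thesis using J 3 t' by (auto simp: sorted_between_def)
      qed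
      have "?J (Suc t) (set_int ''lo'' 0 (?lo + w + w) \<sigma>3)"
        using img srt J f by (simp add: same_except_def)
      then show "runs (ISet ''lo'' (INum 0) (IVar ''hi'')) 5 \<sigma>3 (?J (Suc t))"
        using 3 by (intro runs_loop_free[where Q = "?J (Suc t)"]) simp_all
    qed simp
    then show "bval \<sigma>2 (ILess (IVar ''lo'') (IVar ''M'')) \<and> runs ?body (2 * w * 80 + 50) \<sigma>2 (?J (Suc t))"
      using J test by simp
  next
    fix \<sigma>2 assume "?J N \<sigma>2"
    then show "\<not> bval \<sigma>2 (ILess (IVar ''lo'') (IVar ''M''))" using M by simp
  next
    \<comment> \<open>A block costs 80 per cell plus a constant; the constants sum to a multiple of
      \<open>N\<close>, which is at most \<open>M\<close>.\<close>
    have "N * (2 * w * 80 + 50 + 6 + 1) = 80 * M + N * 57" unfolding M(1) by (simp add: algebra_simps)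
    then show "N * (2 * w * 80 + 50 + bcost (ILess (IVar ''lo'') (IVar ''M'')) + 1) +
      bcost (ILess (IVar ''lo'') (IVar ''M'')) + 1 \<le> 150 * M + 7" using NM by simp
  qed (use that in simp_all)
  have copy: "runs (For ''x'' 0 (IVar ''M'') (ISet ''p'' (IVar ''x'') (IGet ''q'' (IVar ''x'')))) (M * 30 + 10) \<sigma>2 (\<lambda>\<sigma>'.
      ints \<sigma>' ''p'' ` {..<M} = ?p ` {..<M} \<and>
      (\<forall>t<N. sorted_between ?v (ints \<sigma>' ''p'') (t * (2 * w)) (t * (2 * w) + 2 * w)))" if J: "?J N \<sigma>2" for \<sigma>2
  proof (rule runs_For[where hi = M and T = 10 and I = "\<lambda>k \<sigma>'. \<forall>x<k. ints \<sigma>' ''p'' x = ints \<sigma>2 ''q'' x"])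
    fix \<sigma>3 assume "\<forall>x<M. ints \<sigma>3 ''p'' x = ints \<sigma>2 ''q'' x"
    then have eq: "ints \<sigma>3 ''p'' x = ints \<sigma>2 ''q'' x" if "x < M" for x using that by simp
    have "ints \<sigma>3 ''p'' ` {..<M} = ints \<sigma>2 ''q'' ` {..<M}" by (intro image_cong) (auto simp: eq)
    moreover have "sorted_between ?v (ints \<sigma>3 ''p'') (t * (2 * w)) (t * (2 * w) + 2 * w)" if "t < N" for t
    proof -
      have "Suc t * (2 * w) \<le> M" unfolding M(1) using that by (intro mult_le_mono1) simp
      then have "t * (2 * w) + 2 * w \<le> M" by simp
      then show ?thesis using J that eq by (auto simp: sorted_between_def)
    qed
    ultimately show "ints \<sigma>3 ''p'' ` {..<M} = ?p ` {..<M} \<and>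
      (\<forall>t<N. sorted_between ?v (ints \<sigma>3 ''p'') (t * (2 * w)) (t * (2 * w) + 2 * w))"
      using J M by simp
  next
    fix k \<sigma>3 assume k: "ints \<sigma>3 ''x'' 0 = k" and I: "\<forall>x<k. ints \<sigma>3 ''p'' x = ints \<sigma>2 ''q'' x"
      and f: "same_except (insert ''x'' (written_ints (ISet ''p'' (IVar ''x'') (IGet ''q'' (IVar ''x'')))))
        (written_nums (ISet ''p'' (IVar ''x'') (IGet ''q'' (IVar ''x'')))) \<sigma>2 \<sigma>3"
    have "ints \<sigma>3 ''q'' = ints \<sigma>2 ''q''" using f by (simp add: same_except_def)
    then show "runs (ISet ''p'' (IVar ''x'') (IGet ''q'' (IVar ''x''))) 10 \<sigma>3
        (\<lambda>\<sigma>'. \<forall>x<Suc k. ints (set_int ''x'' 0 (Suc k) \<sigma>') ''p'' x = ints \<sigma>2 ''q'' x)"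
      using k I by (intro runs_loop_free) (auto simp: less_Suc_eq)
  next
    fix \<sigma>3 assume "same_except (insert ''x'' (written_ints (ISet ''p'' (IVar ''x'') (IGet ''q'' (IVar ''x'')))))
        (written_nums (ISet ''p'' (IVar ''x'') (IGet ''q'' (IVar ''x'')))) \<sigma>2 \<sigma>3"
    then have "ints \<sigma>3 ''M'' = ints \<sigma>2 ''M''" by (simp add: same_except_def)
    then show "ival \<sigma>3 (IVar ''M'') = M" using J by simp
  qed simp_all
  show ?thesis unfolding merge_pass_def
    using start
  proof (rule runs_SeqI[where T' = "150 * M + 7 + (M * 30 + 10)"])
    fix \<sigma>1 assume "?J 0 \<sigma>1"
    from loop[OF this] show "runs (Seq ?loop (For ''x'' 0 (IVar ''M'') (ISet ''p'' (IVar ''x'') (IGet ''q'' (IVar ''x'')))))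
      (150 * M + 7 + (M * 30 + 10)) \<sigma>1 (\<lambda>\<sigma>'.
      ints \<sigma>' ''p'' ` {..<M} = ?p ` {..<M} \<and>
      (\<forall>t<N. sorted_between ?v (ints \<sigma>' ''p'') (t * (2 * w)) (t * (2 * w) + 2 * w)))"
      by (rule runs_SeqI[OF _ copy]) simp_all
  next
    have "1 \<le> M" using M by simp
    then show "3 + (150 * M + 7 + (M * 30 + 10)) \<le> 250 * M" by simp
  qed
qed

lemma runs_merge_sort:
  fixes \<sigma> :: state
  assumes M: "ints \<sigma> ''M'' 0 = 2 ^ e"
  shows "runs merge_sort (e * (270 * 2 ^ e) + 15) \<sigma> (\<lambda>\<sigma>'.
    ints \<sigma>' ''p'' ` {..<2 ^ e} = ints \<sigma> ''p'' ` {..<2 ^ e} \<and>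
    sorted_between (nums \<sigma> ''V'') (ints \<sigma>' ''p'') 0 (2 ^ e))"
proof -
  let ?v = "nums \<sigma> ''V''"
  \<comment> \<open>After \<open>h\<close> passes there are \<open>2 ^ (e - h)\<close> sorted runs
    of length \<open>2 ^ h\<close>; for \<open>h = e\<close> this is the whole array.\<close>
  let ?J = "\<lambda>h (\<sigma>' :: state). nums \<sigma>' ''V'' = ?v \<and> ints \<sigma>' ''w'' 0 = 2 ^ h \<and> ints \<sigma>' ''M'' 0 = 2 ^ e \<and>
    ints \<sigma>' ''p'' ` {..<2 ^ e} = ints \<sigma> ''p'' ` {..<2 ^ e} \<and>
    (\<forall>t<2 ^ (e - h). sorted_between ?v (ints \<sigma>' ''p'') (t * 2 ^ h) (t * 2 ^ h + 2 ^ h))"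
  let ?body = "Seq merge_pass (ISet ''w'' (INum 0) (IAdd (IVar ''w'') (IVar ''w'')))"
  have "runs (ISet ''w'' (INum 0) (INum 1)) 3 \<sigma> (?J 0)"
    by (rule runs_loop_free) (auto simp: M sorted_between_singleton)
  then show ?thesis unfolding merge_sort_def
  proof (rule runs_SeqI[where T' = "e * (270 * 2 ^ e) + 12"])
    fix \<sigma>1 assume J: "?J 0 \<sigma>1"
    show "runs (While (ILess (IVar ''w'') (IVar ''M'')) ?body) (e * (270 * 2 ^ e) + 12) \<sigma>1 (\<lambda>\<sigma>'.
      ints \<sigma>' ''p'' ` {..<2 ^ e} = ints \<sigma> ''p'' ` {..<2 ^ e} \<and>
      sorted_between ?v (ints \<sigma>' ''p'') 0 (2 ^ e))"
    proof (rule runs_While[where I = ?J and N = e and T = "250 * 2 ^ e + 10"])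
      fix h \<sigma>2 assume h: "h < e" and J: "?J h \<sigma>2"
      have eq: "ints \<sigma>2 ''w'' 0 = 2 ^ h" "ints \<sigma>2 ''M'' 0 = 2 ^ e" "nums \<sigma>2 ''V'' = ?v" using J by auto
      have e: "e = (e - Suc h) + Suc h" and eh: "e - h = Suc (e - Suc h)" using h by auto
      have "(2::nat) ^ e = 2 ^ (e - Suc h) * (2 * 2 ^ h)"
        by (subst e) (simp only: power_add power_Suc)
      then have "runs merge_pass (250 * 2 ^ e) \<sigma>2 (\<lambda>\<sigma>'.
        ints \<sigma>' ''p'' ` {..<2 ^ e} = ints \<sigma>2 ''p'' ` {..<2 ^ e} \<and>
        (\<forall>t<2 ^ (e - Suc h). sorted_between ?v (ints \<sigma>' ''p'') (t * (2 * 2 ^ h)) (t * (2 * 2 ^ h) + 2 * 2 ^ h)))"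
        using runs_merge_pass[of \<sigma>2 "2 ^ (e - Suc h)"] J unfolding eq eh by simp
      then have "runs ?body (250 * 2 ^ e + 10) \<sigma>2 (?J (Suc h))"
      proof (rule runs_SeqI[where T' = 10])
        fix \<sigma>3 assume 3: "ints \<sigma>3 ''p'' ` {..<2 ^ e} = ints \<sigma>2 ''p'' ` {..<2 ^ e} \<and>
          (\<forall>t<2 ^ (e - Suc h). sorted_between ?v (ints \<sigma>3 ''p'') (t * (2 * 2 ^ h)) (t * (2 * 2 ^ h) + 2 * 2 ^ h))"
          and f: "same_except (written_ints merge_pass) (written_nums merge_pass) \<sigma>2 \<sigma>3"
        then have "?J (Suc h) (set_int ''w'' 0 (2 ^ h + 2 ^ h) \<sigma>3)"
          using J by (simp add: same_except_def mult_2)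
        moreover have "ints \<sigma>3 ''w'' 0 = 2 ^ h" using f eq by (simp add: same_except_def)
        ultimately show "runs (ISet ''w'' (INum 0) (IAdd (IVar ''w'') (IVar ''w''))) 10 \<sigma>3 (?J (Suc h))"
          by (intro runs_loop_free[where Q = "?J (Suc h)"]) simp_all
      qed simp
      then show "bval \<sigma>2 (ILess (IVar ''w'') (IVar ''M'')) \<and> runs ?body (250 * 2 ^ e + 10) \<sigma>2 (?J (Suc h))"
        using J h by simp
    next
      fix \<sigma>2 assume "?J e \<sigma>2"
      then show "ints \<sigma>2 ''p'' ` {..<2 ^ e} = ints \<sigma> ''p'' ` {..<2 ^ e} \<and>
        sorted_between ?v (ints \<sigma>2 ''p'') 0 (2 ^ e)" by simp
    next
      have "250 * 2 ^ e + 10 + 7 \<le> 270 * (2 ^ e :: nat)" using one_le_power[of "2::nat" e] by linarith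
      note le = mult_le_mono2[OF this, of e]
      show "e * (250 * 2 ^ e + 10 + bcost (ILess (IVar ''w'') (IVar ''M'')) + 1) +
        bcost (ILess (IVar ''w'') (IVar ''M'')) + 1 \<le> e * (270 * 2 ^ e) + 12"
        by simp (rule trans_le_add2, use le in \<open>simp add: add.commute\<close>)
    qed (use J in simp_all)
  qed simp
qed

section \<open>Initialisation and separation of the groups\<close>

text \<open>Items occupy the cells 1 to \<open>2 * n\<close> and cell 0 is padding, hence
  \<open>2 * n + 1\<close> cells rounded up to a power of two. The same exponent later bounds the
  number of bits of a chunk number.\<close>

definition levels :: "nat \<Rightarrow> nat" where
  "levels n = (LEAST e. 2 * n + 1 \<le> 2 ^ e)"

lemma levels_ge: "2 * n + 1 \<le> 2 ^ levels n"
  unfolding levels_def by (rule LeastI[of _ "2 * n + 1"]) (use less_exp[of "2 * n + 1"] in linarith)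

lemma levels_less: "h < levels n \<Longrightarrow> 2 ^ h < 2 * n + 1"
  using not_less_Least[of h] unfolding levels_def by fastforce

lemma levels_le: assumes "1 \<le> n" shows "2 ^ levels n \<le> 4 * n"
proof (cases "levels n")
  case 0
  then show ?thesis using assms by simp
next
  case (Suc h)
  then show ?thesis using levels_less[of h n] by simp
qed

lemma levels_log: assumes "1 \<le> n" shows "real (levels n) \<le> log 2 (real n) + 2"
proof -
  have "real (2 ^ levels n) \<le> real (4 * n)" by (rule of_nat_mono[OF levels_le[OF assms]])
  then have "(2::real) ^ levels n \<le> 4 * real n" by simp
  then have "log 2 (2 ^ levels n) \<le> log 2 (4 * real n)" using assms by (intro log_mono) auto
  moreover have "log 2 (4 * real n) = log 2 4 + log 2 (real n)" using assms by (intro log_mult_pos) auto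
  moreover have "log 2 (2 ^ levels n) = real (levels n)" by (subst log_nat_power) auto
  moreover have "log 2 4 = (2::real)" using log_nat_power[of 2 2 2] by simp
  ultimately show ?thesis by linarith
qed

definition choose_size :: com where
  "choose_size = Seq (ISet ''M'' (INum 0) (INum 1))
     (While (ILess (IVar ''M'') (IAdd (IAdd (IVar ''n'') (IVar ''n'')) (INum 1)))
       (ISet ''M'' (INum 0) (IAdd (IVar ''M'') (IVar ''M''))))"

text \<open>Halves and parities follow the recurrences \<open>half (x + 1) = half x + par x\<close>
  and \<open>par (x + 1) = 1 - par x\<close>; the entries at 0 come from the zero-initialised
  memory.\<close>

definition fill_tables :: com where
  "fill_tables = For ''x'' 0 (IVar ''M'')
     (Seq (NSet ''V'' (IVar ''x'') NInf)
     (Seq (ISet ''p'' (IVar ''x'') (IVar ''x''))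
     (Seq (ISet ''half'' (IAdd (IVar ''x'') (INum 1)) (IAdd (IGet ''half'' (IVar ''x'')) (IGet ''par'' (IVar ''x''))))
          (ISet ''par'' (IAdd (IVar ''x'') (INum 1)) (ISub (INum 1) (IGet ''par'' (IVar ''x'')))))))"

definition load_values :: com where
  "load_values = For ''i'' 1 (IAdd (IVar ''n'') (INum 1))
     (Seq (NSet ''V'' (IVar ''i'') (NGet ''A'' (IVar ''i'')))
          (NSet ''V'' (IAdd (IVar ''n'') (IVar ''i'')) (NGet ''B'' (IVar ''i''))))"

lemma written_setup [simp]:
  "written_ints choose_size = {''M''}" "written_nums choose_size = {}"
  "written_ints fill_tables = {''x'', ''p'', ''half'', ''par''}" "written_nums fill_tables = {''V''}"
  "written_ints load_values = {''i''}" "written_nums load_values = {''V''}"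
  by (auto simp: choose_size_def fill_tables_def load_values_def)

lemma runs_choose_size:
  assumes n: "ints \<sigma> ''n'' 0 = n"
  shows "runs choose_size (levels n * 20 + 20) \<sigma> (\<lambda>\<sigma>'. ints \<sigma>' ''M'' 0 = 2 ^ levels n)"
proof -
  let ?J = "\<lambda>h (\<sigma>' :: state). ints \<sigma>' ''n'' 0 = n \<and> ints \<sigma>' ''M'' 0 = 2 ^ h"
  have "runs (ISet ''M'' (INum 0) (INum 1)) 3 \<sigma> (?J 0)"
    by (rule runs_loop_free) (simp_all add: n)
  then show ?thesis unfolding choose_size_def
  proof (rule runs_SeqI[where T' = "levels n * 20 + 15"])
    fix \<sigma>1 assume J: "?J 0 \<sigma>1"
    show "runs (While (ILess (IVar ''M'') (IAdd (IAdd (IVar ''n'') (IVar ''n'')) (INum 1)))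
       (ISet ''M'' (INum 0) (IAdd (IVar ''M'') (IVar ''M'')))) (levels n * 20 + 15) \<sigma>1
       (\<lambda>\<sigma>'. ints \<sigma>' ''M'' 0 = 2 ^ levels n)"
    proof (rule runs_While[where I = ?J and N = "levels n" and T = 7])
      fix h \<sigma>2 assume h: "h < levels n" and J: "?J h \<sigma>2"
      have "runs (ISet ''M'' (INum 0) (IAdd (IVar ''M'') (IVar ''M''))) 7 \<sigma>2 (?J (Suc h))"
        by (rule runs_loop_free) (use J in simp_all)
      then show "bval \<sigma>2 (ILess (IVar ''M'') (IAdd (IAdd (IVar ''n'') (IVar ''n'')) (INum 1))) \<and>
        runs (ISet ''M'' (INum 0) (IAdd (IVar ''M'') (IVar ''M''))) 7 \<sigma>2 (?J (Suc h))"
        using J levels_less[OF h] by simp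
    next
      fix \<sigma>2 assume "?J (levels n) \<sigma>2"
      then show "\<not> bval \<sigma>2 (ILess (IVar ''M'') (IAdd (IAdd (IVar ''n'') (IVar ''n'')) (INum 1)))"
        using levels_ge[of n] by simp
    qed (use J in simp_all)
  qed simp
qed

lemma runs_fill_tables:
  assumes M: "ints \<sigma> ''M'' 0 = m" and z: "ints \<sigma> ''half'' 0 = 0" "ints \<sigma> ''par'' 0 = 0"
  shows "runs fill_tables (m * 50 + 10) \<sigma> (\<lambda>\<sigma>'.
    \<forall>x<m. nums \<sigma>' ''V'' x = \<infinity> \<and> ints \<sigma>' ''p'' x = x \<and> ints \<sigma>' ''half'' x = x div 2 \<and> ints \<sigma>' ''par'' x = x mod 2)"
  unfolding fill_tables_def
\<comment> \<open>The two tables are one entry ahead of the counter, hence \<open>x \<le> k\<close>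
  for them.\<close>
proof (rule runs_For[where hi = m and T = 35 and I = "\<lambda>k \<sigma>'.
    (\<forall>x<k. nums \<sigma>' ''V'' x = \<infinity> \<and> ints \<sigma>' ''p'' x = x) \<and>
    (\<forall>x\<le>k. ints \<sigma>' ''half'' x = x div 2 \<and> ints \<sigma>' ''par'' x = x mod 2)"], goal_cases)
  case (5 k \<sigma>')
  have "k div 2 + k mod 2 = Suc k div 2" "1 - k mod 2 = Suc k mod 2" by (simp_all add: div_Suc mod_Suc)
  then show ?case using 5 by (intro runs_loop_free) (auto simp: less_Suc_eq le_Suc_eq)
qed (use M z in \<open>simp_all add: same_except_def\<close>)

context covering_input
begin

text \<open>Padding holds \<infinity>, which is itself a legal entry, so facts about groups apply to
  the full array.\<close>

definition item :: "nat \<Rightarrow> ereal" where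
  "item x = (if x \<in> {1..n} then A x else if x \<in> {n + 1..2 * n} then B (x - n) else \<infinity>)"

lemma item_A: "i \<in> {1..n} \<Longrightarrow> item i = A i" and item_B: "i \<in> {1..n} \<Longrightarrow> item (n + i) = B i"
  by (auto simp: item_def)

lemma item_Rplus: "item x \<in> Rplus"
proof -
  have "B (x - n) \<in> Rplus" if "x \<in> {n + 1..2 * n}" using that by (intro Pi_mem[OF B]) auto
  then show ?thesis using A by (auto simp: item_def Rplus_def)
qed

lemma runs_load_values:
  assumes load: "loaded \<sigma>" and V: "\<forall>x<m. nums \<sigma> ''V'' x = \<infinity>"
  shows "runs load_values (n * 40 + 20) \<sigma> (\<lambda>\<sigma>'. \<forall>x<m. nums \<sigma>' ''V'' x = item x)"
  unfolding load_values_def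
proof (rule runs_For[where hi = "Suc n" and T = 20 and I = "\<lambda>k \<sigma>'. \<forall>x<m. nums \<sigma>' ''V'' x =
    (if x \<in> {1..<k} then A x else if x \<in> {n + 1..<n + k} then B (x - n) else \<infinity>)"], goal_cases)
  case (5 k \<sigma>')
  have eq: "ints \<sigma>' ''n'' 0 = n" "nums \<sigma>' ''A'' k = A k" "nums \<sigma>' ''B'' k = B k"
    using 5(1-3) load by (simp_all add: same_except_def loaded_def)
  show ?case using 5(1,2,4,5) eq by (intro runs_loop_free) auto
next
  case (6 \<sigma>')
  then show ?case by (auto simp: item_def)
qed (use load V in \<open>auto simp: same_except_def loaded_def\<close>)

end

text \<open>Collects what sorting delivers, so that the combinatorics of groups can be developed
  apart from machine states.\<close>

locale grouped_input = covering_input +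
  fixes e :: nat and p :: "nat \<Rightarrow> nat"
  assumes big: "2 * n + 1 \<le> 2 ^ e" and perm: "p ` {..<2 ^ e} = {..<2 ^ e}"
    and srt: "sorted_between item p 0 (2 ^ e)"
begin

lemma inj: "inj_on p {..<2 ^ e}"
  by (rule eq_card_imp_inj_on) (simp_all add: perm)

abbreviation v :: "nat \<Rightarrow> ereal" where "v k \<equiv> item (p k)"

definition number :: "nat \<Rightarrow> nat" where
  "number x = group \<epsilon> v (inv_into {..<2 ^ e} p x)"

lemma number_p: "k < 2 ^ e \<Longrightarrow> number (p k) = group \<epsilon> v k"
  using inj by (simp add: number_def inv_into_f_f)

lemma p_less: "k < 2 ^ e \<Longrightarrow> p k < 2 ^ e"
  using perm by blast

lemma p_onto: assumes "x < 2 ^ e" obtains k where "k < 2 ^ e" "x = p k"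
  using perm assms by (metis imageE lessThan_iff)

text \<open>A group number is at most \<open>3 * (2 ^ e - 1)\<close> and the shift adds at most 2.
  Chunk numbers thus have \<open>e\<close> bits and are legal indices of the tables.\<close>

lemma number_bound: assumes "x < 2 ^ e" "r < 3" shows "(number x + r) div 3 < 2 ^ e"
proof -
  obtain k where k: "k < 2 ^ e" "x = p k" using p_onto[OF assms(1)] .
  have "number x + r < 3 * 2 ^ e"
    using group_bound[of \<epsilon> v k] assms(2) k number_p[OF k(1)] by simp
  then show ?thesis by simp
qed

lemma number_separation:
  assumes "x < 2 ^ e" "y < 2 ^ e"
  shows "number x + 2 \<le> number y \<Longrightarrow> item x \<le> ereal \<epsilon> * item y"
    and "number y \<le> number x + 1 \<Longrightarrow> ereal \<epsilon> * (ereal \<epsilon> * (ereal \<epsilon> * item y)) \<le> item x"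
proof -
  obtain k l where kl: "k < 2 ^ e" "x = p k" "l < 2 ^ e" "y = p l" using p_onto assms by metis
  have "\<forall>x y. x \<le> y \<and> y < 2 ^ e \<longrightarrow> v x \<le> v y" using srt by (simp add: sorted_between_def)
  moreover have "\<forall>x<2 ^ e. 0 \<le> v x" by (simp add: Rplus_ge_0 item_Rplus)
  ultimately have sep: "group \<epsilon> v k + 2 \<le> group \<epsilon> v l \<Longrightarrow> v k \<le> ereal \<epsilon> * v l"
    "group \<epsilon> v l \<le> group \<epsilon> v k + 1 \<Longrightarrow> ereal \<epsilon> * (ereal \<epsilon> * (ereal \<epsilon> * v l)) \<le> v k"
    using group_separation[of \<epsilon> "2 ^ e" v k l] \<epsilon> kl by auto
  show "item x \<le> ereal \<epsilon> * item y" if "number x + 2 \<le> number y"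
    using sep(1) that kl number_p by simp
  show "ereal \<epsilon> * (ereal \<epsilon> * (ereal \<epsilon> * item y)) \<le> item x" if "number y \<le> number x + 1"
    using sep(2) that kl number_p by simp
qed

section \<open>Masks separating distant pairs\<close>

definition active :: "nat \<Rightarrow> nat \<Rightarrow> nat \<Rightarrow> nat \<Rightarrow> bool" where
  "active r h d x \<longleftrightarrow> (number x + r) mod 3 \<noteq> 0 \<and> (number x + r) div 3 div 2 ^ h mod 2 = d"

definition masked :: "nat \<Rightarrow> nat \<Rightarrow> nat \<Rightarrow> nat \<Rightarrow> ereal" where
  "masked r h d x = (if active r h d x then item x * ereal (1 + \<epsilon>) else \<infinity>)"

text \<open>If one side is masked out, the maximum is \<infinity>. Otherwise bit \<open>h\<close>
  distinguishes the two chunks, so the group numbers differ by at least 2, the smaller item is at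
  most \<epsilon> times the larger, and the scaled larger item dominates the sum.\<close>

lemma valid_masked:
  assumes "d \<noteq> d'"
  shows "valid_pair n A B (masked r h d) (\<lambda>j. masked r h d' (n + j))"
  unfolding valid_pair_def
proof (intro conjI ballI Pi_I)
  have *: "masked r h d x \<in> Rplus" for d x
    using Rplus_scale[OF item_Rplus, of "1 + \<epsilon>"] \<epsilon> by (simp add: masked_def Rplus_def)
  fix i assume "i \<in> {1..n}"
  show "masked r h d i \<in> Rplus" "masked r h d' (n + i) \<in> Rplus" by (rule *)+
next
  fix i j assume ij: "i \<in> {1..n}" "j \<in> {1..n}"
  show "A i + B j \<le> max (masked r h d i) (masked r h d' (n + j))"
  proof (cases "active r h d i \<and> active r h d' (n + j)")
    case False
    then have "max (masked r h d i) (masked r h d' (n + j)) = \<infinity>" by (auto simp: masked_def max_def)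
    then show ?thesis by simp
  next
    case True
    then have "(number i + r) div 3 \<noteq> (number (n + j) + r) div 3" using assms by (auto simp: active_def)
    then have far: "number i + 2 \<le> number (n + j) \<or> number (n + j) + 2 \<le> number i"
      using chunks_far_apart[of "number i" r "number (n + j)"] True by (simp add: active_def)
    have lt: "i < 2 ^ e" "n + j < 2 ^ e" using ij big by auto
    have nn: "0 \<le> item x" for x by (rule Rplus_ge_0[OF item_Rplus])
    have eq: "A i = item i" "B j = item (n + j)" using ij item_A item_B by auto
    from far show ?thesis
    proof
      assume "number i + 2 \<le> number (n + j)"
      then have "item i + item (n + j) \<le> item (n + j) * ereal (1 + \<epsilon>)"
        by (intro sum_le_larger[OF nn _ \<epsilon>(1)] number_separation(1)[OF lt])
      then show ?thesis using True by (simp add: eq masked_def max.coboundedI2)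
    next
      assume "number (n + j) + 2 \<le> number i"
      then have "item (n + j) + item i \<le> item i * ereal (1 + \<epsilon>)"
        by (intro sum_le_larger[OF nn _ \<epsilon>(1)] number_separation(1)[OF lt(2,1)])
      then show ?thesis using True by (simp add: eq masked_def max.coboundedI1 add.commute)
    qed
  qed
qed

definition split_at :: "nat \<Rightarrow> nat \<Rightarrow> nat \<Rightarrow> nat \<Rightarrow> bool" where
  "split_at r h i j \<longleftrightarrow> active r h 0 i \<and> active r h 1 (n + j) \<or> active r h 1 i \<and> active r h 0 (n + j)"

lemma masked_covers:
  assumes "i \<in> {1..n}" "j \<in> {1..n}" "active r h d i" "active r h d' (n + j)"
  shows "covers \<epsilon> (A i) (B j) (masked r h d i) (masked r h d' (n + j))"
  using scaled_covers[OF item_Rplus item_Rplus \<epsilon>(1), of i "n + j"] assms item_A[of i] item_B[of j]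
  by (simp add: masked_def)

text \<open>Group numbers differing by at most 1 give closeness in both directions. Otherwise some
  shift keeps both items, their chunks differ, and so does some bit.\<close>

lemma close_or_split:
  assumes ij: "i \<in> {1..n}" "j \<in> {1..n}"
  obtains "ereal \<epsilon> * (ereal \<epsilon> * (ereal \<epsilon> * A i)) \<le> B j" "ereal \<epsilon> * (ereal \<epsilon> * (ereal \<epsilon> * B j)) \<le> A i"
  | r h where "r < 3" "h < e" "split_at r h i j"
proof (cases "number i + 2 \<le> number (n + j) \<or> number (n + j) + 2 \<le> number i")
  case False
  have lt: "i < 2 ^ e" "n + j < 2 ^ e" using ij big by auto
  from False number_separation(2)[OF lt] number_separation(2)[OF lt(2,1)] that(1) show thesis
    using item_A[OF ij(1)] item_B[OF ij(2)] by simp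
next
  case True
  have lt: "i < 2 ^ e" "n + j < 2 ^ e" using ij big by auto
  obtain r where r: "r < 3" "(number i + r) mod 3 \<noteq> 0" "(number (n + j) + r) mod 3 \<noteq> 0"
    by (rule good_shift)
  then have "(number i + r) div 3 \<noteq> (number (n + j) + r) div 3" using chunks_far_apart True by simp
  then obtain h where h: "h < e"
    "(number i + r) div 3 div 2 ^ h mod 2 \<noteq> (number (n + j) + r) div 3 div 2 ^ h mod 2"
    using bits_differ number_bound[OF lt(1) r(1)] number_bound[OF lt(2) r(1)] by metis
  have "split_at r h i j" unfolding split_at_def active_def using r(2,3) h(2) by auto
  with that(2) r(1) h(1) show thesis .
qed

end

section \<open>The distant pairs and the whole program\<close>

definition scan_start :: com where
  "scan_start = Seq (NSet ''base'' (INum 0) (NGet ''V'' (IGet ''p'' (INum 0))))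
    (Seq (NSet ''prev'' (INum 0) (NVar ''base''))
    (Seq (ISet ''c'' (INum 0) (INum 0)) (ISet ''m'' (INum 0) (IVar ''r''))))"

text \<open>\<open>c\<close> and \<open>m\<close> hold quotient and remainder mod 3 of the shifted
  group number. A jump by 1 increments \<open>m\<close> with carry into \<open>c\<close>; a jump by
  3 increments \<open>c\<close> only.\<close>

definition scan_step :: com where
  "scan_step = Seq (NSet ''v'' (INum 0) (NGet ''V'' (IGet ''p'' (IVar ''k''))))
    (Seq (Cond (NLe (NMul (NVar ''eps'') (NVar ''v'')) (NVar ''base'')) Skip
      (Seq (Cond (NLe (NMul (NVar ''eps'') (NVar ''v'')) (NVar ''prev''))
              (Cond (ILe (INum 2) (IVar ''m''))
                 (Seq (ISet ''m'' (INum 0) (INum 0)) (ISet ''c'' (INum 0) (IAdd (IVar ''c'') (INum 1))))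
                 (ISet ''m'' (INum 0) (IAdd (IVar ''m'') (INum 1))))
              (ISet ''c'' (INum 0) (IAdd (IVar ''c'') (INum 1))))
           (NSet ''base'' (INum 0) (NVar ''v''))))
    (Seq (NSet ''prev'' (INum 0) (NVar ''v''))
    (Seq (ISet ''C'' (IGet ''p'' (IVar ''k'')) (IVar ''c''))
         (ISet ''R'' (IGet ''p'' (IVar ''k'')) (IVar ''m'')))))"

definition number_items :: com where
  "number_items = Seq scan_start (For ''k'' 0 (IVar ''M'') scan_step)"

text \<open>\<open>U\<close> receives the items whose current bit is 0, \<open>W\<close> those whose
  bit is 1. Halving \<open>C\<close> afterwards makes the next bit the lowest one.\<close>

definition mask_items :: com where
  "mask_items = For ''x'' 0 (IVar ''M'')
    (Seq (NSet ''U'' (IVar ''x'') NInf)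
    (Seq (NSet ''W'' (IVar ''x'') NInf)
    (Seq (Cond (ILe (INum 1) (IGet ''R'' (IVar ''x'')))
           (Cond (ILe (INum 1) (IGet ''par'' (IGet ''C'' (IVar ''x''))))
             (NSet ''W'' (IVar ''x'') (NMul (NGet ''V'' (IVar ''x'')) (NAdd NOne (NVar ''eps''))))
             (NSet ''U'' (IVar ''x'') (NMul (NGet ''V'' (IVar ''x'')) (NAdd NOne (NVar ''eps'')))))
           Skip)
         (ISet ''C'' (IVar ''x'') (IGet ''half'' (IGet ''C'' (IVar ''x'')))))))"

text \<open>The two emissions are the two ways of assigning the bit values to \<open>A\<close> and
  \<open>B\<close>. \<open>P\<close> is \<open>2 ^ h\<close> at level \<open>h\<close>, so comparing
  it with \<open>M = 2 ^ e\<close> counts \<open>e\<close> levels.\<close>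

definition split_level :: com where
  "split_level = Seq mask_items
    (Seq (emit (NGet ''U'' (IVar ''i'')) (NGet ''W'' (IAdd (IVar ''n'') (IVar ''i''))))
    (Seq (emit (NGet ''W'' (IVar ''i'')) (NGet ''U'' (IAdd (IVar ''n'') (IVar ''i''))))
         (ISet ''P'' (INum 0) (IAdd (IVar ''P'') (IVar ''P'')))))"

definition split_round :: com where
  "split_round = Seq number_items (Seq (ISet ''P'' (INum 0) (INum 1))
     (While (ILess (IVar ''P'') (IVar ''M'')) split_level))"

definition distant_phase :: com where
  "distant_phase = For ''r'' 0 (INum 3) split_round"

lemma written_distant [simp]:
  "written_ints number_items = {''k'', ''c'', ''m'', ''C'', ''R''}"
  "written_nums number_items = {''base'', ''prev'', ''v''}"
  "written_ints mask_items = {''x'', ''C''}" "written_nums mask_items = {''U'', ''W''}"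
  "written_ints split_level = {''x'', ''C'', ''i'', ''off'', ''s'', ''P''}"
  "written_nums split_level = {''U'', ''W'', ''A_out'', ''B_out''}"
  "written_ints split_round = {''k'', ''c'', ''m'', ''C'', ''R'', ''x'', ''i'', ''off'', ''s'', ''P''}"
  "written_nums split_round = {''base'', ''prev'', ''v'', ''U'', ''W'', ''A_out'', ''B_out''}"
  by (auto simp: number_items_def scan_start_def scan_step_def mask_items_def split_level_def split_round_def)

context grouped_input
begin

definition ready :: "state \<Rightarrow> bool" where
  "ready \<sigma> \<longleftrightarrow> loaded \<sigma> \<and> ints \<sigma> ''M'' 0 = 2 ^ e \<and> (\<forall>x<2 ^ e. ints \<sigma> ''p'' x = p x \<and>
     nums \<sigma> ''V'' x = item x \<and> ints \<sigma> ''half'' x = x div 2 \<and> ints \<sigma> ''par'' x = x mod 2)"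

lemma ready_same_except:
  "ready \<sigma> \<Longrightarrow> same_except X Y \<sigma> \<sigma>' \<Longrightarrow> X \<inter> {''n'', ''M'', ''p'', ''half'', ''par''} = {} \<Longrightarrow>
    Y \<inter> {''eps'', ''A'', ''B'', ''V''} = {} \<Longrightarrow> ready \<sigma>'"
  unfolding ready_def loaded_def same_except_def by auto

lemma runs_number_items:
  assumes ready: "ready \<sigma>" and r: "ints \<sigma> ''r'' 0 = r" "r < 3"
  shows "runs number_items (130 * 2 ^ e) \<sigma> (\<lambda>\<sigma>'. \<forall>x<2 ^ e.
    ints \<sigma>' ''C'' x = (number x + r) div 3 \<and> ints \<sigma>' ''R'' x = (number x + r) mod 3)"
proof -
  \<comment> \<open>By truncated subtraction \<open>k - 1\<close> is 0 for \<open>k = 0\<close> as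
    well, matching the start, where position 0 has been read but not recorded.\<close>
  let ?I = "\<lambda>k (\<sigma>' :: state). nums \<sigma>' ''base'' 0 = fst (scan \<epsilon> v (k - 1)) \<and> nums \<sigma>' ''prev'' 0 = v (k - 1) \<and>
    ints \<sigma>' ''c'' 0 = (group \<epsilon> v (k - 1) + r) div 3 \<and> ints \<sigma>' ''m'' 0 = (group \<epsilon> v (k - 1) + r) mod 3 \<and>
    (\<forall>l<k. ints \<sigma>' ''C'' (p l) = (group \<epsilon> v l + r) div 3 \<and> ints \<sigma>' ''R'' (p l) = (group \<epsilon> v l + r) mod 3)"
  have p0: "p 0 < 2 ^ e" by (rule p_less) simp
  have "runs scan_start 17 \<sigma> (?I 0)"
    by (rule runs_loop_free) (use ready r p0 in \<open>auto simp: scan_start_def ready_def\<close>)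
  then show ?thesis unfolding number_items_def
  proof (rule runs_SeqI[where T' = "2 ^ e * 110 + 10"])
    fix \<sigma>1 assume I: "?I 0 \<sigma>1" and f: "same_except (written_ints scan_start) (written_nums scan_start) \<sigma> \<sigma>1"
    have ready1: "ready \<sigma>1" by (rule ready_same_except[OF ready f]) (auto simp: scan_start_def)
    show "runs (For ''k'' 0 (IVar ''M'') scan_step) (2 ^ e * 110 + 10) \<sigma>1 (\<lambda>\<sigma>'. \<forall>x<2 ^ e.
      ints \<sigma>' ''C'' x = (number x + r) div 3 \<and> ints \<sigma>' ''R'' x = (number x + r) mod 3)"
    proof (rule runs_For[where hi = "2 ^ e" and T = 95 and I = ?I], goal_cases)
      case (5 k \<sigma>2)
      have "ready \<sigma>2" by (rule ready_same_except[OF ready1 5(3)]) (auto simp: scan_step_def)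
      then have eq: "nums \<sigma>2 ''eps'' 0 = ereal \<epsilon>" "ints \<sigma>2 ''p'' k = p k" "nums \<sigma>2 ''V'' (p k) = v k"
        using 5(2) p_less by (auto simp: ready_def loaded_def)
      \<comment> \<open>Injectivity of \<open>p\<close> ensures that recording position
        \<open>k\<close> overwrites no earlier record.\<close>
      have ne: "p l \<noteq> p k" if "l < k" for l
        using inj_onD[OF inj, of l k] that 5(2) by auto
      have I: "?I k \<sigma>2" by (rule 5(5))
      define b where "b = fst (scan \<epsilon> v (k - 1))"
      define u where "u = v (k - 1)"
      define g where "g = group \<epsilon> v (k - 1)"
      have scan_k: "scan \<epsilon> v k = (if ereal \<epsilon> * v k \<le> b then (b, g)
        else (v k, g + (if ereal \<epsilon> * v k \<le> u then 1 else 3)))"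
      proof (cases k)
        case 0
        \<comment> \<open>The first round meets position 0 again; it lies in its own window, so
          nothing changes.\<close>
        have "ereal \<epsilon> * v 0 \<le> 1 * v 0"
          using \<epsilon> by (intro ereal_mult_right_mono Rplus_ge_0[OF item_Rplus]) auto
        then show ?thesis by (simp add: 0 b_def g_def)
      next
        case (Suc k')
        then show ?thesis by (simp add: b_def g_def u_def)
      qed
      have step: "(g + 1 + r) div 3 = (if 2 \<le> (g + r) mod 3 then (g + r) div 3 + 1 else (g + r) div 3)"
        "(g + 1 + r) mod 3 = (if 2 \<le> (g + r) mod 3 then 0 else (g + r) mod 3 + 1)"
        "(g + 3 + r) div 3 = (g + r) div 3 + 1" "(g + 3 + r) mod 3 = (g + r) mod 3"
      proof -
        have "(g + r) mod 3 < 3" by simp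
        then show "(g + 1 + r) div 3 = (if 2 \<le> (g + r) mod 3 then (g + r) div 3 + 1 else (g + r) div 3)"
          "(g + 1 + r) mod 3 = (if 2 \<le> (g + r) mod 3 then 0 else (g + r) mod 3 + 1)"
          using div_Suc[of "g + r" 3] mod_Suc[of "g + r" 3] by auto
        have "g + 3 + r = (g + r) + 3" by simp
        then show "(g + 3 + r) div 3 = (g + r) div 3 + 1" "(g + 3 + r) mod 3 = (g + r) mod 3"
          by (simp_all only: div_add_self2 mod_add_self2)
      qed
      from I have I': "nums \<sigma>2 ''base'' 0 = b" "nums \<sigma>2 ''prev'' 0 = u"
        "ints \<sigma>2 ''c'' 0 = (g + r) div 3" "ints \<sigma>2 ''m'' 0 = (g + r) mod 3"
        "\<And>l. l < k \<Longrightarrow> ints \<sigma>2 ''C'' (p l) = (group \<epsilon> v l + r) div 3 \<and> ints \<sigma>2 ''R'' (p l) = (group \<epsilon> v l + r) mod 3"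
        by (simp_all add: b_def u_def g_def)
      have k: "ints \<sigma>2 ''k'' 0 = k" by (rule 5(4))
      consider "ereal \<epsilon> * v k \<le> b" | "\<not> ereal \<epsilon> * v k \<le> b" "ereal \<epsilon> * v k \<le> u" "2 \<le> (g + r) mod 3"
        | "\<not> ereal \<epsilon> * v k \<le> b" "ereal \<epsilon> * v k \<le> u" "\<not> 2 \<le> (g + r) mod 3"
        | "\<not> ereal \<epsilon> * v k \<le> b" "\<not> ereal \<epsilon> * v k \<le> u" by blast
      then have "nums (effect scan_step \<sigma>2) ''base'' 0 = fst (scan \<epsilon> v k) \<and>
          nums (effect scan_step \<sigma>2) ''prev'' 0 = v k \<and>
          ints (effect scan_step \<sigma>2) ''c'' 0 = (group \<epsilon> v k + r) div 3 \<and>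
          ints (effect scan_step \<sigma>2) ''m'' 0 = (group \<epsilon> v k + r) mod 3 \<and>
          ints (effect scan_step \<sigma>2) ''C'' = (ints \<sigma>2 ''C'')(p k := (group \<epsilon> v k + r) div 3) \<and>
          ints (effect scan_step \<sigma>2) ''R'' = (ints \<sigma>2 ''R'')(p k := (group \<epsilon> v k + r) mod 3)"
        by cases (simp_all add: scan_step_def eq k I'(1-4) scan_k step[simplified])
      then have "?I (Suc k) (set_int ''k'' 0 (Suc k) (effect scan_step \<sigma>2))"
        using I'(5) ne by (auto simp: less_Suc_eq)
      then show ?case by (rule runs_loop_free[rotated]) (simp_all add: scan_step_def)
    next
      case (6 \<sigma>2)
      then show ?case using p_onto number_p by metis
    qed (use I ready1 in \<open>simp_all add: ready_def scan_step_def same_except_def\<close>)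
  next
    have "(1::nat) \<le> 2 ^ e" by simp
    moreover have "2 * n + 1 \<le> 2 ^ e" by (rule big)
    ultimately show "17 + (2 ^ e * 110 + 10) \<le> 130 * (2 ^ e :: nat)" using n by linarith
  qed
qed

lemma size_ge: "3 \<le> (2::nat) ^ e"
  using big n by linarith

lemma runs_mask_items:
  assumes ready: "ready \<sigma>" and r: "r < 3"
    and C: "\<forall>x<2 ^ e. ints \<sigma> ''C'' x = (number x + r) div 3 div 2 ^ h"
    and R: "\<forall>x<2 ^ e. ints \<sigma> ''R'' x = (number x + r) mod 3"
  shows "runs mask_items (2 ^ e * 75 + 10) \<sigma> (\<lambda>\<sigma>'. \<forall>x<2 ^ e. nums \<sigma>' ''U'' x = masked r h 0 x \<and>
    nums \<sigma>' ''W'' x = masked r h 1 x \<and> ints \<sigma>' ''C'' x = (number x + r) div 3 div 2 ^ Suc h)"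
proof -
  \<comment> \<open>Cells below \<open>k\<close> are already at the next level, the others still at
    the current one.\<close>
  let ?I = "\<lambda>k (\<sigma>' :: state). (\<forall>x<k. nums \<sigma>' ''U'' x = masked r h 0 x \<and>
    nums \<sigma>' ''W'' x = masked r h 1 x \<and> ints \<sigma>' ''C'' x = (number x + r) div 3 div 2 ^ Suc h) \<and>
    (\<forall>x. k \<le> x \<and> x < 2 ^ e \<longrightarrow> ints \<sigma>' ''C'' x = (number x + r) div 3 div 2 ^ h)"
  show ?thesis unfolding mask_items_def
  proof (rule runs_For[where hi = "2 ^ e" and T = 60 and I = ?I], goal_cases)
    case (5 k \<sigma>')
    let ?body = "Seq (NSet ''U'' (IVar ''x'') NInf)
      (Seq (NSet ''W'' (IVar ''x'') NInf)
      (Seq (Cond (ILe (INum 1) (IGet ''R'' (IVar ''x'')))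
             (Cond (ILe (INum 1) (IGet ''par'' (IGet ''C'' (IVar ''x''))))
               (NSet ''W'' (IVar ''x'') (NMul (NGet ''V'' (IVar ''x'')) (NAdd NOne (NVar ''eps''))))
               (NSet ''U'' (IVar ''x'') (NMul (NGet ''V'' (IVar ''x'')) (NAdd NOne (NVar ''eps'')))))
             Skip)
           (ISet ''C'' (IVar ''x'') (IGet ''half'' (IGet ''C'' (IVar ''x''))))))"
    have "ready \<sigma>'" by (rule ready_same_except[OF ready 5(3)]) auto
    define c where "c = (number k + r) div 3 div 2 ^ h"
    \<comment> \<open>Keeps the lookups of half and parity within the filled tables.\<close>
    have "c \<le> (number k + r) div 3" unfolding c_def by (rule div_le_dividend)
    then have "c < 2 ^ e" using number_bound[OF 5(2) r] by (rule le_less_trans)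
    then have eq: "nums \<sigma>' ''eps'' 0 = ereal \<epsilon>" "nums \<sigma>' ''V'' k = item k"
        "ints \<sigma>' ''half'' c = c div 2" "ints \<sigma>' ''par'' c = c mod 2"
      using \<open>ready \<sigma>'\<close> 5(2) by (auto simp: ready_def loaded_def)
    have Rk: "ints \<sigma>' ''R'' k = (number k + r) mod 3"
      using R 5(2) same_except_ints[OF 5(3), of "''R''"] by simp
    have x: "ints \<sigma>' ''x'' 0 = k" by (rule 5(4))
    have Ck: "ints \<sigma>' ''C'' k = c" using 5(2,5) by (simp add: c_def)
    have half: "c div 2 = (number k + r) div 3 div 2 ^ Suc h"
      by (simp add: c_def div_mult2_eq[symmetric] mult.commute)
    have act: "active r h d k \<longleftrightarrow> (number k + r) mod 3 \<noteq> 0 \<and> c mod 2 = d" for d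
      by (simp add: active_def c_def)
    consider "(number k + r) mod 3 = 0" | "(number k + r) mod 3 \<noteq> 0" "c mod 2 = 0"
      | "(number k + r) mod 3 \<noteq> 0" "c mod 2 = 1" by linarith
    then have "nums (effect ?body \<sigma>') ''U'' = (nums \<sigma>' ''U'')(k := masked r h 0 k) \<and>
        nums (effect ?body \<sigma>') ''W'' = (nums \<sigma>' ''W'')(k := masked r h 1 k) \<and>
        ints (effect ?body \<sigma>') ''C'' = (ints \<sigma>' ''C'')(k := c div 2)"
      by cases (simp_all add: eq Rk x Ck masked_def act one_ereal_def)
    then have "?I (Suc k) (set_int ''x'' 0 (Suc k) (effect ?body \<sigma>'))"
      using 5(5) half by (auto simp: less_Suc_eq)
    then show ?case by (rule runs_loop_free[rotated]) simp_all
  next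
    case (2 \<sigma>')
    then have "ints \<sigma>' ''M'' = ints \<sigma> ''M''" by (simp add: same_except_def)
    then show ?case using ready by (simp add: ready_def)
  qed (use C in simp_all)
qed

abbreviation split_state :: "nat \<Rightarrow> nat \<Rightarrow> state \<Rightarrow> bool" where
  "split_state r h \<sigma> \<equiv> ready \<sigma> \<and> emitted \<sigma> \<and>
     (\<forall>x<2 ^ e. ints \<sigma> ''C'' x = (number x + r) div 3 div 2 ^ h) \<and>
     (\<forall>x<2 ^ e. ints \<sigma> ''R'' x = (number x + r) mod 3)"

lemma runs_split_level:
  assumes st: "split_state r h \<sigma>" and P: "ints \<sigma> ''P'' 0 = 2 ^ h" and r: "r < 3"
  shows "runs split_level (2 ^ e * 180) \<sigma> (\<lambda>\<sigma>'. split_state r (Suc h) \<sigma>' \<and> ints \<sigma>' ''P'' 0 = 2 ^ Suc h \<and>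
    ints \<sigma>' ''s'' 0 = ints \<sigma> ''s'' 0 + 2 \<and>
    (\<forall>i\<in>{1..n}. \<forall>j\<in>{1..n}. covered \<sigma> i j \<or> split_at r h i j \<longrightarrow> covered \<sigma>' i j))"
proof -
  let ?M = "\<lambda>\<sigma>' :: state. \<forall>x<2 ^ e. nums \<sigma>' ''U'' x = masked r h 0 x \<and>
    nums \<sigma>' ''W'' x = masked r h 1 x \<and> ints \<sigma>' ''C'' x = (number x + r) div 3 div 2 ^ Suc h"
  let ?c = "\<lambda>d d' i j. covers \<epsilon> (A i) (B j) (masked r h d i) (masked r h d' (n + j))"
  let ?Q = "\<lambda>\<sigma>'. split_state r (Suc h) \<sigma>' \<and> ints \<sigma>' ''P'' 0 = 2 ^ Suc h \<and>
    ints \<sigma>' ''s'' 0 = ints \<sigma> ''s'' 0 + 2 \<and>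
    (\<forall>i\<in>{1..n}. \<forall>j\<in>{1..n}. covered \<sigma> i j \<or> split_at r h i j \<longrightarrow> covered \<sigma>' i j)"
  let ?e1 = "emit (NGet ''U'' (IVar ''i'')) (NGet ''W'' (IAdd (IVar ''n'') (IVar ''i'')))"
  let ?e2 = "emit (NGet ''W'' (IVar ''i'')) (NGet ''U'' (IAdd (IVar ''n'') (IVar ''i'')))"
  let ?P = "ISet ''P'' (INum 0) (IAdd (IVar ''P'') (IVar ''P''))"
  \<comment> \<open>One statement for both emissions, with bits (0, 1) or (1, 0). The expressions
    cost 3 and 6, giving 69 per entry.\<close>
  have emit: "runs (emit (NGet X (IVar ''i'')) (NGet Y (IAdd (IVar ''n'') (IVar ''i'')))) (n * 69) \<sigma>1
      (\<lambda>\<sigma>'. emitted \<sigma>' \<and> ints \<sigma>' ''s'' 0 = Suc (ints \<sigma>1 ''s'' 0) \<and>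
        (\<forall>i\<in>{1..n}. \<forall>j\<in>{1..n}. covered \<sigma>1 i j \<or> ?c d d' i j \<longrightarrow> covered \<sigma>' i j))"
    if "?M \<sigma>1" "emitted \<sigma>1" "ready \<sigma>1"
      "X = ''U'' \<and> d = 0 \<and> Y = ''W'' \<and> d' = 1 \<or> X = ''W'' \<and> d = 1 \<and> Y = ''U'' \<and> d' = 0" for \<sigma>1 X Y d d'
  proof (rule runs_emit)
    show "valid_pair n A B (masked r h d) (\<lambda>j. masked r h d' (n + j))"
      using that(4) by (intro valid_masked) auto
    show n1: "ints \<sigma>1 ''n'' 0 = n" using that(3) by (simp add: ready_def loaded_def)
    fix \<sigma>' i assume i: "i \<in> {1..n}" "ints \<sigma>' ''i'' 0 = i"
      and f: "same_except {''i''} {''A_out'', ''B_out''} \<sigma>1 \<sigma>'"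
    have eq: "nums \<sigma>' ''U'' = nums \<sigma>1 ''U''" "nums \<sigma>' ''W'' = nums \<sigma>1 ''W''" "ints \<sigma>' ''n'' = ints \<sigma>1 ''n''"
      using f by (simp_all add: same_except_def)
    have "i < 2 ^ e" "n + i < 2 ^ e" using i big by auto
    then show "nval \<sigma>' (NGet X (IVar ''i'')) = masked r h d i \<and>
        nval \<sigma>' (NGet Y (IAdd (IVar ''n'') (IVar ''i''))) = masked r h d' (n + i)"
      using that(1,4) i eq n1 by auto
  qed (use that in simp_all)
  have "runs mask_items (2 ^ e * 75 + 10) \<sigma> ?M"
    by (rule runs_mask_items) (use st r in auto)
  then show ?thesis unfolding split_level_def
  proof (rule runs_SeqI[where T' = "n * 69 + (n * 69 + 7)"])
    fix \<sigma>1 assume M1: "?M \<sigma>1" and f1: "same_except (written_ints mask_items) (written_nums mask_items) \<sigma> \<sigma>1"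
    have ready1: "ready \<sigma>1" by (rule ready_same_except[OF _ f1]) (use st in auto)
    have o1: "emitted \<sigma>1 = emitted \<sigma>" "covered \<sigma>1 = covered \<sigma>" "ints \<sigma>1 ''s'' = ints \<sigma> ''s''"
      by (rule outputs_same_except[OF f1]; simp)+
    have k1: "ints \<sigma>1 ''P'' = ints \<sigma> ''P''" "ints \<sigma>1 ''R'' = ints \<sigma> ''R''"
      using f1 by (simp_all add: same_except_def)
    have "runs ?e1 (n * 69) \<sigma>1 (\<lambda>\<sigma>'. emitted \<sigma>' \<and> ints \<sigma>' ''s'' 0 = Suc (ints \<sigma>1 ''s'' 0) \<and>
        (\<forall>i\<in>{1..n}. \<forall>j\<in>{1..n}. covered \<sigma>1 i j \<or> ?c 0 1 i j \<longrightarrow> covered \<sigma>' i j))"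
      by (rule emit) (use M1 ready1 o1 st in auto)
    then show "runs (Seq ?e1 (Seq ?e2 ?P)) (n * 69 + (n * 69 + 7)) \<sigma>1 ?Q"
    proof (rule runs_SeqI[where T' = "n * 69 + 7"])
      fix \<sigma>2 assume 2: "emitted \<sigma>2 \<and> ints \<sigma>2 ''s'' 0 = Suc (ints \<sigma>1 ''s'' 0) \<and>
          (\<forall>i\<in>{1..n}. \<forall>j\<in>{1..n}. covered \<sigma>1 i j \<or> ?c 0 1 i j \<longrightarrow> covered \<sigma>2 i j)"
        and f2: "same_except (written_ints ?e1) (written_nums ?e1) \<sigma>1 \<sigma>2"
      have ready2: "ready \<sigma>2" by (rule ready_same_except[OF ready1 f2]) auto
      have k2: "ints \<sigma>2 ''P'' = ints \<sigma>1 ''P''" "ints \<sigma>2 ''R'' = ints \<sigma>1 ''R''" "ints \<sigma>2 ''C'' = ints \<sigma>1 ''C''"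
        "nums \<sigma>2 ''U'' = nums \<sigma>1 ''U''" "nums \<sigma>2 ''W'' = nums \<sigma>1 ''W''"
        using f2 by (simp_all add: same_except_def)
      have "runs ?e2 (n * 69) \<sigma>2 (\<lambda>\<sigma>'. emitted \<sigma>' \<and> ints \<sigma>' ''s'' 0 = Suc (ints \<sigma>2 ''s'' 0) \<and>
          (\<forall>i\<in>{1..n}. \<forall>j\<in>{1..n}. covered \<sigma>2 i j \<or> ?c 1 0 i j \<longrightarrow> covered \<sigma>' i j))"
        by (rule emit) (use M1 ready2 k2 2 in auto)
      then show "runs (Seq ?e2 ?P) (n * 69 + 7) \<sigma>2 ?Q"
      proof (rule runs_SeqI[where T' = 7])
        fix \<sigma>3 assume 3: "emitted \<sigma>3 \<and> ints \<sigma>3 ''s'' 0 = Suc (ints \<sigma>2 ''s'' 0) \<and>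
            (\<forall>i\<in>{1..n}. \<forall>j\<in>{1..n}. covered \<sigma>2 i j \<or> ?c 1 0 i j \<longrightarrow> covered \<sigma>3 i j)"
          and f3: "same_except (written_ints ?e2) (written_nums ?e2) \<sigma>2 \<sigma>3"
        have ready3: "ready \<sigma>3" by (rule ready_same_except[OF ready2 f3]) auto
        have k3: "ints \<sigma>3 ''P'' = ints \<sigma>2 ''P''" "ints \<sigma>3 ''R'' = ints \<sigma>2 ''R''" "ints \<sigma>3 ''C'' = ints \<sigma>2 ''C''"
          using f3 by (simp_all add: same_except_def)
        have f4: "same_except {''P''} {} \<sigma>3 (effect ?P \<sigma>3)" by (simp add: same_except_def)
        have "ready (effect ?P \<sigma>3)" by (rule ready_same_except[OF ready3 f4]) auto
        moreover have o4: "emitted (effect ?P \<sigma>3) = emitted \<sigma>3" "covered (effect ?P \<sigma>3) = covered \<sigma>3"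
            "ints (effect ?P \<sigma>3) ''s'' = ints \<sigma>3 ''s''"
          by (rule outputs_same_except[OF f4]; simp)+
        moreover have "ints (effect ?P \<sigma>3) ''P'' 0 = 2 ^ Suc h"
          "ints (effect ?P \<sigma>3) ''C'' = ints \<sigma>1 ''C''" "ints (effect ?P \<sigma>3) ''R'' = ints \<sigma> ''R''"
          using P k1 k2 k3 by simp_all
        moreover have "covered \<sigma>3 i j" if ij: "i \<in> {1..n}" "j \<in> {1..n}" and "covered \<sigma> i j \<or> split_at r h i j" for i j
        proof -
          have "?c 0 1 i j \<or> ?c 1 0 i j" if "split_at r h i j"
            using that masked_covers[OF ij] unfolding split_at_def by blast
          then show ?thesis using that o1(2) 2 3 by auto
        qed
        ultimately have "?Q (effect ?P \<sigma>3)" using st M1 o1 2 3 by simp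
        then show "runs ?P 7 \<sigma>3 ?Q" by (rule runs_loop_free[where Q = ?Q, rotated]) simp_all
      qed simp
    qed simp
  next
    show "2 ^ e * 75 + 10 + (n * 69 + (n * 69 + 7)) \<le> (2::nat) ^ e * 180" using big size_ge by linarith
  qed
qed

lemma runs_split_round:
  assumes ready: "ready \<sigma>" and em: "emitted \<sigma>" and r: "ints \<sigma> ''r'' 0 = r" "r < 3"
  shows "runs split_round (2 ^ e * (200 * e + 150)) \<sigma> (\<lambda>\<sigma>'. ready \<sigma>' \<and> emitted \<sigma>' \<and>
    ints \<sigma>' ''s'' 0 = ints \<sigma> ''s'' 0 + 2 * e \<and>
    (\<forall>i\<in>{1..n}. \<forall>j\<in>{1..n}. covered \<sigma> i j \<or> (\<exists>h<e. split_at r h i j) \<longrightarrow> covered \<sigma>' i j))"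
proof -
  let ?J = "\<lambda>h \<sigma>'. split_state r h \<sigma>' \<and> ints \<sigma>' ''P'' 0 = 2 ^ h \<and>
    ints \<sigma>' ''s'' 0 = ints \<sigma> ''s'' 0 + 2 * h \<and>
    (\<forall>i\<in>{1..n}. \<forall>j\<in>{1..n}. covered \<sigma> i j \<or> (\<exists>h'<h. split_at r h' i j) \<longrightarrow> covered \<sigma>' i j)"
  let ?Q = "\<lambda>\<sigma>'. ready \<sigma>' \<and> emitted \<sigma>' \<and> ints \<sigma>' ''s'' 0 = ints \<sigma> ''s'' 0 + 2 * e \<and>
    (\<forall>i\<in>{1..n}. \<forall>j\<in>{1..n}. covered \<sigma> i j \<or> (\<exists>h<e. split_at r h i j) \<longrightarrow> covered \<sigma>' i j)"
  let ?w = "While (ILess (IVar ''P'') (IVar ''M'')) split_level"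
  let ?P = "ISet ''P'' (INum 0) (INum 1)"
  have loop: "runs ?w (2 ^ e * (200 * e) + 7) \<sigma>1 ?Q" if J: "?J 0 \<sigma>1" for \<sigma>1
  proof (rule runs_While[where I = ?J and N = e and T = "2 ^ e * 180"])
    fix h \<sigma>2 assume h: "h < e" and J: "?J h \<sigma>2"
    have "runs split_level (2 ^ e * 180) \<sigma>2 (\<lambda>\<sigma>'. split_state r (Suc h) \<sigma>' \<and> ints \<sigma>' ''P'' 0 = 2 ^ Suc h \<and>
      ints \<sigma>' ''s'' 0 = ints \<sigma>2 ''s'' 0 + 2 \<and>
      (\<forall>i\<in>{1..n}. \<forall>j\<in>{1..n}. covered \<sigma>2 i j \<or> split_at r h i j \<longrightarrow> covered \<sigma>' i j))"
      by (rule runs_split_level) (use J r in auto)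
    then have "runs split_level (2 ^ e * 180) \<sigma>2 (?J (Suc h))"
      by (rule runs_mono) (use J in \<open>auto simp del: atLeastAtMost_iff simp: Ex_less_Suc\<close>)
    moreover have "bval \<sigma>2 (ILess (IVar ''P'') (IVar ''M''))" using J h by (simp add: ready_def)
    ultimately show "bval \<sigma>2 (ILess (IVar ''P'') (IVar ''M'')) \<and> runs split_level (2 ^ e * 180) \<sigma>2 (?J (Suc h))"
      by blast
  next
    fix \<sigma>2 assume "?J e \<sigma>2"
    then show "\<not> bval \<sigma>2 (ILess (IVar ''P'') (IVar ''M''))" by (simp add: ready_def)
  next
    have "2 ^ e * 180 + 7 \<le> (2::nat) ^ e * 200" using size_ge by linarith
    from mult_le_mono2[OF this, of e]
    have "e * (2 ^ e * 180 + 7) \<le> 2 ^ e * (200 * e)" by (simp only: mult_ac)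
    then show "e * (2 ^ e * 180 + bcost (ILess (IVar ''P'') (IVar ''M'')) + 1) +
      bcost (ILess (IVar ''P'') (IVar ''M'')) + 1 \<le> 2 ^ e * (200 * e) + 7"
      by simp
  next
    fix \<sigma>2 assume "?J e \<sigma>2"
    then show "?Q \<sigma>2" by blast
  qed (rule J)
  show ?thesis unfolding split_round_def
    using runs_number_items[OF ready r]
  proof (rule runs_SeqI[where T' = "3 + (2 ^ e * (200 * e) + 7)"])
    fix \<sigma>1 assume CR: "\<forall>x<2 ^ e. ints \<sigma>1 ''C'' x = (number x + r) div 3 \<and> ints \<sigma>1 ''R'' x = (number x + r) mod 3"
      and f1: "same_except (written_ints number_items) (written_nums number_items) \<sigma> \<sigma>1"
    have f2: "same_except {''P''} {} \<sigma>1 (effect ?P \<sigma>1)" by (simp add: same_except_def)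
    have "ready \<sigma>1" by (rule ready_same_except[OF ready f1]) auto
    then have "ready (effect ?P \<sigma>1)" by (rule ready_same_except[OF _ f2]) auto
    moreover have "emitted \<sigma>1 = emitted \<sigma>" "covered \<sigma>1 = covered \<sigma>" "ints \<sigma>1 ''s'' = ints \<sigma> ''s''"
      by (rule outputs_same_except[OF f1]; simp)+
    moreover have "emitted (effect ?P \<sigma>1) = emitted \<sigma>1" "covered (effect ?P \<sigma>1) = covered \<sigma>1"
        "ints (effect ?P \<sigma>1) ''s'' = ints \<sigma>1 ''s''"
      by (rule outputs_same_except[OF f2]; simp)+
    ultimately have "?J 0 (effect ?P \<sigma>1)" using CR em by simp
    then have "runs ?P 3 \<sigma>1 (?J 0)" by (rule runs_loop_free[where Q = "?J 0", rotated]) simp_all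
    then show "runs (Seq ?P ?w) (3 + (2 ^ e * (200 * e) + 7)) \<sigma>1 ?Q"
      by (rule runs_SeqI[OF _ loop]) simp_all
  next
    have "130 * 2 ^ e + 10 \<le> (2::nat) ^ e * 150" using size_ge by linarith
    then show "130 * 2 ^ e + (3 + (2 ^ e * (200 * e) + 7)) \<le> 2 ^ e * (200 * e + 150)"
      by (simp add: distrib_left)
  qed
qed

lemma runs_distant_phase:
  assumes ready: "ready \<sigma>" and em: "emitted \<sigma>"
  shows "runs distant_phase (2 ^ e * (600 * e + 500)) \<sigma> (\<lambda>\<sigma>'. emitted \<sigma>' \<and>
    ints \<sigma>' ''s'' 0 = ints \<sigma> ''s'' 0 + 6 * e \<and>
    (\<forall>i\<in>{1..n}. \<forall>j\<in>{1..n}. covered \<sigma> i j \<or> (\<exists>r<3. \<exists>h<e. split_at r h i j) \<longrightarrow> covered \<sigma>' i j))"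
proof -
  let ?I = "\<lambda>r \<sigma>'. ready \<sigma>' \<and> emitted \<sigma>' \<and> ints \<sigma>' ''s'' 0 = ints \<sigma> ''s'' 0 + 2 * e * r \<and>
    (\<forall>i\<in>{1..n}. \<forall>j\<in>{1..n}. covered \<sigma> i j \<or> (\<exists>r'<r. \<exists>h<e. split_at r' h i j) \<longrightarrow> covered \<sigma>' i j)"
  \<comment> \<open>The invariant does not read the counter cell.\<close>
  have keep: "?I r \<sigma>'' = ?I r \<sigma>'" if "same_except {''r''} {} \<sigma>' \<sigma>''" "ready \<sigma>'" for r \<sigma>' \<sigma>''
  proof -
    have "ready \<sigma>''" by (rule ready_same_except[OF that(2,1)]) auto
    moreover have "emitted \<sigma>'' = emitted \<sigma>'" "covered \<sigma>'' = covered \<sigma>'" "ints \<sigma>'' ''s'' = ints \<sigma>' ''s''"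
      by (rule outputs_same_except[OF that(1)]; simp)+
    ultimately show ?thesis using that(2) by simp
  qed
  show ?thesis unfolding distant_phase_def
  proof (rule runs_For[where hi = 3 and T = "2 ^ e * (200 * e + 150)" and I = ?I], goal_cases)
    case 4
    have "?I 0 \<sigma>" using ready em by simp
    then show ?case by (subst keep[of \<sigma>]) (simp_all add: same_except_def ready)
  next
    case (5 r \<sigma>')
    then have "runs split_round (2 ^ e * (200 * e + 150)) \<sigma>' (\<lambda>\<sigma>''. ready \<sigma>'' \<and> emitted \<sigma>'' \<and>
      ints \<sigma>'' ''s'' 0 = ints \<sigma>' ''s'' 0 + 2 * e \<and>
      (\<forall>i\<in>{1..n}. \<forall>j\<in>{1..n}. covered \<sigma>' i j \<or> (\<exists>h<e. split_at r h i j) \<longrightarrow> covered \<sigma>'' i j))"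
      by (intro runs_split_round) auto
    then show ?case
    proof (rule runs_mono)
      fix \<sigma>2 assume 2: "ready \<sigma>2 \<and> emitted \<sigma>2 \<and> ints \<sigma>2 ''s'' 0 = ints \<sigma>' ''s'' 0 + 2 * e \<and>
        (\<forall>i\<in>{1..n}. \<forall>j\<in>{1..n}. covered \<sigma>' i j \<or> (\<exists>h<e. split_at r h i j) \<longrightarrow> covered \<sigma>2 i j)"
      have "?I (Suc r) \<sigma>2" using 2 5(5) by (auto simp del: atLeastAtMost_iff simp: Ex_less_Suc)
      then show "?I (Suc r) (set_int ''r'' 0 (Suc r) \<sigma>2)"
        by (subst keep[of \<sigma>2]) (use 2 in \<open>simp_all add: same_except_def\<close>)
    qed simp
  next
    case (6 \<sigma>')
    then show ?case by simp
  next
    case 7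
    have "3 * 12 + 9 \<le> 50 * (2::nat) ^ e" using size_ge by linarith
    then show ?case by (simp add: distrib_left)
  qed simp_all
qed

end

section \<open>Assembly and final bounds\<close>

definition covering_program :: com where
  "covering_program = Seq choose_size (Seq fill_tables (Seq load_values (Seq merge_sort
     (Seq close_phase distant_phase))))"

lemma (in covering_input) runs_covering_program:
  "runs covering_program (n * (10000 * (thetas \<epsilon> + levels n + 1))) (input_state n A B \<epsilon>)
    (\<lambda>\<sigma>. output_size \<sigma> = 2 * thetas \<epsilon> + 6 * levels n \<and>
      sum_to_max_covering n A B \<epsilon> (output_size \<sigma>) (output_vectors ''A_out'' n \<sigma>) (output_vectors ''B_out'' n \<sigma>))"
proof -
  let ?e = "levels n"
  let ?\<sigma> = "input_state n A B \<epsilon>"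
  let ?Q = "\<lambda>\<sigma>. output_size \<sigma> = 2 * thetas \<epsilon> + 6 * levels n \<and>
      sum_to_max_covering n A B \<epsilon> (output_size \<sigma>) (output_vectors ''A_out'' n \<sigma>) (output_vectors ''B_out'' n \<sigma>)"
  let ?T5 = "2 ^ ?e * (600 * ?e + 500)"
  let ?T4 = "thetas \<epsilon> * (300 * n) + 30 + ?T5"
  let ?T3 = "?e * (270 * 2 ^ ?e) + 15 + ?T4"
  let ?T2 = "n * 40 + 20 + ?T3"
  let ?T1 = "2 ^ ?e * 50 + 10 + ?T2"
  have load: "loaded ?\<sigma>" and em: "emitted ?\<sigma>" and s: "ints ?\<sigma> ''s'' 0 = 0"
    and hp: "ints ?\<sigma> ''half'' 0 = 0" "ints ?\<sigma> ''par'' 0 = 0"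
    by (simp_all add: input_state_def loaded_def emitted_def)
  have "runs choose_size (?e * 20 + 20) ?\<sigma> (\<lambda>\<sigma>'. ints \<sigma>' ''M'' 0 = 2 ^ ?e)"
    using load by (intro runs_choose_size) (simp add: loaded_def)
  then show ?thesis unfolding covering_program_def
  proof (rule runs_SeqI[where T' = ?T1])
    fix \<sigma>1 assume M1: "ints \<sigma>1 ''M'' 0 = 2 ^ ?e"
      and f1: "same_except (written_ints choose_size) (written_nums choose_size) ?\<sigma> \<sigma>1"
    have load1: "loaded \<sigma>1" by (rule loaded_same_except[OF load f1]) auto
    have o1: "emitted \<sigma>1 = emitted ?\<sigma>" "ints \<sigma>1 ''s'' = ints ?\<sigma> ''s''"
      by (rule outputs_same_except[OF f1]; simp)+
    have hp1: "ints \<sigma>1 ''half'' 0 = 0" "ints \<sigma>1 ''par'' 0 = 0" using f1 hp by (simp_all add: same_except_def)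
    from runs_fill_tables[OF M1 hp1]
    show "runs (Seq fill_tables (Seq load_values (Seq merge_sort (Seq close_phase distant_phase)))) ?T1 \<sigma>1 ?Q"
    proof (rule runs_SeqI[where T' = ?T2])
      fix \<sigma>2 assume t2: "\<forall>x<2 ^ ?e. nums \<sigma>2 ''V'' x = \<infinity> \<and> ints \<sigma>2 ''p'' x = x \<and>
          ints \<sigma>2 ''half'' x = x div 2 \<and> ints \<sigma>2 ''par'' x = x mod 2"
        and f2: "same_except (written_ints fill_tables) (written_nums fill_tables) \<sigma>1 \<sigma>2"
      have load2: "loaded \<sigma>2" by (rule loaded_same_except[OF load1 f2]) auto
      have o2: "emitted \<sigma>2 = emitted \<sigma>1" "ints \<sigma>2 ''s'' = ints \<sigma>1 ''s''"
        by (rule outputs_same_except[OF f2]; simp)+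
      have M2: "ints \<sigma>2 ''M'' 0 = 2 ^ ?e" using f2 M1 by (simp add: same_except_def)
      have "runs load_values (n * 40 + 20) \<sigma>2 (\<lambda>\<sigma>'. \<forall>x<2 ^ ?e. nums \<sigma>' ''V'' x = item x)"
        by (rule runs_load_values[OF load2]) (use t2 in simp)
      then show "runs (Seq load_values (Seq merge_sort (Seq close_phase distant_phase))) ?T2 \<sigma>2 ?Q"
      proof (rule runs_SeqI[where T' = ?T3])
        fix \<sigma>3 assume V3: "\<forall>x<2 ^ ?e. nums \<sigma>3 ''V'' x = item x"
          and f3: "same_except (written_ints load_values) (written_nums load_values) \<sigma>2 \<sigma>3"
        have load3: "loaded \<sigma>3" by (rule loaded_same_except[OF load2 f3]) auto
        have o3: "emitted \<sigma>3 = emitted \<sigma>2" "ints \<sigma>3 ''s'' = ints \<sigma>2 ''s''"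
          by (rule outputs_same_except[OF f3]; simp)+
        have k3: "ints \<sigma>3 ''M'' = ints \<sigma>2 ''M''" "ints \<sigma>3 ''half'' = ints \<sigma>2 ''half''"
          "ints \<sigma>3 ''par'' = ints \<sigma>2 ''par''" "ints \<sigma>3 ''p'' = ints \<sigma>2 ''p''"
          using f3 by (simp_all add: same_except_def)
        have p3: "ints \<sigma>3 ''p'' ` {..<2 ^ ?e} = {..<2 ^ ?e}" using t2 k3 by force
        have "ints \<sigma>3 ''M'' 0 = 2 ^ ?e" using M2 k3 by simp
        from runs_merge_sort[OF this]
        show "runs (Seq merge_sort (Seq close_phase distant_phase)) ?T3 \<sigma>3 ?Q"
        proof (rule runs_SeqI[where T' = ?T4])
          fix \<sigma>4 assume s4: "ints \<sigma>4 ''p'' ` {..<2 ^ ?e} = ints \<sigma>3 ''p'' ` {..<2 ^ ?e} \<and>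
              sorted_between (nums \<sigma>3 ''V'') (ints \<sigma>4 ''p'') 0 (2 ^ ?e)"
            and f4: "same_except (written_ints merge_sort) (written_nums merge_sort) \<sigma>3 \<sigma>4"
          have load4: "loaded \<sigma>4" by (rule loaded_same_except[OF load3 f4]) auto
          have o4: "emitted \<sigma>4 = emitted \<sigma>3" "ints \<sigma>4 ''s'' = ints \<sigma>3 ''s''"
            by (rule outputs_same_except[OF f4]; simp)+
          have k4: "ints \<sigma>4 ''M'' = ints \<sigma>3 ''M''" "ints \<sigma>4 ''half'' = ints \<sigma>3 ''half''"
            "ints \<sigma>4 ''par'' = ints \<sigma>3 ''par''" "nums \<sigma>4 ''V'' = nums \<sigma>3 ''V''"
            using f4 by (simp_all add: same_except_def)
          define q where "q = ints \<sigma>4 ''p''"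
          have q: "q ` {..<2 ^ ?e} = {..<2 ^ ?e}" using s4 p3 by (simp add: q_def)
          have "sorted_between item q 0 (2 ^ ?e)"
            unfolding sorted_between_def
          proof (intro allI impI)
            fix x y :: nat assume xy: "0 \<le> x \<and> x \<le> y \<and> y < 2 ^ ?e"
            \<comment> \<open>The stored values are known to equal \<open>item\<close> only below
              the array size, so the sorted indices must be located there.\<close>
            have "q x \<in> q ` {..<2 ^ ?e}" "q y \<in> q ` {..<2 ^ ?e}" using xy by auto
            then have "q x \<in> {..<2 ^ ?e}" "q y \<in> {..<2 ^ ?e}" unfolding q .
            moreover have "nums \<sigma>3 ''V'' (q x) \<le> nums \<sigma>3 ''V'' (q y)"
              using s4 xy by (simp add: sorted_between_def q_def)
            ultimately show "item (q x) \<le> item (q y)" using V3 by simp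
          qed
          then interpret grouped_input n A B \<epsilon> ?e q
            using levels_ge[of n] q by unfold_locales auto
          have ready4: "ready \<sigma>4"
            using load4 M2 k3 k4 V3 t2 unfolding ready_def by (simp add: q_def)
          have "emitted \<sigma>4" "ints \<sigma>4 ''s'' 0 = 0" using o1 o2 o3 o4 em s by simp_all
          from runs_close_phase[OF load4 this]
          show "runs (Seq close_phase distant_phase) ?T4 \<sigma>4 ?Q"
          proof (rule runs_SeqI[where T' = ?T5])
            fix \<sigma>5 assume c5: "emitted \<sigma>5 \<and> ints \<sigma>5 ''s'' 0 = 2 * thetas \<epsilon> \<and>
               (\<forall>i\<in>{1..n}. \<forall>j\<in>{1..n}. ereal \<epsilon> * (ereal \<epsilon> * (ereal \<epsilon> * A i)) \<le> B j \<and>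
                  ereal \<epsilon> * (ereal \<epsilon> * (ereal \<epsilon> * B j)) \<le> A i \<longrightarrow> covered \<sigma>5 i j)"
              and f5: "same_except (written_ints close_phase) (written_nums close_phase) \<sigma>4 \<sigma>5"
            have ready5: "ready \<sigma>5" by (rule ready_same_except[OF ready4 f5]) auto
            have "emitted \<sigma>5" using c5 by blast
            from runs_distant_phase[OF ready5 this] show "runs distant_phase ?T5 \<sigma>5 ?Q"
            proof (rule runs_mono)
              fix \<sigma>6 assume c6: "emitted \<sigma>6 \<and> ints \<sigma>6 ''s'' 0 = ints \<sigma>5 ''s'' 0 + 6 * ?e \<and>
                (\<forall>i\<in>{1..n}. \<forall>j\<in>{1..n}. covered \<sigma>5 i j \<or> (\<exists>r<3. \<exists>h<?e. split_at r h i j) \<longrightarrow> covered \<sigma>6 i j)"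
              \<comment> \<open>Close pairs were covered by the first phase and stay covered; every
                other pair is split for some shift and bit.\<close>
              have "covered \<sigma>6 i j" if ij: "i \<in> {1..n}" "j \<in> {1..n}" for i j
                using close_or_split[OF ij] c5 c6 ij by metis
              moreover have "output_size \<sigma>6 = 2 * thetas \<epsilon> + 6 * ?e" using c5 c6 by (simp add: output_size_def)
              ultimately show "?Q \<sigma>6"
                using c6 unfolding sum_to_max_covering_def emitted_def covered_def covers_def valid_pair_def output_size_def
                by blast
            qed simp
          qed simp
        qed simp
      qed simp
    qed simp
  next
    have M: "2 ^ ?e \<le> 4 * n" by (rule levels_le[OF n])
    \<comment> \<open>Padding costs at most a factor 4, so sorting and separation take time linear
      in \<open>n * ?e\<close> and \<open>n\<close>.\<close>
    have "?e * 2 ^ ?e \<le> ?e * (4 * n)" by (rule mult_le_mono2[OF M])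
    then have 1: "?e * 2 ^ ?e \<le> 4 * (n * ?e)" by (simp only: mult_ac)
    have 2: "?e \<le> n * ?e" using n by simp
    have T5: "?T5 = 600 * (?e * 2 ^ ?e) + 500 * 2 ^ ?e" by (simp add: algebra_simps)
    have T3: "?e * (270 * 2 ^ ?e) = 270 * (?e * 2 ^ ?e)" "thetas \<epsilon> * (300 * n) = 300 * (n * thetas \<epsilon>)"
      by (simp_all only: mult_ac)
    have "?e * 20 + 20 + ?T1 \<le> 10000 * (n * ?e) + 10000 * (n * thetas \<epsilon>) + 10000 * n"
      unfolding T5 T3 using 1 2 M n by linarith
    also have "\<dots> = n * (10000 * (thetas \<epsilon> + ?e + 1))" by (simp add: algebra_simps)
    finally show "?e * 20 + 20 + ?T1 \<le> n * (10000 * (thetas \<epsilon> + ?e + 1))" .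
  qed
qed

theorem mainTheorem5:
  "(\<exists>C::real. \<forall>(n::nat) (A::nat \<Rightarrow> ereal) (B::nat \<Rightarrow> ereal) (\<epsilon>::real).
      n \<ge> 1 \<and> 0 < \<epsilon> \<and> \<epsilon> < 1/10 \<and> A \<in> {1..n} \<rightarrow> Rplus \<and> B \<in> {1..n} \<rightarrow> Rplus \<longrightarrow>
      (\<exists>(s::nat) A' B'.
         real s \<le> C * (1/\<epsilon> * log 2 (1/\<epsilon>) + log 2 (real n) * log 2 (1/\<epsilon>)) \<and>
         sum_to_max_covering n A B \<epsilon> s A' B')) \<and>
   (\<exists>(P::com) (C::real). \<forall>(n::nat) (A::nat \<Rightarrow> ereal) (B::nat \<Rightarrow> ereal) (\<epsilon>::real).
      n \<ge> 1 \<and> 0 < \<epsilon> \<and> \<epsilon> < 1/10 \<and> A \<in> {1..n} \<rightarrow> Rplus \<and> B \<in> {1..n} \<rightarrow> Rplus \<longrightarrow>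
      (\<exists>(t::nat) \<sigma>.
         exec P (input_state n A B \<epsilon>) t \<sigma> \<and>
         real t \<le> C * (real n/\<epsilon> * log 2 (1/\<epsilon>) + real n * log 2 (real n) * log 2 (1/\<epsilon>)) \<and>
         real (output_size \<sigma>) \<le> C * (1/\<epsilon> * log 2 (1/\<epsilon>) + log 2 (real n) * log 2 (1/\<epsilon>)) \<and>
         sum_to_max_covering n A B \<epsilon> (output_size \<sigma>)
           (output_vectors ''A_out'' n \<sigma>) (output_vectors ''B_out'' n \<sigma>)))"
proof -
  \<comment> \<open>The time is at most \<open>10000 * (7 * X + (Y + 2) + 1)\<close> per entry, and
    \<open>1 \<le> X\<close> turns the remaining 3 into \<open>3 * X\<close>.\<close>
  define K :: real where "K = 100000"
  have alg: "\<exists>t \<sigma>. exec covering_program (input_state n A B \<epsilon>) t \<sigma> \<and>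
      real t \<le> K * (real n/\<epsilon> * log 2 (1/\<epsilon>) + real n * log 2 (real n) * log 2 (1/\<epsilon>)) \<and>
      real (output_size \<sigma>) \<le> K * (1/\<epsilon> * log 2 (1/\<epsilon>) + log 2 (real n) * log 2 (1/\<epsilon>)) \<and>
      sum_to_max_covering n A B \<epsilon> (output_size \<sigma>) (output_vectors ''A_out'' n \<sigma>) (output_vectors ''B_out'' n \<sigma>)"
    if "n \<ge> 1 \<and> 0 < \<epsilon> \<and> \<epsilon> < 1/10 \<and> A \<in> {1..n} \<rightarrow> Rplus \<and> B \<in> {1..n} \<rightarrow> Rplus" for n A B \<epsilon>
  proof -
    interpret covering_input n A B \<epsilon> using that by unfold_locales auto
    obtain t \<sigma> where ex: "exec covering_program (input_state n A B \<epsilon>) t \<sigma>"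
      and t: "t \<le> n * (10000 * (thetas \<epsilon> + levels n + 1))"
      and s: "output_size \<sigma> = 2 * thetas \<epsilon> + 6 * levels n"
      and cov: "sum_to_max_covering n A B \<epsilon> (output_size \<sigma>) (output_vectors ''A_out'' n \<sigma>) (output_vectors ''B_out'' n \<sigma>)"
      using runs_covering_program unfolding runs_def by blast
    define X where "X = 1 / \<epsilon> * log 2 (1 / \<epsilon>)"
    define Y where "Y = log 2 (real n) * log 2 (1 / \<epsilon>)"
    have th: "real (thetas \<epsilon>) \<le> 7 * X" and X1: "1 \<le> X" using thetas_bound[OF \<epsilon>] by (simp_all add: X_def)
    have "0 \<le> log 2 (real n)" using n by simp
    \<comment> \<open>The distant pairs use only \<open>O(log n)\<close> vectors; the factor
      \<open>log 2 (1 / \<epsilon>)\<close>, being at least 1, is inserted to reach the stated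
      form.\<close>
    then have "log 2 (real n) \<le> Y" unfolding Y_def using thetas_bound(3)[OF \<epsilon>] mult_left_mono[of 1 "log 2 (1 / \<epsilon>)"] by fastforce
    then have lv: "real (levels n) \<le> Y + 2" and Y0: "0 \<le> Y"
      using levels_log[OF n] \<open>0 \<le> log 2 (real n)\<close> by linarith+
    have "real (output_size \<sigma>) \<le> K * (X + Y)"
      using th lv X1 Y0 by (simp add: s K_def)
    moreover have "real t \<le> K * (real n/\<epsilon> * log 2 (1/\<epsilon>) + real n * log 2 (real n) * log 2 (1/\<epsilon>))"
    proof -
      have "real t \<le> real (n * (10000 * (thetas \<epsilon> + levels n + 1)))" using t by (rule of_nat_mono)
      also have "\<dots> = real n * (10000 * (real (thetas \<epsilon>) + real (levels n) + 1))" by simp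
      also have "\<dots> \<le> real n * (K * (X + Y))"
        using th lv X1 Y0 by (intro mult_left_mono) (simp_all add: K_def)
      also have "\<dots> = K * (real n/\<epsilon> * log 2 (1/\<epsilon>) + real n * log 2 (real n) * log 2 (1/\<epsilon>))"
        by (simp add: X_def Y_def algebra_simps)
      finally show ?thesis .
    qed
    ultimately show ?thesis using ex cov unfolding X_def Y_def by blast
  qed
  show ?thesis
  proof (intro conjI)
    \<comment> \<open>The existence part is witnessed by the vectors that the program
      outputs.\<close>
    show "\<exists>C::real. \<forall>(n::nat) (A::nat \<Rightarrow> ereal) (B::nat \<Rightarrow> ereal) (\<epsilon>::real).
      n \<ge> 1 \<and> 0 < \<epsilon> \<and> \<epsilon> < 1/10 \<and> A \<in> {1..n} \<rightarrow> Rplus \<and> B \<in> {1..n} \<rightarrow> Rplus \<longrightarrow>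
      (\<exists>(s::nat) A' B'.
         real s \<le> C * (1/\<epsilon> * log 2 (1/\<epsilon>) + log 2 (real n) * log 2 (1/\<epsilon>)) \<and>
         sum_to_max_covering n A B \<epsilon> s A' B')"
      using alg by (intro exI[of _ K] allI impI) blast
  qed (use alg in \<open>intro exI[of _ covering_program] exI[of _ K] allI impI\<close>)
qed

end
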